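(* Let $(\mathbb I,\tau)$ be a quasi-split Satake diagram of type ADE, $\lambda$ a dominant $\tau$-invariant coweight and $\mu$ an even spherical coweight with $\lambda\ge\mu$, subject to the parity condition $c_{ij}\theta_i\theta_j=0$ for all $i\ne j\in\mathbb I$. Let ${}^\imath\mathcal Y_\mu^\lambda=\Phi_\mu^\lambda({}^\imath\mathcal Y_\mu[\boldsymbol z])\subset\mathcal A$ be the truncated shifted iYangian. Then the center of the algebra ${}^\imath\mathcal Y_\mu^\lambda$ is the polynomial algebra $\mathbb C[\boldsymbol z]$.
   Context: **Satake data.** $\mathfrak g$ is a complex simple Lie algebra of type A, D or E with Dynkin node set $\mathbb I$, Cartan matrix $(c_{ij})$, simple roots $\alpha_i$, simple coroots $\alpha_i^\vee$. $\tau$ is an automorphism of the Dynkin diagram with $\tau^2=\mathrm{id}$ ($\tau=\mathrm{id}$ allowed); $(\mathbb I,\tau)$ is called a quasi-split Satake diagram. $\mathbb I_0=\{i:\tau i=i\}$; $\mathbb I_1$ is a set of representatives of the $\tau$-orbits of length 2, $\mathbb I_{-1}=\tau\mathbb I_1$. Coweights are integral. A coweight $\mu$ is *spherical* if $\mu=\mu_1+\tau\mu_1$ for some coweight $\mu_1$, *even* if all $\langle\mu,\alpha_i\rangle$ are even. $\lambda\ge\mu$ means $\lambda-\mu\in\sum_i\mathbb N\alpha_i^\vee$. **Shifted iYangian.** $[A,B]_+=AB+BA$, $\mathrm{Sym}_{s_1,s_2}f(s_1,s_2)=f(s_1,s_2)+f(s_2,s_1)$. ${}^\imath\mathcal Y_\mu$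 is the $\mathbb C$-algebra with generators $H_i^{(r)},B_i^{(s)}$ ($i\in\mathbb I$, $r\in\mathbb Z$, $s\in\mathbb Z_{>0}$) and relations ($r,r_1,r_2\in\mathbb Z$, $s,s_1,s_2\in\mathbb Z_{>0}$): (R0) $H_i^{(r)}=0$ for $r<-\langle\mu,\alpha_i\rangle$, $H_i^{(-\langle\mu,\alpha_i\rangle)}=1$, $H_i^{(r)}=(-1)^rH_{\tau i}^{(r)}$ for all $r$; (R1) $[H_i^{(r_1)},H_j^{(r_2)}]=0$; (R2) $[H_i^{(r+2)},B_j^{(s)}]-[H_i^{(r)},B_j^{(s+2)}]=\frac{c_{ij}-c_{\tau i,j}}2[H_i^{(r+1)},B_j^{(s)}]_++\frac{c_{ij}+c_{\tau i,j}}2[H_i^{(r)},B_j^{(s+1)}]_++\frac{c_{ij}c_{\tau i,j}}4[H_i^{(r)},B_j^{(s)}]$; (R3) $[B_i^{(s_1+1)},B_j^{(s_2)}]-[B_i^{(s_1)},B_j^{(s_2+1)}]=\frac{c_{ij}}2[B_i^{(s_1)},B_j^{(s_2)}]_++2\delta_{\tau i,j}(-1)^{s_1}H_j^{(s_1+s_2)}$; (R4) if $c_{ij}=0$: $[B_i^{(s_1)},B_j^{(s_2)}]=(-1)^{s_1-1}\delta_{\tau i,j}H_j^{(s_1+s_2-1)}$; (R5) if $c_{ij}=-1$, $i\ne\tau i\ne j$: $\mathrm{Sym}_{s_1,s_2}[B_i^{(s_1)},[B_i^{(s_2)},B_j^{(s)}]]=0$; (R6) if $c_{ij}=-1$, $i=\tau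 i$: $\mathrm{Sym}_{s_1,s_2}[B_i^{(s_1)},[B_i^{(s_2)},B_j^{(s)}]]=(-1)^{s_1-1}[H_i^{(s_1+s_2)},B_j^{(s-1)}]$, where for $s=1$ one interprets $[H_i^{(r)},B_j^{(0)}]$ as $\sum_{p\ge0}2^{-2p}\big([H_i^{(r-2p-2)},B_j^{(2)}]-[H_i^{(r-2p-2)},B_j^{(1)}]_+\big)$; (R7) if $c_{i,\tau i}=-1$: $\mathrm{Sym}_{s_1,s_2}[B_i^{(s_1)},[B_i^{(s_2)},B_{\tau i}^{(s)}]]=4\,\mathrm{Sym}_{s_1,s_2}(-1)^{s_1-1}\sum_{p\ge0}3^{-p-1}[B_i^{(s_2+p)},H_{\tau i}^{(s_1+s-p-1)}]$. Put $H_i(u)=\sum_{r\in\mathbb Z}H_i^{(r)}u^{-r}$, $B_i(u)=\sum_{s>0}B_i^{(s)}u^{-s}$. **Numerical data.** Write $\lambda-\mu=\sum_i\mathbf v_i\alpha_i^\vee$ ($\mathbf v_i\in\mathbb N$), $\mathbf w_i=\langle\lambda,\alpha_i\rangle$. If $\tau i\ne i$: $\mathfrak v_i=\mathbf v_i$, $\theta_i=0$, $\mathfrak w_i=\mathbf w_i$, $\varsigma_i=0$. If $\tau i=i$: $\mathfrak v_i=\lfloor\mathbf v_i/2\rfloor$, $\mathfrak w_i=\lfloor\mathbf w_i/2\rfloor$, and $\theta_i,\varsigma_i\in\{0,1\}$ are the parities of $\mathbf v_i,\mathbf w_i$. Set $\vartheta_i=\theta_i$ if $\tau i\neq i$, and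 $\vartheta_i=\max\{\theta_j:c_{ij}\ne0\}$ if $\tau i=i$. For $i\in\mathbb I_1$ fix an integer $\zeta_i$ with $1\le\zeta_i\le\mathfrak v_i$ ($\zeta_i=0$ if $\mathfrak v_i=0$), and put $\zeta_{\tau i}=\mathfrak v_i-\zeta_i$. **Orientation.** $i\leftrightarrow j$ means adjacent in the Dynkin diagram. Fix an orientation such that for each $i$ with $i\ne\tau i$: if $i\to j$ then $\tau j\to\tau i$, and if $j\to i$ then $\tau i\to\tau j$. $\wp_i=1$ if $i\leftarrow\tau i$, $\wp_i=-1$ if $i\to\tau i$, $\wp_i=0$ if $c_{i,\tau i}\in\{0,2\}$. **The target ring.** $\mathbb C[\boldsymbol z]=\mathbb C[z_{i,s}:i\in\mathbb I_0\cup\mathbb I_1,1\le s\le\mathfrak w_i]$, ${}^\imath\mathcal Y_\mu[\boldsymbol z]={}^\imath\mathcal Y_\mu\otimes\mathbb C[\boldsymbol z]$. $\mathcal A$ is the $\mathbb C[\boldsymbol z]$-algebra generated by $w_{i,r},\eth_{i,r}^{\pm1},(w_{i,r}\pm w_{i,r'}+m)^{-1},(w_{i,r}+\frac m2)^{-1}$ for $i\in\mathbb I_0\cup\mathbb I_1$, $1\le r\neq r'\le\mathfrak v_i$, $m\in\mathbb Z$, with $[\eth_{i,r}^{\pm1},w_{j,r'}]=\pm\delta_{ij}\delta_{r,r'}\eth_{i,r}^{\pm1}$, $[w_{i,r},w_{j,r'}]=[\eth_{i,r},\eth_{j,r'}]=0$, $\eth_{i,r}^{\pm1}\eth_{i,r}^{\mp1}=1$.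 For $i\in\mathbb I_1$ set $z_{\tau i,s}=-z_{i,s}$, $w_{\tau i,r}=-w_{i,\mathfrak v_i+1-r}$, $\eth_{\tau i,r}=\eth_{i,\mathfrak v_i+1-r}^{-1}$. **Polynomials.** For monic $f$, $f^-(u)=(-1)^{\deg f}f(-u)$. $\varkappa(u)=1-\frac1{2u}$, $\mathbf K(u)=1-\frac1{4u^2}$. For $i\in\mathbb I_0$: $W_i(u)=\prod_{r=1}^{\mathfrak v_i}(u-w_{i,r})$, $Z_i(u)=\prod_{s=1}^{\mathfrak w_i}(u-z_{i,s})$, $\mathbf W_i^\circ(u)=\prod_{r=1}^{\mathfrak v_i}(u^2-w_{i,r}^2)$, $\mathbf W_i(u)=u^{\theta_i}\mathbf W_i^\circ(u)$, $\mathbf Z_i(u)=u^{\varsigma_i}\prod_{s=1}^{\mathfrak w_i}(u^2-z_{i,s}^2)$, $\mathbf W_{i,r}(u)=u^{\theta_i}(u+w_{i,r})\prod_{s\ne r}(u^2-w_{i,s}^2)$, $\overline W_i^-(u)=u^{\theta_i}W_i^-(u)$, $\overline Z_i^-(u)=u^{\varsigma_i}Z_i^-(u)$. For $i\in\mathbb I_1\cup\mathbb I_{-1}$: $W_i(u)=\prod_{r=1}^{\zeta_i}(u-w_{i,r})$, $\mathbf W_i(u)=\prod_{r=1}^{\mathfrak v_i}(u-w_{i,r})$, $\mathbf W_{i,r}(u)=\prod_{s\ne r}(u-w_{i,s})$, $\mathbf Z_i(u)=\prod_{s=1}^{\mathfrak w_i}(u-z_{i,s})$, and $Z_i(u)$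 are fixed monic polynomials with $\mathbf Z_i(u)=Z_i(u)Z_{\tau i}^-(u)$. **The homomorphism.** $\Phi_\mu^\lambda:{}^\imath\mathcal Y_\mu[\boldsymbol z]\to\mathcal A$ is the $\mathbb C[\boldsymbol z]$-algebra homomorphism (known to exist) given, with rational functions of $u$ expanded in $u^{-1}$, by $$H_i(u)\mapsto\Big(1+\frac{\wp_i}{4u}\Big)\frac{\mathbf K(u)^{\vartheta_i}\mathbf Z_i(u)}{\mathbf W_i(u-\frac12)\mathbf W_i(u+\frac12)}\prod_{j\leftrightarrow i}\mathbf W_j(u)\quad(i\in\mathbb I),$$ for $i\in\mathbb I\setminus\mathbb I_0$: $$B_i(u)\mapsto-\sum_{r=1}^{\zeta_i}\frac{Z_i(w_{i,r}-\frac12)}{(u+\frac12-w_{i,r})\mathbf W_{i,r}(w_{i,r})}\prod_{j\to i}\mathbf W_j(w_{i,r}-\tfrac12)\eth_{i,r}^{-1}-\sum_{r=1}^{\zeta_{\tau i}}\frac{Z_i^-(w_{\tau i,r}+\frac12)}{(u+\frac12+w_{\tau i,r})\mathbf W_{\tau i,r}(w_{\tau i,r})}\prod_{\tau j\leftarrow\tau i}\mathbf W_{\tau j}(w_{\tau i,r}+\tfrac12)\eth_{\tau i,r},$$ and for $i\in\mathbb I_0$: $$\begin{aligned}B_i(u)\mapsto&-\sum_{r=1}^{\mathfrak v_i}\frac{\varkappa(w_{i,r})^{-\vartheta_i}Z_i(w_{i,r}-\frac12)}{(u+\frac12-w_{i,r})\mathbf W_{i,r}(w_{i,r})}\prod_{j\to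 i}\mathbf W_j(w_{i,r}-\tfrac12)\prod_{j\leftarrow i,j\in\mathbb I_0}\overline W_j^-(w_{i,r}-\tfrac12)\eth_{i,r}^{-1}\\&-\sum_{r=1}^{\mathfrak v_i}\frac{\varkappa(-w_{i,r})^{-\vartheta_i}\overline Z_i^-(w_{i,r}+\frac12)}{(u+\frac12+w_{i,r})\mathbf W_{i,r}(w_{i,r})}\prod_{j\leftarrow i,j\in\mathbb I_1\cup\mathbb I_{-1}}\mathbf W_j(w_{i,r}+\tfrac12)\prod_{j\leftarrow i,j\in\mathbb I_0}W_j(w_{i,r}+\tfrac12)\eth_{i,r}\\&+\sqrt{(-1)^{\mathfrak w_i+\sum_{j\leftrightarrow i,j\in\mathbb I_0\cup\mathbb I_1}\mathfrak v_j}}\,\frac{\theta_iZ_i(0)}{u\,\mathbf W_i^\circ(\frac12)}\prod_{j\leftrightarrow i}W_j(0).\end{aligned}$$ *)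

theory Defs
  imports
    "HOL-Library.Poly_Mapping"
    "HOL-Computational_Algebra.Formal_Laurent_Series"
    "HOL-Algebra.QuotRing"
begin

section \<open>Algebras given by generators and relations over polynomial coefficients\<close>

text \<open>Polynomials in commuting variables \<open>z\<^sub>i\<^sub>,\<^sub>s\<close>; the admissible pairs \<open>(i, s)\<close> are cut out by
  the carrier of \<open>Cz\<close> below.\<close>

type_synonym zpoly = "((nat \<times> nat) \<Rightarrow>\<^sub>0 nat) \<Rightarrow>\<^sub>0 complex"

text \<open>With concatenation as addition, lists form the free monoid, so \<open>'g list \<Rightarrow>\<^sub>0 zpoly\<close>, with the
  convolution product of \<open>Poly_Mapping\<close>, is the free associative algebra with central
  coefficients.\<close>

instantiation list :: (type) monoid_add
begin
definition zero_list :: "'a list" where "zero_list = []"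
definition plus_list :: "'a list \<Rightarrow> 'a list \<Rightarrow> 'a list" where "plus_list xs ys = xs @ ys"
instance by standard (simp_all add: zero_list_def plus_list_def)
end

type_synonym 'g free = "'g list \<Rightarrow>\<^sub>0 zpoly"

definition free_gen :: "'g \<Rightarrow> 'g free"
  where "free_gen g = Poly_Mapping.single [g] 1"

definition scal :: "zpoly \<Rightarrow> 'g free"
  where "scal c = Poly_Mapping.single [] c"

definition cst :: "complex \<Rightarrow> 'g free"
  where "cst a = scal (Poly_Mapping.single 0 a)"

definition subring_record :: "'a::ring_1 set \<Rightarrow> 'a ring"
  where "subring_record S =
    \<lparr>carrier = S, monoid.mult = (*), one = 1, ring.zero = 0, add = (+)\<rparr>"

definition free_algebra :: "zpoly set \<Rightarrow> 'g set \<Rightarrow> 'g free ring"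
  where "free_algebra K X = subring_record
    {p. \<forall>xs. Poly_Mapping.lookup p xs \<in> K \<and>
            (Poly_Mapping.lookup p xs \<noteq> 0 \<longrightarrow> set xs \<subseteq> X)}"

text \<open>An element \<open>p\<close> of the set \<open>R\<close> of relators stands for the relation \<open>p = 0\<close>.\<close>

definition presented :: "zpoly set \<Rightarrow> 'g set \<Rightarrow> 'g free set \<Rightarrow> 'g free set ring"
  where "presented K X R = free_algebra K X Quot (Idl\<^bsub>free_algebra K X\<^esub> R)"

definition presented_class :: "zpoly set \<Rightarrow> 'g set \<Rightarrow> 'g free set \<Rightarrow> 'g free \<Rightarrow> 'g free set"
  where "presented_class K X R p = (Idl\<^bsub>free_algebra K X\<^esub> R) +>\<^bsub>free_algebra K X\<^esub> p"

definition ring_center :: "('a, 'b) ring_scheme \<Rightarrow> 'a set"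
  where "ring_center R = {x \<in> carrier R. \<forall>y \<in> carrier R. x \<otimes>\<^bsub>R\<^esub> y = y \<otimes>\<^bsub>R\<^esub> x}"

definition commut :: "'a::ring_1 \<Rightarrow> 'a \<Rightarrow> 'a"
  where "commut a b = a * b - b * a"

definition anticommut :: "'a::ring_1 \<Rightarrow> 'a \<Rightarrow> 'a"
  where "anticommut a b = a * b + b * a"

definition Sym :: "(nat \<Rightarrow> nat \<Rightarrow> 'a::ring_1) \<Rightarrow> nat \<Rightarrow> nat \<Rightarrow> 'a"
  where "Sym f s1 s2 = f s1 s2 + f s2 s1"


section \<open>Dynkin diagrams of type ADE\<close>

text \<open>Nodes are numbered \<open>1, \<dots>, n\<close> as in Bourbaki.\<close>

datatype dynkin = TypeA nat | TypeD nat | TypeE nat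

fun dynkin_ok :: "dynkin \<Rightarrow> bool" where
  "dynkin_ok (TypeA n) \<longleftrightarrow> n \<ge> 1"
| "dynkin_ok (TypeD n) \<longleftrightarrow> n \<ge> 4"
| "dynkin_ok (TypeE n) \<longleftrightarrow> n \<in> {6, 7, 8}"

fun dynkin_rank :: "dynkin \<Rightarrow> nat" where
  "dynkin_rank (TypeA n) = n"
| "dynkin_rank (TypeD n) = n"
| "dynkin_rank (TypeE n) = n"

text \<open>\<open>dynkin_edge X i j\<close> with \<open>i < j\<close>.\<close>

fun dynkin_edge :: "dynkin \<Rightarrow> nat \<Rightarrow> nat \<Rightarrow> bool" where
  "dynkin_edge (TypeA n) i j \<longleftrightarrow> 1 \<le> i \<and> j = i + 1 \<and> j \<le> n"
| "dynkin_edge (TypeD n) i j \<longleftrightarrow> 1 \<le> i \<and> (j = i + 1 \<and> j < n \<or> i = n - 2 \<and> j = n)"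
| "dynkin_edge (TypeE n) i j \<longleftrightarrow> (i, j) \<in> {(1, 3), (2, 4)} \<or> (3 \<le> i \<and> j = i + 1 \<and> j \<le> n)"

definition cartan :: "dynkin \<Rightarrow> nat \<Rightarrow> nat \<Rightarrow> int"
  where "cartan X i j = (if i = j then 2 else if dynkin_edge X i j \<or> dynkin_edge X j i then -1 else 0)"


section \<open>Satake data\<close>

text \<open>A coweight is represented by its pairings \<open>i \<mapsto> \<langle>\<mu>, \<alpha>\<^sub>i\<rangle>\<close> with the simple roots; only the
  values at nodes matter. \<open>mult_of i\<close> is the coefficient of the \<open>i\<close>-th simple coroot in
  \<open>lam - mu\<close>, \<open>reps\<close> is the set of representatives of the two-element \<open>tau\<close>-orbits, and
  \<open>arrow i j\<close> means \<open>i \<rightarrow> j\<close>. \<open>Zfac i\<close> is the chosen factor \<open>Z\<^sub>i\<close> for nodes not fixed by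
  \<open>tau\<close>.\<close>

record satake =
  dyn :: dynkin
  tau :: "nat \<Rightarrow> nat"
  lam :: "nat \<Rightarrow> int"
  mu :: "nat \<Rightarrow> int"
  mult_of :: "nat \<Rightarrow> nat"
  reps :: "nat set"
  zeta :: "nat \<Rightarrow> nat"
  arrow :: "nat \<Rightarrow> nat \<Rightarrow> bool"
  Zfac :: "nat \<Rightarrow> zpoly poly"

definition node_list :: "satake \<Rightarrow> nat list"
  where "node_list D = [1..<Suc (dynkin_rank (dyn D))]"

definition nodes :: "satake \<Rightarrow> nat set"
  where "nodes D = set (node_list D)"

definition cij :: "satake \<Rightarrow> nat \<Rightarrow> nat \<Rightarrow> int"
  where "cij D = cartan (dyn D)"

definition quasi_split_satake :: "satake \<Rightarrow> bool"
  where "quasi_split_satake D \<longleftrightarrow> dynkin_ok (dyn D) \<and>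
    (\<forall>i\<in>nodes D. tau D i \<in> nodes D \<and> tau D (tau D i) = i) \<and>
    (\<forall>i\<in>nodes D. \<forall>j\<in>nodes D. cij D (tau D i) (tau D j) = cij D i j)"

definition tau_fixed :: "satake \<Rightarrow> nat \<Rightarrow> bool"
  where "tau_fixed D i \<longleftrightarrow> tau D i = i"

definition orbit_reps :: "satake \<Rightarrow> bool"
  where "orbit_reps D \<longleftrightarrow> reps D \<subseteq> {i\<in>nodes D. \<not> tau_fixed D i} \<and>
    (\<forall>i\<in>nodes D. \<not> tau_fixed D i \<longrightarrow> (i \<in> reps D) \<noteq> (tau D i \<in> reps D))"

text \<open>\<open>I\<^sub>0 \<union> I\<^sub>1\<close>\<close>

definition tau_base :: "satake \<Rightarrow> nat set"
  where "tau_base D = {i\<in>nodes D. tau_fixed D i} \<union> reps D"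

definition dominant :: "satake \<Rightarrow> (nat \<Rightarrow> int) \<Rightarrow> bool"
  where "dominant D x \<longleftrightarrow> (\<forall>i\<in>nodes D. 0 \<le> x i)"

text \<open>\<open>tau\<close> acts on coweights by \<open>\<langle>\<tau>\<mu>, \<alpha>\<^sub>i\<rangle> = \<langle>\<mu>, \<alpha>\<^sub>\<tau>\<^sub>i\<rangle>\<close>.\<close>

definition tau_invariant :: "satake \<Rightarrow> (nat \<Rightarrow> int) \<Rightarrow> bool"
  where "tau_invariant D x \<longleftrightarrow> (\<forall>i\<in>nodes D. x (tau D i) = x i)"

definition spherical :: "satake \<Rightarrow> (nat \<Rightarrow> int) \<Rightarrow> bool"
  where "spherical D x \<longleftrightarrow> (\<exists>y. \<forall>i\<in>nodes D. x i = y i + y (tau D i))"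

definition even_coweight :: "satake \<Rightarrow> (nat \<Rightarrow> int) \<Rightarrow> bool"
  where "even_coweight D x \<longleftrightarrow> (\<forall>i\<in>nodes D. even (x i))"

definition difference_coroots :: "satake \<Rightarrow> bool"
  where "difference_coroots D \<longleftrightarrow>
    (\<forall>i\<in>nodes D. lam D i - mu D i = (\<Sum>j\<in>nodes D. int (mult_of D j) * cij D j i))"

text \<open>\<open>vfr\<close>, \<open>wfr\<close> are the fraktur \<open>\<vv>, \<ww>\<close>; \<open>theta\<close>, \<open>varsig\<close>, \<open>vtheta\<close> are
  \<open>\<theta>, \<varsigma>, \<vartheta>\<close>.\<close>

definition vfr :: "satake \<Rightarrow> nat \<Rightarrow> nat"
  where "vfr D i = (if tau_fixed D i then mult_of D i div 2 else mult_of D i)"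

definition theta :: "satake \<Rightarrow> nat \<Rightarrow> nat"
  where "theta D i = (if tau_fixed D i then mult_of D i mod 2 else 0)"

definition wfr :: "satake \<Rightarrow> nat \<Rightarrow> nat"
  where "wfr D i = (if tau_fixed D i then nat (lam D i) div 2 else nat (lam D i))"

definition varsig :: "satake \<Rightarrow> nat \<Rightarrow> nat"
  where "varsig D i = (if tau_fixed D i then nat (lam D i) mod 2 else 0)"

definition vtheta :: "satake \<Rightarrow> nat \<Rightarrow> nat"
  where "vtheta D i =
    (if tau_fixed D i then Max (theta D ` {j\<in>nodes D. cij D i j \<noteq> 0}) else theta D i)"

definition parity_condition :: "satake \<Rightarrow> bool"
  where "parity_condition D \<longleftrightarrow> (\<forall>i\<in>nodes D. \<forall>j\<in>nodes D. i \<noteq> j \<longrightarrow>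
    cij D i j * int (theta D i) * int (theta D j) = 0)"

definition zeta_ok :: "satake \<Rightarrow> bool"
  where "zeta_ok D \<longleftrightarrow> (\<forall>i\<in>reps D.
    (if vfr D i = 0 then zeta D i = 0 else 1 \<le> zeta D i \<and> zeta D i \<le> vfr D i) \<and>
    zeta D (tau D i) = vfr D i - zeta D i)"

definition orientation :: "satake \<Rightarrow> bool"
  where "orientation D \<longleftrightarrow>
    (\<forall>i j. arrow D i j \<longrightarrow> i \<in> nodes D \<and> j \<in> nodes D \<and> cij D i j = -1) \<and>
    (\<forall>i\<in>nodes D. \<forall>j\<in>nodes D. cij D i j = -1 \<longrightarrow> arrow D i j \<noteq> arrow D j i) \<and>
    (\<forall>i\<in>nodes D. \<forall>j\<in>nodes D. \<not> tau_fixed D i \<longrightarrow>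
       (arrow D i j \<longrightarrow> arrow D (tau D j) (tau D i)) \<and>
       (arrow D j i \<longrightarrow> arrow D (tau D i) (tau D j)))"

definition wp :: "satake \<Rightarrow> nat \<Rightarrow> int"
  where "wp D i = (if arrow D (tau D i) i then 1 else if arrow D i (tau D i) then -1 else 0)"


section \<open>The ring \<open>\<complex>[z]\<close> and the polynomials \<open>Z\<close>\<close>

definition Cz :: "satake \<Rightarrow> zpoly ring"
  where "Cz D = subring_record
    {p. \<forall>m \<in> Poly_Mapping.keys p.
       Poly_Mapping.keys m \<subseteq> {(i, s). i \<in> tau_base D \<and> 1 \<le> s \<and> s \<le> wfr D i}}"

definition zvar :: "satake \<Rightarrow> nat \<Rightarrow> nat \<Rightarrow> zpoly"
  where "zvar D i s =
    (if i \<in> tau_base D then Poly_Mapping.single (Poly_Mapping.single (i, s) 1) 1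
     else - Poly_Mapping.single (Poly_Mapping.single (tau D i, s) 1) 1)"

definition poly_minus :: "zpoly poly \<Rightarrow> zpoly poly"
  where "poly_minus f = Polynomial.smult ((-1) ^ Polynomial.degree f) (pcompose f [:0, -1:])"

definition Zpol :: "satake \<Rightarrow> nat \<Rightarrow> zpoly poly"
  where "Zpol D i = (if tau_fixed D i then (\<Prod>s=1..wfr D i. [:- zvar D i s, 1:]) else Zfac D i)"

definition Zbold :: "satake \<Rightarrow> nat \<Rightarrow> zpoly poly"
  where "Zbold D i =
    (if tau_fixed D i
     then Polynomial.monom 1 (varsig D i) * (\<Prod>s=1..wfr D i. [:- (zvar D i s)\<^sup>2, 0, 1:])
     else (\<Prod>s=1..wfr D i. [:- zvar D i s, 1:]))"

definition Zbar_minus :: "satake \<Rightarrow> nat \<Rightarrow> zpoly poly"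
  where "Zbar_minus D i = Polynomial.monom 1 (varsig D i) * poly_minus (Zpol D i)"

definition Z_factorization :: "satake \<Rightarrow> bool"
  where "Z_factorization D \<longleftrightarrow> (\<forall>i\<in>nodes D. \<not> tau_fixed D i \<longrightarrow>
    (\<forall>k. Polynomial.coeff (Zfac D i) k \<in> carrier (Cz D)) \<and>
    Polynomial.lead_coeff (Zfac D i) = 1 \<and>
    Zbold D i = Zfac D i * poly_minus (Zfac D (tau D i)))"


section \<open>The shifted iYangian\<close>

datatype yletter = Hl nat int | Bl nat nat

abbreviation Hgen :: "nat \<Rightarrow> int \<Rightarrow> yletter free" where "Hgen i r \<equiv> free_gen (Hl i r)"
abbreviation Bgen :: "nat \<Rightarrow> nat \<Rightarrow> yletter free" where "Bgen i s \<equiv> free_gen (Bl i s)"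

definition iY_gens :: "satake \<Rightarrow> yletter set"
  where "iY_gens D = {Hl i r | i r. i \<in> nodes D} \<union> {Bl i s | i s. i \<in> nodes D \<and> 1 \<le> s}"

text \<open>\<open>HB0 D i j r\<close> is the interpretation of \<open>[H\<^sub>i\<^sup>(\<^sup>r\<^sup>), B\<^sub>j\<^sup>(\<^sup>0\<^sup>)]\<close>. Here and in \<open>R7\<close> the sum over
  \<open>p \<ge> 0\<close> is truncated to those \<open>p\<close> for which the \<open>H\<close>-generator is not zero by \<open>R0_low\<close>.\<close>

definition HB0 :: "satake \<Rightarrow> nat \<Rightarrow> nat \<Rightarrow> int \<Rightarrow> yletter free"
  where "HB0 D i j r = (\<Sum>p | - mu D i \<le> r - 2 * int p - 2.
    cst ((1 / 2) ^ (2 * p)) *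
      (commut (Hgen i (r - 2 * int p - 2)) (Bgen j 2)
       - anticommut (Hgen i (r - 2 * int p - 2)) (Bgen j 1)))"

inductive_set iY_relators :: "satake \<Rightarrow> yletter free set" for D :: satake where
  R0_low: "\<lbrakk>i \<in> nodes D; r < - mu D i\<rbrakk> \<Longrightarrow> Hgen i r \<in> iY_relators D"
| R0_lead: "i \<in> nodes D \<Longrightarrow> Hgen i (- mu D i) - 1 \<in> iY_relators D"
| R0_sym: "i \<in> nodes D \<Longrightarrow> Hgen i r - cst ((-1) powi r) * Hgen (tau D i) r \<in> iY_relators D"
| R1: "\<lbrakk>i \<in> nodes D; j \<in> nodes D\<rbrakk> \<Longrightarrow> commut (Hgen i r1) (Hgen j r2) \<in> iY_relators D"
| R2: "\<lbrakk>i \<in> nodes D; j \<in> nodes D; 1 \<le> s\<rbrakk> \<Longrightarrow>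
    (commut (Hgen i (r + 2)) (Bgen j s) - commut (Hgen i r) (Bgen j (s + 2)))
    - (cst (of_int (cij D i j - cij D (tau D i) j) / 2) * anticommut (Hgen i (r + 1)) (Bgen j s)
       + cst (of_int (cij D i j + cij D (tau D i) j) / 2) * anticommut (Hgen i r) (Bgen j (s + 1))
       + cst (of_int (cij D i j * cij D (tau D i) j) / 4) * commut (Hgen i r) (Bgen j s))
    \<in> iY_relators D"
| R3: "\<lbrakk>i \<in> nodes D; j \<in> nodes D; 1 \<le> s1; 1 \<le> s2\<rbrakk> \<Longrightarrow>
    (commut (Bgen i (s1 + 1)) (Bgen j s2) - commut (Bgen i s1) (Bgen j (s2 + 1)))
    - (cst (of_int (cij D i j) / 2) * anticommut (Bgen i s1) (Bgen j s2)
       + cst (2 * of_bool (tau D i = j) * (-1) ^ s1) * Hgen j (int (s1 + s2)))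
    \<in> iY_relators D"
| R4: "\<lbrakk>i \<in> nodes D; j \<in> nodes D; 1 \<le> s1; 1 \<le> s2; cij D i j = 0\<rbrakk> \<Longrightarrow>
    commut (Bgen i s1) (Bgen j s2)
    - cst ((-1) ^ (s1 - 1) * of_bool (tau D i = j)) * Hgen j (int (s1 + s2) - 1)
    \<in> iY_relators D"
| R5: "\<lbrakk>i \<in> nodes D; j \<in> nodes D; 1 \<le> s; 1 \<le> s1; 1 \<le> s2;
        cij D i j = -1; i \<noteq> tau D i; tau D i \<noteq> j\<rbrakk> \<Longrightarrow>
    Sym (\<lambda>s1 s2. commut (Bgen i s1) (commut (Bgen i s2) (Bgen j s))) s1 s2 \<in> iY_relators D"
| R6: "\<lbrakk>i \<in> nodes D; j \<in> nodes D; 1 \<le> s; 1 \<le> s1; 1 \<le> s2;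
        cij D i j = -1; i = tau D i\<rbrakk> \<Longrightarrow>
    Sym (\<lambda>s1 s2. commut (Bgen i s1) (commut (Bgen i s2) (Bgen j s))) s1 s2
    - cst ((-1) ^ (s1 - 1)) *
      (if s = 1 then HB0 D i j (int (s1 + s2)) else commut (Hgen i (int (s1 + s2))) (Bgen j (s - 1)))
    \<in> iY_relators D"
| R7: "\<lbrakk>i \<in> nodes D; 1 \<le> s; 1 \<le> s1; 1 \<le> s2; cij D i (tau D i) = -1\<rbrakk> \<Longrightarrow>
    Sym (\<lambda>s1 s2. commut (Bgen i s1) (commut (Bgen i s2) (Bgen (tau D i) s))) s1 s2
    - 4 * Sym (\<lambda>s1 s2. cst ((-1) ^ (s1 - 1)) *
        (\<Sum>p | - mu D (tau D i) \<le> int (s1 + s) - int p - 1.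
           cst ((1 / 3) ^ (p + 1)) *
           commut (Bgen i (s2 + p)) (Hgen (tau D i) (int (s1 + s) - int p - 1)))) s1 s2
    \<in> iY_relators D"

text \<open>For the ring \<open>K\<close> of constants this is the shifted iYangian over \<open>\<complex>\<close>; the coefficients of the
  relators are complex numbers, so for \<open>K = \<complex>[z]\<close> one obtains its tensor product with \<open>\<complex>[z]\<close>.\<close>

definition shifted_iYangian :: "satake \<Rightarrow> zpoly set \<Rightarrow> yletter free set ring"
  where "shifted_iYangian D K = presented K (iY_gens D) (iY_relators D)"

definition iYz :: "satake \<Rightarrow> yletter free set ring"
  where "iYz D = shifted_iYangian D (carrier (Cz D))"

definition iYz_class :: "satake \<Rightarrow> yletter free \<Rightarrow> yletter free set"
  where "iYz_class D = presented_class (carrier (Cz D)) (iY_gens D) (iY_relators D)"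


section \<open>The target algebra\<close>

text \<open>\<open>PlusInv i r r' m\<close>, \<open>MinusInv i r r' m\<close>, \<open>HalfInv i r m\<close> are the inverses of
  \<open>w\<^sub>i\<^sub>,\<^sub>r + w\<^sub>i\<^sub>,\<^sub>r\<^sub>' + m\<close>, \<open>w\<^sub>i\<^sub>,\<^sub>r - w\<^sub>i\<^sub>,\<^sub>r\<^sub>' + m\<close> and \<open>w\<^sub>i\<^sub>,\<^sub>r + m/2\<close>.\<close>

datatype aletter = Wl nat nat | Eth nat nat | EthInv nat nat
  | PlusInv nat nat nat int | MinusInv nat nat nat int | HalfInv nat nat int

definition A_index :: "satake \<Rightarrow> (nat \<times> nat) set"
  where "A_index D = {(i, r). i \<in> tau_base D \<and> 1 \<le> r \<and> r \<le> vfr D i}"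

definition A_gens :: "satake \<Rightarrow> aletter set"
  where "A_gens D =
    (\<Union>(i, r)\<in>A_index D. {Wl i r, Eth i r, EthInv i r} \<union> {HalfInv i r m | m. True}) \<union>
    {PlusInv i r r' m | i r r' m. (i, r) \<in> A_index D \<and> (i, r') \<in> A_index D \<and> r \<noteq> r'} \<union>
    {MinusInv i r r' m | i r r' m. (i, r) \<in> A_index D \<and> (i, r') \<in> A_index D \<and> r \<noteq> r'}"

inductive_set A_relators :: "satake \<Rightarrow> aletter free set" for D :: satake where
  w_w: "\<lbrakk>(i, r) \<in> A_index D; (j, r') \<in> A_index D\<rbrakk> \<Longrightarrow>
    commut (free_gen (Wl i r)) (free_gen (Wl j r')) \<in> A_relators D"
| eth_eth: "\<lbrakk>(i, r) \<in> A_index D; (j, r') \<in> A_index D\<rbrakk> \<Longrightarrow>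
    commut (free_gen (Eth i r)) (free_gen (Eth j r')) \<in> A_relators D"
| eth_w: "\<lbrakk>(i, r) \<in> A_index D; (j, r') \<in> A_index D\<rbrakk> \<Longrightarrow>
    commut (free_gen (Eth i r)) (free_gen (Wl j r')) - of_bool (i = j \<and> r = r') * free_gen (Eth i r)
    \<in> A_relators D"
| ethinv_w: "\<lbrakk>(i, r) \<in> A_index D; (j, r') \<in> A_index D\<rbrakk> \<Longrightarrow>
    commut (free_gen (EthInv i r)) (free_gen (Wl j r')) + of_bool (i = j \<and> r = r') * free_gen (EthInv i r)
    \<in> A_relators D"
| eth_ethinv: "(i, r) \<in> A_index D \<Longrightarrow> free_gen (Eth i r) * free_gen (EthInv i r) - 1 \<in> A_relators D"
| ethinv_eth: "(i, r) \<in> A_index D \<Longrightarrow> free_gen (EthInv i r) * free_gen (Eth i r) - 1 \<in> A_relators D"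
| plus_inv_right: "\<lbrakk>(i, r) \<in> A_index D; (i, r') \<in> A_index D; r \<noteq> r'\<rbrakk> \<Longrightarrow>
    (free_gen (Wl i r) + free_gen (Wl i r') + of_int m) * free_gen (PlusInv i r r' m) - 1 \<in> A_relators D"
| plus_inv_left: "\<lbrakk>(i, r) \<in> A_index D; (i, r') \<in> A_index D; r \<noteq> r'\<rbrakk> \<Longrightarrow>
    free_gen (PlusInv i r r' m) * (free_gen (Wl i r) + free_gen (Wl i r') + of_int m) - 1 \<in> A_relators D"
| minus_inv_right: "\<lbrakk>(i, r) \<in> A_index D; (i, r') \<in> A_index D; r \<noteq> r'\<rbrakk> \<Longrightarrow>
    (free_gen (Wl i r) - free_gen (Wl i r') + of_int m) * free_gen (MinusInv i r r' m) - 1 \<in> A_relators D"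
| minus_inv_left: "\<lbrakk>(i, r) \<in> A_index D; (i, r') \<in> A_index D; r \<noteq> r'\<rbrakk> \<Longrightarrow>
    free_gen (MinusInv i r r' m) * (free_gen (Wl i r) - free_gen (Wl i r') + of_int m) - 1 \<in> A_relators D"
| half_inv_right: "(i, r) \<in> A_index D \<Longrightarrow>
    (free_gen (Wl i r) + cst (of_int m / 2)) * free_gen (HalfInv i r m) - 1 \<in> A_relators D"
| half_inv_left: "(i, r) \<in> A_index D \<Longrightarrow>
    free_gen (HalfInv i r m) * (free_gen (Wl i r) + cst (of_int m / 2)) - 1 \<in> A_relators D"

definition A_alg :: "satake \<Rightarrow> aletter free set ring"
  where "A_alg D = presented (carrier (Cz D)) (A_gens D) (A_relators D)"

definition A_class :: "satake \<Rightarrow> aletter free \<Rightarrow> aletter free set"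
  where "A_class D = presented_class (carrier (Cz D)) (A_gens D) (A_relators D)"


section \<open>Generating series of the images of the generators\<close>

text \<open>The series are written with coefficients in the free algebra over the generators of the
  target algebra: the formal variable \<open>fls_X\<close> is \<open>u\<^sup>-\<^sup>1\<close>, so \<open>fls_X_inv\<close> is \<open>u\<close> and \<open>fls_nth f r\<close> is
  the coefficient of \<open>u\<^sup>-\<^sup>r\<close>. Products over sets become list products; the order of the factors is
  immaterial in the target algebra, where all the \<open>w\<close> and their inverses commute.\<close>

type_synonym series = "aletter free fls"

definition num_series :: "complex \<Rightarrow> series"
  where "num_series a = fls_const (cst a)"

abbreviation half_series :: series where "half_series \<equiv> num_series (1 / 2)"

text \<open>The expansion of \<open>1 / (u + a)\<close> in \<open>u\<^sup>-\<^sup>1\<close>.\<close>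

definition recip_series :: "aletter free \<Rightarrow> series"
  where "recip_series a = fls_X * fps_to_fls (Abs_fps (\<lambda>k. (- a) ^ k))"

definition zeval :: "zpoly poly \<Rightarrow> series \<Rightarrow> series"
  where "zeval f x =
    (\<Sum>k\<le>Polynomial.degree f. fls_const (scal (Polynomial.coeff f k)) * x ^ k)"

definition w_free :: "satake \<Rightarrow> nat \<Rightarrow> nat \<Rightarrow> aletter free"
  where "w_free D i r =
    (if i \<in> tau_base D then free_gen (Wl i r) else - free_gen (Wl (tau D i) (vfr D i + 1 - r)))"

definition w_series :: "satake \<Rightarrow> nat \<Rightarrow> nat \<Rightarrow> series"
  where "w_series D i r = fls_const (w_free D i r)"

definition eth_series :: "satake \<Rightarrow> nat \<Rightarrow> nat \<Rightarrow> series"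
  where "eth_series D i r = fls_const
    (if i \<in> tau_base D then free_gen (Eth i r) else free_gen (EthInv (tau D i) (vfr D i + 1 - r)))"

definition eth_inv_series :: "satake \<Rightarrow> nat \<Rightarrow> nat \<Rightarrow> series"
  where "eth_inv_series D i r = fls_const
    (if i \<in> tau_base D then free_gen (EthInv i r) else free_gen (Eth (tau D i) (vfr D i + 1 - r)))"

definition half_inv_series :: "nat \<Rightarrow> nat \<Rightarrow> int \<Rightarrow> series"
  where "half_inv_series i r m = fls_const (free_gen (HalfInv i r m))"

text \<open>\<open>(w\<^sub>i\<^sub>,\<^sub>r - w\<^sub>i\<^sub>,\<^sub>s)\<^sup>-\<^sup>1\<close>; off the representatives it is rewritten using
  \<open>w\<^sub>\<tau>\<^sub>i\<^sub>,\<^sub>r = - w\<^sub>i\<^sub>,\<^sub>v\<^sub>+\<^sub>1\<^sub>-\<^sub>r\<close>.\<close>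

definition minus_inv_series :: "satake \<Rightarrow> nat \<Rightarrow> nat \<Rightarrow> nat \<Rightarrow> series"
  where "minus_inv_series D i r s = fls_const
    (if i \<in> tau_base D then free_gen (MinusInv i r s 0)
     else free_gen (MinusInv (tau D i) (vfr D i + 1 - s) (vfr D i + 1 - r) 0))"

definition plus_inv_series :: "nat \<Rightarrow> nat \<Rightarrow> nat \<Rightarrow> series"
  where "plus_inv_series i r s = fls_const (free_gen (PlusInv i r s 0))"

definition Wpol :: "satake \<Rightarrow> nat \<Rightarrow> series \<Rightarrow> series"
  where "Wpol D i x =
    (\<Prod>r\<leftarrow>[1..<Suc (if tau_fixed D i then vfr D i else zeta D i)]. x - w_series D i r)"

definition Wbold :: "satake \<Rightarrow> nat \<Rightarrow> series \<Rightarrow> series"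
  where "Wbold D i x =
    (if tau_fixed D i then x ^ theta D i * (\<Prod>r\<leftarrow>[1..<Suc (vfr D i)]. x\<^sup>2 - (w_series D i r)\<^sup>2)
     else (\<Prod>r\<leftarrow>[1..<Suc (vfr D i)]. x - w_series D i r))"

text \<open>For a \<open>tau\<close>-fixed node, \<open>u\<^sup>\<theta> W\<^sup>-(u)\<close> with \<open>W\<^sup>-(u) = (-1)\<^sup>d\<^sup>e\<^sup>g\<^sup> \<^sup>W W(-u)\<close>.\<close>

definition Wbar_minus :: "satake \<Rightarrow> nat \<Rightarrow> series \<Rightarrow> series"
  where "Wbar_minus D i x = x ^ theta D i * ((-1) ^ vfr D i * Wpol D i (- x))"

text \<open>The expansion of \<open>1 / Wbold(u + c)\<close>, with \<open>x\<^sup>2 - w\<^sup>2 = (x - w) (x + w)\<close>.\<close>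

definition Wbold_recip :: "satake \<Rightarrow> nat \<Rightarrow> complex \<Rightarrow> series"
  where "Wbold_recip D i c =
    (if tau_fixed D i then recip_series (cst c) ^ theta D i *
       (\<Prod>r\<leftarrow>[1..<Suc (vfr D i)]. recip_series (cst c - w_free D i r) * recip_series (cst c + w_free D i r))
     else (\<Prod>r\<leftarrow>[1..<Suc (vfr D i)]. recip_series (cst c - w_free D i r)))"

text \<open>The inverse of \<open>\<^bold>W\<^sub>i\<^sub>,\<^sub>r(w\<^sub>i\<^sub>,\<^sub>r)\<close>, which for fixed \<open>i\<close> equals
  \<open>w\<^sub>r\<^sup>\<theta> \<cdot> 2 w\<^sub>r \<cdot> \<Prod>\<^sub>s\<^sub>\<noteq>\<^sub>r (w\<^sub>r - w\<^sub>s) (w\<^sub>r + w\<^sub>s)\<close>.\<close>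

definition Wdiff_inv :: "satake \<Rightarrow> nat \<Rightarrow> nat \<Rightarrow> series"
  where "Wdiff_inv D i r =
    (if tau_fixed D i then half_inv_series i r 0 ^ theta D i * (half_series * half_inv_series i r 0) *
       (\<Prod>s\<leftarrow>[s\<leftarrow>[1..<Suc (vfr D i)]. s \<noteq> r]. minus_inv_series D i r s * plus_inv_series i r s)
     else (\<Prod>s\<leftarrow>[s\<leftarrow>[1..<Suc (vfr D i)]. s \<noteq> r]. minus_inv_series D i r s))"

text \<open>\<open>1 / \<kappa>(w) = w / (w - 1/2)\<close> and \<open>1 / \<kappa>(-w) = w / (w + 1/2)\<close> for \<open>\<kappa>(u) = 1 - 1/(2u)\<close>.\<close>

definition kappa_inv :: "satake \<Rightarrow> nat \<Rightarrow> nat \<Rightarrow> series"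
  where "kappa_inv D i r = w_series D i r * half_inv_series i r (-1)"

definition kappa_neg_inv :: "satake \<Rightarrow> nat \<Rightarrow> nat \<Rightarrow> series"
  where "kappa_neg_inv D i r = w_series D i r * half_inv_series i r 1"

text \<open>The inverse of \<open>\<Prod>\<^sub>r (1/4 - w\<^sub>r\<^sup>2) = \<Prod>\<^sub>r (- (w\<^sub>r - 1/2) (w\<^sub>r + 1/2))\<close>.\<close>

definition Wcirc_half_inv :: "satake \<Rightarrow> nat \<Rightarrow> series"
  where "Wcirc_half_inv D i =
    (\<Prod>r\<leftarrow>[1..<Suc (vfr D i)]. - (half_inv_series i r (-1) * half_inv_series i r 1))"

definition H_series :: "satake \<Rightarrow> nat \<Rightarrow> series"
  where "H_series D i =
    (1 + num_series (of_int (wp D i) / 4) * fls_X) * (1 - num_series (1 / 4) * fls_X\<^sup>2) ^ vtheta D i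
    * zeval (Zbold D i) fls_X_inv
    * Wbold_recip D i (- 1 / 2) * Wbold_recip D i (1 / 2)
    * (\<Prod>j\<leftarrow>[j\<leftarrow>node_list D. cij D i j = -1]. Wbold D j fls_X_inv)"

definition B_series_moved :: "satake \<Rightarrow> nat \<Rightarrow> series"
  where "B_series_moved D i =
    - (\<Sum>r=1..zeta D i.
        zeval (Zpol D i) (w_series D i r - half_series)
        * recip_series (cst (1 / 2) - w_free D i r) * Wdiff_inv D i r
        * (\<Prod>j\<leftarrow>[j\<leftarrow>node_list D. arrow D j i]. Wbold D j (w_series D i r - half_series))
        * eth_inv_series D i r)
    - (\<Sum>r=1..zeta D (tau D i).
        zeval (poly_minus (Zpol D i)) (w_series D (tau D i) r + half_series)
        * recip_series (cst (1 / 2) + w_free D (tau D i) r) * Wdiff_inv D (tau D i) r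
        * (\<Prod>j\<leftarrow>[j\<leftarrow>node_list D. arrow D (tau D i) (tau D j)].
             Wbold D (tau D j) (w_series D (tau D i) r + half_series))
        * eth_series D (tau D i) r)"

definition B_series_fixed :: "satake \<Rightarrow> nat \<Rightarrow> series"
  where "B_series_fixed D i =
    - (\<Sum>r=1..vfr D i.
        kappa_inv D i r ^ vtheta D i * zeval (Zpol D i) (w_series D i r - half_series)
        * recip_series (cst (1 / 2) - w_free D i r) * Wdiff_inv D i r
        * (\<Prod>j\<leftarrow>[j\<leftarrow>node_list D. arrow D j i]. Wbold D j (w_series D i r - half_series))
        * (\<Prod>j\<leftarrow>[j\<leftarrow>node_list D. arrow D i j \<and> tau_fixed D j].
             Wbar_minus D j (w_series D i r - half_series))
        * eth_inv_series D i r)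
    - (\<Sum>r=1..vfr D i.
        kappa_neg_inv D i r ^ vtheta D i * zeval (Zbar_minus D i) (w_series D i r + half_series)
        * recip_series (cst (1 / 2) + w_free D i r) * Wdiff_inv D i r
        * (\<Prod>j\<leftarrow>[j\<leftarrow>node_list D. arrow D i j \<and> \<not> tau_fixed D j].
             Wbold D j (w_series D i r + half_series))
        * (\<Prod>j\<leftarrow>[j\<leftarrow>node_list D. arrow D i j \<and> tau_fixed D j].
             Wpol D j (w_series D i r + half_series))
        * eth_series D i r)
    + num_series (csqrt ((-1) ^ (wfr D i + (\<Sum>j | j \<in> tau_base D \<and> cij D i j = -1. vfr D j))))
      * of_nat (theta D i) * zeval (Zpol D i) 0 * fls_X * Wcirc_half_inv D i
      * (\<Prod>j\<leftarrow>[j\<leftarrow>node_list D. cij D i j = -1]. Wpol D j 0)"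

definition B_series :: "satake \<Rightarrow> nat \<Rightarrow> series"
  where "B_series D i = (if tau_fixed D i then B_series_fixed D i else B_series_moved D i)"


section \<open>The truncated shifted iYangian\<close>

text \<open>The classes of the constants and of the letters generate the domain, so at most one \<open>\<Phi>\<close> on its
  carrier satisfies the following; its existence (compatibility with the relators) is a separate
  theorem and is not asserted here.\<close>

definition truncation_hom :: "satake \<Rightarrow> (yletter free set \<Rightarrow> aletter free set) \<Rightarrow> bool"
  where "truncation_hom D \<Phi> \<longleftrightarrow> \<Phi> \<in> ring_hom (iYz D) (A_alg D) \<and>
    (\<forall>c\<in>carrier (Cz D). \<Phi> (iYz_class D (scal c)) = A_class D (scal c)) \<and>
    (\<forall>i\<in>nodes D. \<forall>r. \<Phi> (iYz_class D (Hgen i r)) = A_class D (fls_nth (H_series D i) r)) \<and>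
    (\<forall>i\<in>nodes D. \<forall>s\<ge>1. \<Phi> (iYz_class D (Bgen i s)) = A_class D (fls_nth (B_series D i) (int s)))"

definition truncated_iYangian ::
    "satake \<Rightarrow> (yletter free set \<Rightarrow> aletter free set) \<Rightarrow> aletter free set ring"
  where "truncated_iYangian D \<Phi> = (A_alg D)\<lparr>carrier := \<Phi> ` carrier (iYz D)\<rparr>"

end

theory Submission
  imports Defs "HOL-Library.Multiset"
begin

text \<open>
  The target algebra acts by difference operators on functions on a shifted integer lattice chosen so
  that every element to be inverted is nonzero at every lattice point. Clearing denominators and
  multiplying by a monomial in the \<open>\<eth>\<close> brings every element to a combination of ordered monomials in
  \<open>w\<close> and \<open>\<eth>\<close>; since a polynomial vanishing on an infinite grid is zero, the action is faithful,
  even with \<open>z\<close> restricted to real values.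

  Let \<open>x\<close> be central in the truncated algebra. The coefficients of the \<open>H\<^sub>i(u)\<close> act by functions on
  the lattice. They separate its points: \<open>H\<^sub>i(u)\<close> has poles at \<open>w\<^sub>i\<^sub>,\<^sub>r \<plusminus> 1/2\<close>, which do not cancel
  against its zeros, so it determines \<open>w\<^sub>i\<^sub>,\<^sub>r\<close>. Hence \<open>x\<close> acts by a function \<open>g\<close> on the lattice.
  The coefficients with which \<open>B\<^sub>i\<^sup>(\<^sup>1\<^sup>)\<close> contains the \<open>\<eth>\<^sub>i\<^sub>,\<^sub>r\<^sup>-\<^sup>1\<close> vanish at no lattice point, so \<open>g\<close> is
  invariant under all shifts, and \<open>x\<close> acts as a polynomial in \<open>z\<close>. By faithfulness \<open>x\<close> is that
  polynomial.
\<close>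

section \<open>Sums over finitely supported functions\<close>

text \<open>The coefficients of \<open>H_series\<close> are symmetric in the variables w of one
  node, and even in them at a fixed node, so on the plain integer lattice they would in general not
  separate points. Giving the r-th coordinate the imaginary part r breaks this symmetry: a root of
  \<open>Wbold\<close> with imaginary part r can only come from the r-th variable. Nonvanishing then
  rests on two separations. Imaginary parts keep the elements to be inverted away from 0, and keep w
  \<plusminus> 1/2 away from the roots of Z as long as the z are real; that is why only real z are
  used. Real parts, integral for w and half-integral for w \<plusminus> 1/2, keep the latter away
  from the roots of every \<open>Wbold\<close> and \<open>Wpol\<close>, also when imaginary parts at
  different nodes coincide. On functions on the lattice an element is a matrix with finitely many
  nonzero entries in each row, so commutation can be compared entry by entry; this replaces any
  structure theory of the localized algebra.\<close>

lemma poly_mapping_expand: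
  fixes p :: "'a \<Rightarrow>\<^sub>0 'b::comm_monoid_add"
  shows "p = (\<Sum>k\<in>Poly_Mapping.keys p. Poly_Mapping.single k (Poly_Mapping.lookup p k))"
proof (rule poly_mapping_eqI)
  fix k
  show "Poly_Mapping.lookup p k =
    Poly_Mapping.lookup (\<Sum>k\<in>Poly_Mapping.keys p. Poly_Mapping.single k (Poly_Mapping.lookup p k)) k"
    by (simp add: lookup_sum lookup_single when_def sum.delta' in_keys_iff)
qed

lemma poly_mapping_additive_induct [case_names zero single add]:
  fixes p :: "'a \<Rightarrow>\<^sub>0 'b::comm_monoid_add"
  assumes "P 0" and "\<And>k c. P (Poly_Mapping.single k c)" and "\<And>p q. P p \<Longrightarrow> P q \<Longrightarrow> P (p + q)"
  shows "P p"
proof -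
  have "P (\<Sum>k\<in>K. Poly_Mapping.single k (Poly_Mapping.lookup p k))" if "finite K" for K
    using that by (induction K) (auto intro: assms)
  then show ?thesis
    using poly_mapping_expand[of p] by (metis finite_keys)
qed

text \<open>The additive extension of \<open>f\<close> from single terms to all finitely supported
  functions; evaluation of polynomials and the action of words are both of this shape.\<close>

definition pm_sum :: "('k \<Rightarrow> 'c::zero \<Rightarrow> 'b::comm_monoid_add) \<Rightarrow> ('k \<Rightarrow>\<^sub>0 'c) \<Rightarrow> 'b"
  where "pm_sum f p = (\<Sum>k\<in>Poly_Mapping.keys p. f k (Poly_Mapping.lookup p k))"

lemma pm_sum_superset:
  assumes "\<And>k. f k 0 = 0" "finite K" "Poly_Mapping.keys p \<subseteq> K"
  shows "pm_sum f p = (\<Sum>k\<in>K. f k (Poly_Mapping.lookup p k))"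
  unfolding pm_sum_def using assms by (intro sum.mono_neutral_left) (auto simp: in_keys_iff)

lemma pm_sum_zero [simp]: "pm_sum f 0 = 0"
  by (simp add: pm_sum_def)

lemma pm_sum_single: "f k 0 = 0 \<Longrightarrow> pm_sum f (Poly_Mapping.single k c) = f k c"
  by (cases "c = 0") (auto simp: pm_sum_def)

lemma pm_sum_add:
  fixes f :: "'k \<Rightarrow> 'c::monoid_add \<Rightarrow> 'b::comm_monoid_add"
  assumes "\<And>k. f k 0 = 0" and "\<And>k a b. f k (a + b) = f k a + f k b"
  shows "pm_sum f (p + q) = pm_sum f p + pm_sum f q"
proof -
  let ?K = "Poly_Mapping.keys p \<union> Poly_Mapping.keys q"
  have "pm_sum f r = (\<Sum>k\<in>?K. f k (Poly_Mapping.lookup r k))"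
    if "Poly_Mapping.keys r \<subseteq> ?K" for r
    using pm_sum_superset[of f ?K r] assms(1) that by auto
  then show ?thesis
    using keys_add[of p q] by (simp add: lookup_add assms(2) sum.distrib)
qed

section \<open>Evaluation of polynomials in the variables \<open>z\<close>\<close>

definition mon_eval :: "('v \<Rightarrow> 'c::comm_semiring_1) \<Rightarrow> ('v \<Rightarrow>\<^sub>0 nat) \<Rightarrow> 'c"
  where "mon_eval \<xi> m = (\<Prod>v\<in>Poly_Mapping.keys m. \<xi> v ^ Poly_Mapping.lookup m v)"

lemma mon_eval_superset:
  assumes "finite V" "Poly_Mapping.keys m \<subseteq> V"
  shows "mon_eval \<xi> m = (\<Prod>v\<in>V. \<xi> v ^ Poly_Mapping.lookup m v)"
  unfolding mon_eval_def using assms by (intro prod.mono_neutral_left) (auto simp: in_keys_iff)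

lemma mon_eval_add: "mon_eval \<xi> (m + m') = mon_eval \<xi> m * mon_eval \<xi> m'"
proof -
  let ?K = "Poly_Mapping.keys m \<union> Poly_Mapping.keys m'"
  show ?thesis
    using keys_add[of m m']
    by (simp add: mon_eval_superset[of ?K] lookup_add power_add prod.distrib)
qed

definition zev :: "(nat \<times> nat \<Rightarrow> complex) \<Rightarrow> zpoly \<Rightarrow> complex"
  where "zev \<xi> p = pm_sum (\<lambda>m c. c * mon_eval \<xi> m) p"

lemma zev_add [simp]: "zev \<xi> (p + q) = zev \<xi> p + zev \<xi> q"
  unfolding zev_def by (rule pm_sum_add) (auto simp: algebra_simps)

lemma zev_single [simp]: "zev \<xi> (Poly_Mapping.single m c) = c * mon_eval \<xi> m"
  by (simp add: zev_def pm_sum_single)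

lemma zev_0 [simp]: "zev \<xi> 0 = 0"
  by (simp add: zev_def)

lemma zev_1 [simp]: "zev \<xi> 1 = 1"
  using zev_single[of \<xi> 0 1] by (simp add: mon_eval_def)

lemma zev_mult [simp]: "zev \<xi> (p * q) = zev \<xi> p * zev \<xi> q"
proof (induction p rule: poly_mapping_additive_induct)
  case (single k c)
  show ?case
    by (induction q rule: poly_mapping_additive_induct)
      (auto simp: algebra_simps mult_single mon_eval_add)
qed (auto simp: algebra_simps)

lemma zev_uminus [simp]: "zev \<xi> (- p) = - zev \<xi> p"
  using zev_add[of \<xi> p "- p"] by (simp add: eq_neg_iff_add_eq_0 del: zev_add) (metis add.commute)

lemma zev_diff [simp]: "zev \<xi> (p - q) = zev \<xi> p - zev \<xi> q"
  using zev_add[of \<xi> p "- q"] by simp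

lemma zev_power [simp]: "zev \<xi> (p ^ k) = zev \<xi> p ^ k"
  by (induction k) auto

lemma zev_sum [simp]: "zev \<xi> (\<Sum>x\<in>A. f x) = (\<Sum>x\<in>A. zev \<xi> (f x))"
  by (induction A rule: infinite_finite_induct) auto

lemma zev_prod [simp]: "zev \<xi> (\<Prod>x\<in>A. f x) = (\<Prod>x\<in>A. zev \<xi> (f x))"
  by (induction A rule: infinite_finite_induct) auto

text \<open>Induction on the number of variables. With the other variables held at grid values, the
  sum is a polynomial in the variable \<open>u\<close> with infinitely many roots, so each of its
  coefficients vanishes on the smaller grid. The family is indexed by an abstract set
  \<open>T\<close> with exponents \<open>e\<close> because it is applied both to monomials and to
  multisets of letters.\<close>

lemma monomials_independent_on_grid:
  fixes c :: "'t \<Rightarrow> 'c::idom" and e :: "'t \<Rightarrow> 'v \<Rightarrow> nat" and S :: "'v \<Rightarrow> 'c set"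
  assumes "finite V" "finite T"
    and "\<And>v. v \<in> V \<Longrightarrow> infinite (S v)"
    and "\<And>t t'. t \<in> T \<Longrightarrow> t' \<in> T \<Longrightarrow> (\<forall>v\<in>V. e t v = e t' v) \<Longrightarrow> t = t'"
    and "\<And>a. (\<forall>v\<in>V. a v \<in> S v) \<Longrightarrow> (\<Sum>t\<in>T. c t * (\<Prod>v\<in>V. a v ^ e t v)) = 0"
    and "t \<in> T"
  shows "c t = 0"
  using assms
proof (induction V arbitrary: T t rule: finite_induct)
  case empty
  have "T = {t}"
    using empty by blast
  then show ?case
    using empty.prems(4)[of undefined] by simp
next
  case (insert u V)
  let ?T = "{t'\<in>T. e t' u = e t u}"
  show ?case
  proof (rule insert.IH)
    fix a assume a: "\<forall>v\<in>V. a v \<in> S v"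
    define m where "m s = c s * (\<Prod>v\<in>V. a v ^ e s v)" for s
    define P where "P = (\<Sum>s\<in>T. Polynomial.monom (m s) (e s u))"
    have "poly P x = 0" if "x \<in> S u" for x
    proof -
      have *: "(\<Prod>v\<in>V. (a(u := x)) v ^ e s v) = (\<Prod>v\<in>V. a v ^ e s v)" for s
        using insert.hyps by (intro prod.cong) auto
      have "(\<Sum>s\<in>T. c s * (\<Prod>v\<in>insert u V. (a(u := x)) v ^ e s v)) = 0"
        using a that insert.hyps by (intro insert.prems(4)) auto
      then show ?thesis
        using insert.hyps
        by (simp add: P_def poly_sum poly_monom m_def * mult_ac del: fun_upd_apply) (simp add: mult_ac)
    qed
    then have "S u \<subseteq> {x. poly P x = 0}"
      by auto
    then have "P = 0"
      using insert.prems(2)[of u] poly_roots_finite[of P] finite_subset by blast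
    then have "Polynomial.coeff P (e t u) = 0"
      by simp
    then have "(\<Sum>s\<in>T. if e s u = e t u then m s else 0) = 0"
      by (simp add: P_def Polynomial.coeff_sum)
    then show "(\<Sum>t\<in>?T. c t * (\<Prod>v\<in>V. a v ^ e t v)) = 0"
      using insert.prems(1) by (simp add: sum.If_cases m_def Int_def)
  qed (use insert.prems in \<open>auto\<close>)
qed

lemma infinite_complex_Reals: "infinite (\<real> :: complex set)"
proof (rule infinite_super)
  show "range (of_nat :: nat \<Rightarrow> complex) \<subseteq> \<real>"
    by auto
  show "infinite (range (of_nat :: nat \<Rightarrow> complex))"
    by (simp add: finite_image_iff inj_of_nat)
qed

text \<open>Real evaluation points suffice because \<open>\<real>\<close> is infinite. Keeping to
  them is what later makes the factors Z nonzero at nonreal arguments.\<close>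

lemma zpoly_eq_0_if_zev_eq_0:
  assumes "\<And>\<xi>. range \<xi> \<subseteq> \<real> \<Longrightarrow> zev \<xi> p = 0"
  shows "p = 0"
proof (rule poly_mapping_eqI)
  fix m
  define V where "V = (\<Union>m\<in>Poly_Mapping.keys p. Poly_Mapping.keys m)"
  have "Poly_Mapping.lookup p m = 0" if "m \<in> Poly_Mapping.keys p"
  proof (rule monomials_independent_on_grid[where T = "Poly_Mapping.keys p" and V = V and S = "\<lambda>_. \<real>"
        and e = Poly_Mapping.lookup])
    show "infinite (\<real> :: complex set)"
      by (rule infinite_complex_Reals)
    fix m m' assume *: "m \<in> Poly_Mapping.keys p" "m' \<in> Poly_Mapping.keys p"
      "\<forall>v\<in>V. Poly_Mapping.lookup m v = Poly_Mapping.lookup m' v"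
    show "m = m'"
    proof (rule poly_mapping_eqI)
      fix v show "Poly_Mapping.lookup m v = Poly_Mapping.lookup m' v"
        using * by (cases "v \<in> V") (auto simp: V_def in_keys_iff)
    qed
  next
    fix a :: "nat \<times> nat \<Rightarrow> complex" assume a: "\<forall>v\<in>V. a v \<in> \<real>"
    \<comment> \<open>Variables outside \<open>V\<close> get the real value 0, so that the
      hypothesis on \<open>range \<xi>\<close> holds.\<close>
    define \<xi> where "\<xi> v = (if v \<in> V then a v else 0)" for v
    have "zev \<xi> p = 0"
      using a by (intro assms) (auto simp: \<xi>_def)
    moreover have "zev \<xi> p = (\<Sum>m\<in>Poly_Mapping.keys p. Poly_Mapping.lookup p m *
        (\<Prod>v\<in>V. a v ^ Poly_Mapping.lookup m v))"
      unfolding zev_def pm_sum_def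
    proof (intro sum.cong refl arg_cong2[of _ _ _ _ "(*)"])
      fix m assume "m \<in> Poly_Mapping.keys p"
      then have "mon_eval \<xi> m = (\<Prod>v\<in>V. \<xi> v ^ Poly_Mapping.lookup m v)"
        by (intro mon_eval_superset) (auto simp: V_def)
      then show "mon_eval \<xi> m = (\<Prod>v\<in>V. a v ^ Poly_Mapping.lookup m v)"
        by (simp add: \<xi>_def)
    qed
    ultimately show "(\<Sum>m\<in>Poly_Mapping.keys p. Poly_Mapping.lookup p m *
        (\<Prod>v\<in>V. a v ^ Poly_Mapping.lookup m v)) = 0"
      by simp
  qed (use that in \<open>auto simp: V_def\<close>)
  then show "Poly_Mapping.lookup p m = Poly_Mapping.lookup 0 m"
    by (auto simp: in_keys_iff)
qed

section \<open>Presented algebras\<close>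

lemma scal_conv_single_0: "scal c = Poly_Mapping.single 0 c"
  by (simp add: scal_def zero_list_def)

lemma scal_commute: "scal c * p = p * scal c"
proof (induction p rule: poly_mapping_additive_induct)
  case (single k d)
  then show ?case
    by (simp add: scal_def mult_single plus_list_def mult.commute)
qed (auto simp: algebra_simps)

lemma cst_commute: "cst z * p = p * cst z"
  unfolding cst_def by (rule scal_commute)

lemma scal_add: "scal (a + b) = scal a + scal b"
  by (simp add: scal_def single_add)

lemma scal_mult: "scal (a * b) = scal a * scal b"
  by (simp add: scal_def mult_single plus_list_def)

lemma scal_1: "scal 1 = 1"
  by (simp add: scal_conv_single_0)

lemma scal_sum: "scal (\<Sum>x\<in>A. f x) = (\<Sum>x\<in>A. scal (f x))"
  by (induction A rule: infinite_finite_induct) (simp_all add: scal_add, simp_all add: scal_def)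

lemma scal_diff: "scal (a - b) = scal a - scal b"
  by (simp add: scal_def single_diff)

locale coefficient_ring =
  fixes K :: "zpoly set"
  assumes K_add: "a \<in> K \<Longrightarrow> b \<in> K \<Longrightarrow> a + b \<in> K"
    and K_uminus: "a \<in> K \<Longrightarrow> - a \<in> K"
    and K_mult: "a \<in> K \<Longrightarrow> b \<in> K \<Longrightarrow> a * b \<in> K"
    and K_const: "Poly_Mapping.single 0 z \<in> K"
begin

lemma K_0: "0 \<in> K" and K_1: "1 \<in> K"
  using K_const[of 0] K_const[of 1] by simp_all

lemma K_sum: "(\<And>x. x \<in> A \<Longrightarrow> f x \<in> K) \<Longrightarrow> (\<Sum>x\<in>A. f x) \<in> K"
  by (induction A rule: infinite_finite_induct) (auto intro: K_0 K_add)

definition free_carrier :: "'g set \<Rightarrow> 'g free set"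
  where "free_carrier X = {p. \<forall>xs. Poly_Mapping.lookup p xs \<in> K \<and>
    (Poly_Mapping.lookup p xs \<noteq> 0 \<longrightarrow> set xs \<subseteq> X)}"

lemma carrier_free_algebra: "carrier (free_algebra K X) = free_carrier X"
  by (simp add: free_algebra_def subring_record_def free_carrier_def)

lemma free_carrier_add: "p \<in> free_carrier X \<Longrightarrow> q \<in> free_carrier X \<Longrightarrow> p + q \<in> free_carrier X"
  by (auto simp: free_carrier_def lookup_add K_add) (metis add.right_neutral subsetD)

lemma free_carrier_uminus: "p \<in> free_carrier X \<Longrightarrow> - p \<in> free_carrier X"
  by (auto simp: free_carrier_def K_uminus)

lemma free_carrier_diff: "p \<in> free_carrier X \<Longrightarrow> q \<in> free_carrier X \<Longrightarrow> p - q \<in> free_carrier X"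
  using free_carrier_add[OF _ free_carrier_uminus, of p X q] by simp

lemma free_carrier_0: "0 \<in> free_carrier X"
  by (simp add: free_carrier_def K_0)

lemma free_carrier_single: "c \<in> K \<Longrightarrow> set xs \<subseteq> X \<Longrightarrow> Poly_Mapping.single xs c \<in> free_carrier X"
  by (auto simp: free_carrier_def lookup_single when_def K_0)

lemma free_carrier_sum: "(\<And>x. x \<in> A \<Longrightarrow> f x \<in> free_carrier X) \<Longrightarrow> (\<Sum>x\<in>A. f x) \<in> free_carrier X"
  by (induction A rule: infinite_finite_induct) (auto intro: free_carrier_0 free_carrier_add)

lemma free_carrier_mult:
  assumes "p \<in> free_carrier X" "q \<in> free_carrier X"
  shows "p * q \<in> free_carrier X"
proof -
  have "p * q = (\<Sum>xs\<in>Poly_Mapping.keys p. \<Sum>ys\<in>Poly_Mapping.keys q.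
     Poly_Mapping.single (xs + ys) (Poly_Mapping.lookup p xs * Poly_Mapping.lookup q ys))"
    by (subst poly_mapping_expand[of p], subst poly_mapping_expand[of q])
      (simp add: sum_product mult_single)
  also have "\<dots> \<in> free_carrier X"
    using assms
    by (intro free_carrier_sum free_carrier_single K_mult)
      (auto simp: free_carrier_def plus_list_def in_keys_iff)
  finally show ?thesis .
qed

lemma free_carrier_1: "1 \<in> free_carrier X"
  using free_carrier_single[of 1 "[]" X] K_1 by (simp add: scal_conv_single_0 flip: scal_def)

lemma free_carrier_gen: "x \<in> X \<Longrightarrow> free_gen x \<in> free_carrier X"
  unfolding free_gen_def by (rule free_carrier_single) (auto simp: K_1)

lemma free_carrier_scal: "c \<in> K \<Longrightarrow> scal c \<in> free_carrier X"
  unfolding scal_def by (rule free_carrier_single) auto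

lemma free_carrier_cst: "cst z \<in> free_carrier X"
  unfolding cst_def by (rule free_carrier_scal) (rule K_const)

lemma free_carrier_of_bool: "of_bool b \<in> free_carrier X"
  by (cases b) (auto intro: free_carrier_0 free_carrier_1)

lemma free_carrier_power: "p \<in> free_carrier X \<Longrightarrow> p ^ k \<in> free_carrier X"
  by (induction k) (auto intro: free_carrier_1 free_carrier_mult)

lemma free_carrier_of_int: "of_int m \<in> free_carrier X"
  using free_carrier_cst[of "of_int m" X] by (simp add: cst_def scal_conv_single_0)

lemmas free_carrier_intros =
  free_carrier_0 free_carrier_1 free_carrier_add free_carrier_uminus free_carrier_diff
  free_carrier_mult free_carrier_gen free_carrier_scal free_carrier_cst free_carrier_of_bool
  free_carrier_power free_carrier_of_int

lemma free_algebra_simps: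
  "\<zero>\<^bsub>free_algebra K X\<^esub> = 0" "\<one>\<^bsub>free_algebra K X\<^esub> = 1"
  "a \<oplus>\<^bsub>free_algebra K X\<^esub> b = a + b" "a \<otimes>\<^bsub>free_algebra K X\<^esub> b = a * b"
  by (simp_all add: free_algebra_def subring_record_def)

lemma ring_free_algebra: "ring (free_algebra K X)"
proof (rule ringI)
  show "abelian_group (free_algebra K X)"
  proof (rule abelian_groupI)
    fix x assume "x \<in> carrier (free_algebra K X)"
    then have "- x \<in> carrier (free_algebra K X)"
      by (simp add: carrier_free_algebra free_carrier_uminus)
    then show "\<exists>y\<in>carrier (free_algebra K X). y \<oplus>\<^bsub>free_algebra K X\<^esub> x = \<zero>\<^bsub>free_algebra K X\<^esub>"
      by (rule bexI[rotated]) (simp add: free_algebra_def subring_record_def)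
  qed (simp_all add: free_algebra_simps carrier_free_algebra free_carrier_add free_carrier_0 add_ac)
  show "monoid (free_algebra K X)"
  proof (rule monoidI)
    fix x y assume "x \<in> carrier (free_algebra K X)" "y \<in> carrier (free_algebra K X)"
    then show "x \<otimes>\<^bsub>free_algebra K X\<^esub> y \<in> carrier (free_algebra K X)"
      unfolding carrier_free_algebra
      by (simp add: free_carrier_mult free_algebra_def subring_record_def)
  next
    show "\<one>\<^bsub>free_algebra K X\<^esub> \<in> carrier (free_algebra K X)"
      unfolding carrier_free_algebra
      by (simp add: free_carrier_1 free_algebra_def subring_record_def)
  qed (simp_all add: free_algebra_simps mult.assoc)
qed (simp_all add: free_algebra_simps distrib_left distrib_right)

text \<open>Stated before relators enter: it serves the shifted iYangian, whose letters and
  constants it places in the domain of \<open>\<Phi>\<close>.\<close>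

lemma class_in_carrier:
  "p \<in> free_carrier X \<Longrightarrow> presented_class K X R p \<in> carrier (presented K X R)"
  by (auto simp: presented_def FactRing_def presented_class_def A_RCOSETS_def' carrier_free_algebra)

text \<open>Letters are prepended on the left because \<open>denominator_clearing\<close> moves a
  denominator past one letter at a time.\<close>

lemma free_carrier_induct [consumes 1, case_names scal gen add]:
  assumes "p \<in> free_carrier X"
    and scal: "\<And>c. c \<in> K \<Longrightarrow> P (scal c)"
    and gen: "\<And>x p. x \<in> X \<Longrightarrow> p \<in> free_carrier X \<Longrightarrow> P p \<Longrightarrow> P (free_gen x * p)"
    and add: "\<And>p q. p \<in> free_carrier X \<Longrightarrow> q \<in> free_carrier X \<Longrightarrow> P p \<Longrightarrow> P q \<Longrightarrow> P (p + q)"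
  shows "P p"
proof -
  have single: "P (Poly_Mapping.single xs c)" if "set xs \<subseteq> X" "c \<in> K" for xs c
    using that(1)
  proof (induction xs)
    case Nil
    then show ?case
      using scal[OF that(2)] by (simp add: scal_def)
  next
    case (Cons x xs)
    then have "P (free_gen x * Poly_Mapping.single xs c)"
      using that(2) by (intro gen free_carrier_single) auto
    then show ?case
      by (simp add: free_gen_def mult_single plus_list_def)
  qed
  have "P (\<Sum>xs\<in>A. Poly_Mapping.single xs (Poly_Mapping.lookup p xs))"
    if "finite A" "A \<subseteq> Poly_Mapping.keys p" for A
    using that
  proof (induction A)
    case empty
    then show ?case
      using scal[OF K_0] by (simp add: scal_def)
  next
    case (insert xs A)
    have *: "set xs \<subseteq> X \<and> Poly_Mapping.lookup p xs \<in> K" if "xs \<in> Poly_Mapping.keys p" for xs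
      using assms(1) that by (auto simp: free_carrier_def in_keys_iff)
    show ?case
      unfolding sum.insert[OF insert.hyps]
    proof (rule add)
      show "(\<Sum>xs\<in>A. Poly_Mapping.single xs (Poly_Mapping.lookup p xs)) \<in> free_carrier X"
        using insert.prems * by (intro free_carrier_sum free_carrier_single) blast+
    qed (use insert * in \<open>auto intro!: free_carrier_single single\<close>)
  qed
  from this[of "Poly_Mapping.keys p"] show ?thesis
    using poly_mapping_expand[of p] by simp
qed

end

locale presentation = coefficient_ring K for K :: "zpoly set" +
  fixes X :: "'g set" and R :: "'g free set"
  assumes relators: "R \<subseteq> free_carrier X"
begin

definition rel_ideal :: "'g free set"
  where "rel_ideal = Idl\<^bsub>free_algebra K X\<^esub> R"

lemma ideal_rel_ideal: "ideal rel_ideal (free_algebra K X)"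
  unfolding rel_ideal_def
  using ring.genideal_ideal[OF ring_free_algebra] relators by (simp add: carrier_free_algebra)

lemma relators_subset_ideal: "R \<subseteq> rel_ideal"
  unfolding rel_ideal_def
  using ring.genideal_self[OF ring_free_algebra] relators by (simp add: carrier_free_algebra)

lemma rel_ideal_subset: "p \<in> rel_ideal \<Longrightarrow> p \<in> free_carrier X"
  using ideal.Icarr[OF ideal_rel_ideal] by (simp add: carrier_free_algebra)

lemma ideal_0: "0 \<in> rel_ideal"
  using additive_subgroup.zero_closed[OF ideal.axioms(1)[OF ideal_rel_ideal]]
  by (simp add: free_algebra_simps)

lemma ideal_add: "p \<in> rel_ideal \<Longrightarrow> q \<in> rel_ideal \<Longrightarrow> p + q \<in> rel_ideal"
  using additive_subgroup.a_closed[OF ideal.axioms(1)[OF ideal_rel_ideal]]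
  by (simp add: free_algebra_simps)

lemma ideal_mult_left: "p \<in> rel_ideal \<Longrightarrow> q \<in> free_carrier X \<Longrightarrow> q * p \<in> rel_ideal"
  using ideal.I_l_closed[OF ideal_rel_ideal] by (simp add: free_algebra_simps carrier_free_algebra)

lemma ideal_mult_right: "p \<in> rel_ideal \<Longrightarrow> q \<in> free_carrier X \<Longrightarrow> p * q \<in> rel_ideal"
  using ideal.I_r_closed[OF ideal_rel_ideal] by (simp add: free_algebra_simps carrier_free_algebra)

lemma ideal_uminus: "p \<in> rel_ideal \<Longrightarrow> - p \<in> rel_ideal"
  using ideal_mult_left[OF _ free_carrier_uminus[OF free_carrier_1], of p] by simp

text \<open>Phrased with the operations of the type instead of those of the record, so that
  \<open>J\<close> can be a plain set such as the kernel of an action; closure under negation comes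
  from multiplication by -1.\<close>

lemma rel_ideal_minimal:
  assumes "R \<subseteq> J" "J \<subseteq> free_carrier X" "0 \<in> J"
    and "\<And>p q. p \<in> J \<Longrightarrow> q \<in> J \<Longrightarrow> p + q \<in> J"
    and "\<And>p q. p \<in> J \<Longrightarrow> q \<in> free_carrier X \<Longrightarrow> q * p \<in> J"
    and "\<And>p q. p \<in> J \<Longrightarrow> q \<in> free_carrier X \<Longrightarrow> p * q \<in> J"
  shows "rel_ideal \<subseteq> J"
  unfolding rel_ideal_def
proof (rule ring.genideal_minimal[OF ring_free_algebra])
  show "ideal J (free_algebra K X)"
  proof (rule idealI[OF ring_free_algebra])
    interpret ring "free_algebra K X" by (rule ring_free_algebra)
    have neg: "\<ominus>\<^bsub>free_algebra K X\<^esub> p = - p" if "p \<in> free_carrier X" for p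
      using that by (intro minus_equality)
        (auto simp: free_algebra_simps carrier_free_algebra free_carrier_uminus)
    show "subgroup J (add_monoid (free_algebra K X))"
    proof (rule add.subgroupI)
      fix p assume p: "p \<in> J"
      then have "(- 1) * p \<in> J"
        by (intro assms free_carrier_uminus free_carrier_1)
      then show "\<ominus>\<^bsub>free_algebra K X\<^esub> p \<in> J"
        using p assms(2) neg[of p] by auto
    qed (use assms in \<open>auto simp: free_algebra_simps carrier_free_algebra\<close>)
  qed (use assms in \<open>auto simp: free_algebra_simps carrier_free_algebra\<close>)
qed fact

text \<open>Membership of both sides is built in, so that chains of congruences carry the side
  conditions on the carrier along.\<close>

definition cong :: "'g free \<Rightarrow> 'g free \<Rightarrow> bool" (infix "\<approx>" 50)
  where "p \<approx> q \<longleftrightarrow> p \<in> free_carrier X \<and> q \<in> free_carrier X \<and> p - q \<in> rel_ideal"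

lemma cong_carrier: "p \<approx> q \<Longrightarrow> p \<in> free_carrier X" "p \<approx> q \<Longrightarrow> q \<in> free_carrier X"
  by (auto simp: cong_def)

lemma cong_refl: "p \<in> free_carrier X \<Longrightarrow> p \<approx> p"
  by (simp add: cong_def ideal_0)

lemma cong_sym: "p \<approx> q \<Longrightarrow> q \<approx> p"
  using ideal_uminus[of "p - q"] by (simp add: cong_def)

lemma cong_trans [trans]: "p \<approx> q \<Longrightarrow> q \<approx> r \<Longrightarrow> p \<approx> r"
  using ideal_add[of "p - q" "q - r"] by (simp add: cong_def)

lemma cong_add: "p \<approx> q \<Longrightarrow> p' \<approx> q' \<Longrightarrow> p + p' \<approx> q + q'"
  using ideal_add[of "p - q" "p' - q'"] by (simp add: cong_def free_carrier_add algebra_simps)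

lemma cong_uminus: "p \<approx> q \<Longrightarrow> - p \<approx> - q"
  using ideal_uminus[of "p - q"] by (simp add: cong_def free_carrier_uminus algebra_simps)

lemma cong_diff: "p \<approx> q \<Longrightarrow> p' \<approx> q' \<Longrightarrow> p - p' \<approx> q - q'"
  using cong_add[OF _ cong_uminus, of p q p' q'] by simp

lemma cong_mult:
  assumes "p \<approx> q" "p' \<approx> q'"
  shows "p * p' \<approx> q * q'"
proof -
  have "(p - q) * p' + q * (p' - q') \<in> rel_ideal"
    using assms by (intro ideal_add ideal_mult_left ideal_mult_right) (auto simp: cong_def)
  moreover have "(p - q) * p' + q * (p' - q') = p * p' - q * q'"
    by (simp add: algebra_simps)
  ultimately show ?thesis
    using assms by (simp add: cong_def free_carrier_mult)
qed

lemma cong_sum: "(\<And>x. x \<in> A \<Longrightarrow> f x \<approx> g x) \<Longrightarrow> (\<Sum>x\<in>A. f x) \<approx> (\<Sum>x\<in>A. g x)"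
  by (induction A rule: infinite_finite_induct) (auto intro: cong_add cong_refl free_carrier_0)

lemma cong_mult_left: "q \<approx> q' \<Longrightarrow> p \<in> free_carrier X \<Longrightarrow> p * q \<approx> p * q'"
  by (rule cong_mult[OF cong_refl])

lemma cong_mult_right: "q \<approx> q' \<Longrightarrow> p \<in> free_carrier X \<Longrightarrow> q * p \<approx> q' * p"
  by (rule cong_mult[OF _ cong_refl])

lemma cong_relator: "p - q \<in> R \<Longrightarrow> p \<in> free_carrier X \<Longrightarrow> q \<in> free_carrier X \<Longrightarrow> p \<approx> q"
  using relators_subset_ideal by (auto simp: cong_def)

lemma cong_0_iff: "p \<approx> 0 \<longleftrightarrow> p \<in> rel_ideal"
  using rel_ideal_subset by (auto simp: cong_def free_carrier_0)

abbreviation cls :: "'g free \<Rightarrow> 'g free set"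
  where "cls \<equiv> presented_class K X R"

lemma cls_eq_iff:
  assumes "p \<in> free_carrier X" "q \<in> free_carrier X"
  shows "cls p = cls q \<longleftrightarrow> p \<approx> q"
proof -
  interpret ring "free_algebra K X" by (rule ring_free_algebra)
  interpret ideal rel_ideal "free_algebra K X" by (rule ideal_rel_ideal)
  have minus: "p \<ominus>\<^bsub>free_algebra K X\<^esub> q = p - q"
  proof -
    have "\<ominus>\<^bsub>free_algebra K X\<^esub> q = - q"
      using assms by (intro minus_equality)
        (auto simp: free_algebra_simps carrier_free_algebra free_carrier_uminus)
    then show ?thesis
      by (simp add: minus_eq free_algebra_simps)
  qed
  show ?thesis
    using quotient_eq_iff_same_a_r_cos[OF ideal_rel_ideal, of p q] assms minus
    by (simp add: carrier_free_algebra presented_class_def rel_ideal_def[symmetric] cong_def)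
qed

lemma carrier_presented: "carrier (presented K X R) = cls ` free_carrier X"
  unfolding presented_def FactRing_def presented_class_def
  by (auto simp: A_RCOSETS_def' carrier_free_algebra)

lemma cls_ring_hom: "cls \<in> ring_hom (free_algebra K X) (presented K X R)"
  using ideal.rcos_ring_hom[OF ideal_rel_ideal]
  by (simp add: presented_def presented_class_def[abs_def] rel_ideal_def)

lemma cls_mult: "p \<in> free_carrier X \<Longrightarrow> q \<in> free_carrier X \<Longrightarrow>
    cls p \<otimes>\<^bsub>presented K X R\<^esub> cls q = cls (p * q)"
  using ring_hom_mult[OF cls_ring_hom, of p q] by (simp add: carrier_free_algebra free_algebra_simps)

lemma cls_add: "p \<in> free_carrier X \<Longrightarrow> q \<in> free_carrier X \<Longrightarrow>
    cls p \<oplus>\<^bsub>presented K X R\<^esub> cls q = cls (p + q)"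
  using ring_hom_add[OF cls_ring_hom, of p q] by (simp add: carrier_free_algebra free_algebra_simps)

lemma cls_1: "cls 1 = \<one>\<^bsub>presented K X R\<^esub>"
  using ring_hom_one[OF cls_ring_hom] by (simp add: free_algebra_simps)

end

section \<open>Difference operators on a lattice\<close>

lemma coefficient_ring_Cz: "coefficient_ring (carrier (Cz D))"
proof
  let ?Z = "{(i, s). i \<in> tau_base D \<and> 1 \<le> s \<and> s \<le> wfr D i}"
  have *: "p \<in> carrier (Cz D) \<longleftrightarrow> (\<forall>m\<in>Poly_Mapping.keys p. Poly_Mapping.keys m \<subseteq> ?Z)" for p
    by (simp add: Cz_def subring_record_def)
  fix a b assume ab: "a \<in> carrier (Cz D)" "b \<in> carrier (Cz D)"
  show "a + b \<in> carrier (Cz D)"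
    using ab keys_add[of a b] unfolding * by blast
  show "a * b \<in> carrier (Cz D)"
    unfolding *
  proof
    fix m assume "m \<in> Poly_Mapping.keys (a * b)"
    then obtain x y where "m = x + y" "x \<in> Poly_Mapping.keys a" "y \<in> Poly_Mapping.keys b"
      using keys_mult[of a b] by blast
    then show "Poly_Mapping.keys m \<subseteq> ?Z"
      using ab keys_add[of x y] unfolding * by blast
  qed
qed (simp_all add: Cz_def subring_record_def)

text \<open>The generators of the target algebra are realised as operators on functions on the lattice of
  integer-valued \<open>n\<close>, with \<open>w\<^sub>i\<^sub>,\<^sub>r\<close> acting as multiplication by \<open>n\<^sub>i\<^sub>,\<^sub>r + \<i> r\<close>: distinct imaginary
  parts keep all the elements that have to be inverted away from \<open>0\<close>.\<close>

type_synonym lattice = "nat \<times> nat \<Rightarrow> int"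

definition pt :: "lattice \<Rightarrow> nat \<times> nat \<Rightarrow> complex"
  where "pt n k = of_int (n k) + \<i> * of_nat (snd k)"

text \<open>The letter \<open>a\<close> is the operator sending \<open>F\<close> to
  \<open>\<lambda>n. lcoef a n * F (lshift a n)\<close>. \<open>Eth\<close> has to raise its
  coordinate: then moving it past w produces w + 1, as the relation \<open>eth_w\<close>
  demands.\<close>

fun lcoef :: "aletter \<Rightarrow> lattice \<Rightarrow> complex" where
  "lcoef (Wl i r) n = pt n (i, r)"
| "lcoef (Eth i r) n = 1"
| "lcoef (EthInv i r) n = 1"
| "lcoef (PlusInv i r r' m) n = inverse (pt n (i, r) + pt n (i, r') + of_int m)"
| "lcoef (MinusInv i r r' m) n = inverse (pt n (i, r) - pt n (i, r') + of_int m)"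
| "lcoef (HalfInv i r m) n = inverse (pt n (i, r) + of_int m / 2)"

fun lshift :: "aletter \<Rightarrow> lattice \<Rightarrow> lattice" where
  "lshift (Eth i r) n = n((i, r) := n (i, r) + 1)"
| "lshift (EthInv i r) n = n((i, r) := n (i, r) - 1)"
| "lshift _ n = n"

text \<open>The leftmost letter of a word is applied last. At a point it is therefore met first, and
  it moves the point at which the rest of the word is evaluated.\<close>

fun wcoef :: "aletter list \<Rightarrow> lattice \<Rightarrow> complex" where
  "wcoef [] n = 1"
| "wcoef (a # xs) n = lcoef a n * wcoef xs (lshift a n)"

fun wshift :: "aletter list \<Rightarrow> lattice \<Rightarrow> lattice" where
  "wshift [] n = n"
| "wshift (a # xs) n = wshift xs (lshift a n)"

lemma wshift_append: "wshift (xs @ ys) n = wshift ys (wshift xs n)"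
  by (induction xs arbitrary: n) auto

lemma wcoef_append: "wcoef (xs @ ys) n = wcoef xs n * wcoef ys (wshift xs n)"
  by (induction xs arbitrary: n) auto

definition act ::
    "(nat \<times> nat \<Rightarrow> complex) \<Rightarrow> aletter free \<Rightarrow> (lattice \<Rightarrow> complex) \<Rightarrow> lattice \<Rightarrow> complex"
  where "act \<xi> p F n = pm_sum (\<lambda>xs c. zev \<xi> c * (wcoef xs n * F (wshift xs n))) p"

lemma act_add: "act \<xi> (p + q) F n = act \<xi> p F n + act \<xi> q F n"
  unfolding act_def by (rule pm_sum_add) (auto simp: algebra_simps)

lemma act_single: "act \<xi> (Poly_Mapping.single xs c) F n = zev \<xi> c * (wcoef xs n * F (wshift xs n))"
  unfolding act_def by (rule pm_sum_single) auto

lemma act_0: "act \<xi> 0 F n = 0"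
  by (simp add: act_def)

lemma act_uminus: "act \<xi> (- p) F n = - act \<xi> p F n"
  using act_add[of \<xi> p "- p" F n] by (simp add: act_0 eq_neg_iff_add_eq_0 add.commute)

lemma act_diff: "act \<xi> (p - q) F n = act \<xi> p F n - act \<xi> q F n"
  using act_add[of \<xi> p "- q" F n] by (simp add: act_uminus)

lemma act_mult: "act \<xi> (p * q) F n = act \<xi> p (act \<xi> q F) n"
proof (induction p arbitrary: n rule: poly_mapping_additive_induct)
  case (single xs c)
  show ?case
    by (induction q rule: poly_mapping_additive_induct)
      (auto simp: algebra_simps mult_single act_single act_0 act_add plus_list_def
        wcoef_append wshift_append)
qed (auto simp: algebra_simps act_0 act_add)

lemma act_scal: "act \<xi> (scal c) F n = zev \<xi> c * F n"
  by (simp add: scal_def act_single)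

lemma act_cst: "act \<xi> (cst z) F n = z * F n"
  by (simp add: cst_def act_scal mon_eval_def)

lemma act_1: "act \<xi> 1 F n = F n"
  using act_cst[of \<xi> 1 F n] by (simp add: cst_def scal_conv_single_0)

lemma act_of_int: "act \<xi> (of_int m) F n = of_int m * F n"
  using act_cst[of \<xi> "of_int m" F n] by (simp add: cst_def scal_conv_single_0)

lemma act_of_bool: "act \<xi> (of_bool b) F n = of_bool b * F n"
  by (cases b) (auto simp: act_0 act_1)

lemma act_gen: "act \<xi> (free_gen a) F n = lcoef a n * F (lshift a n)"
  by (simp add: free_gen_def act_single)

lemmas act_simps = act_add act_0 act_uminus act_diff act_mult act_scal act_cst act_1 act_of_int
  act_of_bool act_gen

lemma act_scale: "act \<xi> p (\<lambda>m. z * F m) n = z * act \<xi> p F n"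
  by (simp add: act_def pm_sum_def sum_distrib_left algebra_simps)

locale target_algebra =
  fixes D :: satake
begin

text \<open>Coordinates outside the index set are frozen at 0, so that finitely many unit shifts in
  indexed directions connect any two points.\<close>

definition base_lattice :: "lattice set"
  where "base_lattice = {n. \<forall>k. k \<notin> A_index D \<longrightarrow> n k = 0}"

abbreviation W :: "nat \<times> nat \<Rightarrow> aletter free" where "W k \<equiv> free_gen (Wl (fst k) (snd k))"
abbreviation E :: "nat \<times> nat \<Rightarrow> aletter free" where "E k \<equiv> free_gen (Eth (fst k) (snd k))"
abbreviation E' :: "nat \<times> nat \<Rightarrow> aletter free" where "E' k \<equiv> free_gen (EthInv (fst k) (snd k))"

lemma A_gens_iff:
  "Wl i r \<in> A_gens D \<longleftrightarrow> (i, r) \<in> A_index D"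
  "Eth i r \<in> A_gens D \<longleftrightarrow> (i, r) \<in> A_index D"
  "EthInv i r \<in> A_gens D \<longleftrightarrow> (i, r) \<in> A_index D"
  "HalfInv i r m \<in> A_gens D \<longleftrightarrow> (i, r) \<in> A_index D"
  "PlusInv i r r' m \<in> A_gens D \<longleftrightarrow> (i, r) \<in> A_index D \<and> (i, r') \<in> A_index D \<and> r \<noteq> r'"
  "MinusInv i r r' m \<in> A_gens D \<longleftrightarrow> (i, r) \<in> A_index D \<and> (i, r') \<in> A_index D \<and> r \<noteq> r'"
  by (auto simp: A_gens_def)

sublocale presentation "carrier (Cz D)" "A_gens D" "A_relators D"
proof -
  interpret coefficient_ring "carrier (Cz D)" by (rule coefficient_ring_Cz)
  show "presentation (carrier (Cz D)) (A_gens D) (A_relators D)"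
  proof
    show "A_relators D \<subseteq> free_carrier (A_gens D)"
    proof
      fix p assume "p \<in> A_relators D"
      then show "p \<in> free_carrier (A_gens D)"
        by cases (auto simp: commut_def A_gens_iff intro!: free_carrier_intros)
    qed
  qed
qed

notation cong (infix "\<approx>" 50)

abbreviation A_carrier :: "aletter free set" where "A_carrier \<equiv> free_carrier (A_gens D)"

text \<open>The imaginary parts are r + r', r - r' and r, with r and r' positive and, in the first
  two cases, distinct.\<close>

lemma pt_nonzero:
  assumes "(i, r) \<in> A_index D" "(i, r') \<in> A_index D"
  shows "r \<noteq> r' \<Longrightarrow> pt n (i, r) + pt n (i, r') + of_int m \<noteq> 0"
    and "r \<noteq> r' \<Longrightarrow> pt n (i, r) - pt n (i, r') + of_int m \<noteq> 0"
    and "pt n (i, r) + of_int m / 2 \<noteq> 0"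
  using assms by (auto simp: pt_def complex_eq_iff A_index_def)

text \<open>The elements acting as 0 on all functions form a two-sided ideal, so it suffices to
  treat the relators. Those with inverses act as 0 by \<open>pt_nonzero\<close>, which holds at
  every lattice point.\<close>

lemma act_ideal: "p \<in> rel_ideal \<Longrightarrow> act \<xi> p F n = 0"
proof -
  let ?J = "{p \<in> A_carrier. \<forall>F n. act \<xi> p F n = 0}"
  have "rel_ideal \<subseteq> ?J"
  proof (rule rel_ideal_minimal)
    have "act \<xi> p F n = 0" if "p \<in> A_relators D" for p F n
      using that
    proof cases
      case (plus_inv_right i r r' m)
      define z where "z = pt n (i, r) + pt n (i, r') + of_int m"
      have "pt n (i, r) * y + pt n (i, r') * y + of_int m * y = z * y" for y
        by (simp add: z_def distrib_right left_diff_distrib)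
      moreover have "z * (inverse z * y) = y" for y
        using pt_nonzero(1)[of i r r' n m] plus_inv_right by (simp add: z_def)
      ultimately show ?thesis
        using plus_inv_right by (simp add: act_simps z_def[symmetric])
    next
      case (minus_inv_right i r r' m)
      define z where "z = pt n (i, r) - pt n (i, r') + of_int m"
      have "pt n (i, r) * y - pt n (i, r') * y + of_int m * y = z * y" for y
        by (simp add: z_def distrib_right left_diff_distrib)
      moreover have "z * (inverse z * y) = y" for y
        using pt_nonzero(2)[of i r r' n m] minus_inv_right by (simp add: z_def)
      ultimately show ?thesis
        using minus_inv_right by (simp add: act_simps z_def[symmetric])
    next
      case (half_inv_right i r m)
      define z where "z = pt n (i, r) + of_int m / 2"
      have "pt n (i, r) * y + of_int m * y / 2 = z * y" for y
        by (simp add: z_def distrib_right left_diff_distrib)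
      moreover have "z * (inverse z * y) = y" for y
        using pt_nonzero(3)[of i r r n m] half_inv_right by (simp add: z_def)
      ultimately show ?thesis
        using half_inv_right by (simp add: act_simps z_def[symmetric])
    next
      case (plus_inv_left i r r' m)
      define z where "z = pt n (i, r) + pt n (i, r') + of_int m"
      have "pt n (i, r) * y + pt n (i, r') * y + of_int m * y = z * y" for y
        by (simp add: z_def distrib_right left_diff_distrib)
      moreover have "inverse z * (z * y) = y" for y
        using pt_nonzero(1)[of i r r' n m] plus_inv_left by (simp add: z_def)
      ultimately show ?thesis
        using plus_inv_left by (simp add: act_simps z_def[symmetric])
    next
      case (minus_inv_left i r r' m)
      define z where "z = pt n (i, r) - pt n (i, r') + of_int m"
      have "pt n (i, r) * y - pt n (i, r') * y + of_int m * y = z * y" for y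
        by (simp add: z_def distrib_right left_diff_distrib)
      moreover have "inverse z * (z * y) = y" for y
        using pt_nonzero(2)[of i r r' n m] minus_inv_left by (simp add: z_def)
      ultimately show ?thesis
        using minus_inv_left by (simp add: act_simps z_def[symmetric])
    next
      case (half_inv_left i r m)
      define z where "z = pt n (i, r) + of_int m / 2"
      have "pt n (i, r) * y + of_int m * y / 2 = z * y" for y
        by (simp add: z_def distrib_right left_diff_distrib)
      moreover have "inverse z * (z * y) = y" for y
        using pt_nonzero(3)[of i r r n m] half_inv_left by (simp add: z_def)
      ultimately show ?thesis
        using half_inv_left by (simp add: act_simps z_def[symmetric])
    next
      case (eth_eth i r j r')
      then show ?thesis
        by (cases "(i, r) = (j, r')") (auto simp: act_simps commut_def fun_upd_twist)
    next
      case (eth_w i r j r')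
      then show ?thesis
        by (cases "(i, r) = (j, r')") (auto simp: act_simps commut_def pt_def distrib_right)
    next
      case (ethinv_w i r j r')
      then show ?thesis
        by (cases "(i, r) = (j, r')") (auto simp: act_simps commut_def pt_def distrib_right left_diff_distrib)
    qed (simp_all add: act_simps commut_def)
    then show "A_relators D \<subseteq> ?J"
      using relators by auto
  next
    fix p q assume p: "p \<in> ?J" and q: "q \<in> A_carrier"
    have "act \<xi> q (act \<xi> p F) n = 0" for F n
    proof -
      have "act \<xi> p F = (\<lambda>m. 0)"
        using p by auto
      then show ?thesis
        using act_scale[of \<xi> q 0 "\<lambda>_. 0" n] by simp
    qed
    with p q show "q * p \<in> ?J" "p * q \<in> ?J"
      by (auto simp: act_mult intro!: free_carrier_mult)
  qed (auto simp: act_simps intro!: free_carrier_0 free_carrier_add)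
  then show "p \<in> rel_ideal \<Longrightarrow> act \<xi> p F n = 0"
    by auto
qed

lemma act_cong: "p \<approx> q \<Longrightarrow> act \<xi> p F n = act \<xi> q F n"
  using act_ideal[of "p - q" \<xi> F n] by (simp add: cong_def act_diff)

text \<open>A constant in the ideal acts as 0 on the function 1, so all its values vanish. This
  makes the map from the polynomial ring to the target algebra injective.\<close>

lemma scal_in_ideal_iff: "scal c \<in> rel_ideal \<longleftrightarrow> c = 0"
proof
  assume "scal c \<in> rel_ideal"
  then have "zev \<xi> c = 0" for \<xi>
    using act_ideal[of "scal c" \<xi> "\<lambda>_. 1" undefined] by (simp add: act_scal)
  then show "c = 0"
    by (rule zpoly_eq_0_if_zev_eq_0)
qed (simp add: scal_def ideal_0)

section \<open>Faithfulness of the action\<close>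

lemma W_carrier: "k \<in> A_index D \<Longrightarrow> W k \<in> A_carrier"
  and E_carrier: "k \<in> A_index D \<Longrightarrow> E k \<in> A_carrier"
  and E'_carrier: "k \<in> A_index D \<Longrightarrow> E' k \<in> A_carrier"
  by (auto intro!: free_carrier_gen simp: A_gens_iff)

lemmas carrier_intros = W_carrier E_carrier E'_carrier free_carrier_intros

context
  fixes k l :: "nat \<times> nat"
  assumes kl: "k \<in> A_index D" "l \<in> A_index D"
begin

lemma W_W: "W k * W l \<approx> W l * W k"
  using kl A_relators.w_w[of "fst k" "snd k" D "fst l" "snd l"]
  by (intro cong_relator carrier_intros) (auto simp: commut_def)

lemma E_E: "E k * E l \<approx> E l * E k"
  using kl A_relators.eth_eth[of "fst k" "snd k" D "fst l" "snd l"]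
  by (intro cong_relator carrier_intros) (auto simp: commut_def)

lemma E_W: "E k * W l \<approx> (W l + of_bool (k = l)) * E k"
  using kl A_relators.eth_w[of "fst k" "snd k" D "fst l" "snd l"]
  by (intro cong_relator carrier_intros) (auto simp: commut_def prod_eq_iff distrib_right diff_diff_add)

lemma E'_W: "E' k * W l \<approx> (W l - of_bool (k = l)) * E' k"
  using kl A_relators.ethinv_w[of "fst k" "snd k" D "fst l" "snd l"]
  by (intro cong_relator carrier_intros)
    (auto simp: commut_def prod_eq_iff left_diff_distrib algebra_simps)

end

lemma E_E': "k \<in> A_index D \<Longrightarrow> E k * E' k \<approx> 1"
  using A_relators.eth_ethinv[of "fst k" "snd k" D]
  by (intro cong_relator carrier_intros) auto

lemma E'_E: "k \<in> A_index D \<Longrightarrow> E' k * E k \<approx> 1"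
  using A_relators.ethinv_eth[of "fst k" "snd k" D]
  by (intro cong_relator carrier_intros) auto

section \<open>Denominators: a multiplicative set satisfying the Ore condition up to
  congruence\<close>

inductive_set denominators :: "aletter free set" where
  one: "1 \<in> denominators"
| plus: "\<lbrakk>(i, r) \<in> A_index D; (i, r') \<in> A_index D; r \<noteq> r'\<rbrakk> \<Longrightarrow>
    W (i, r) + W (i, r') + of_int m \<in> denominators"
| minus: "\<lbrakk>(i, r) \<in> A_index D; (i, r') \<in> A_index D; r \<noteq> r'\<rbrakk> \<Longrightarrow>
    W (i, r) - W (i, r') + of_int m \<in> denominators"
| half: "(i, r) \<in> A_index D \<Longrightarrow> W (i, r) + cst (of_int m / 2) \<in> denominators"
| mult: "d \<in> denominators \<Longrightarrow> d' \<in> denominators \<Longrightarrow> d * d' \<in> denominators"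

lemma denominators_carrier: "d \<in> denominators \<Longrightarrow> d \<in> A_carrier"
  by (induction rule: denominators.induct) (auto intro!: carrier_intros simp: A_gens_iff)

lemma commutes_add:
  assumes "p * x \<approx> x * p" "q * x \<approx> x * q"
  shows "(p + q) * x \<approx> x * (p + q)"
  using cong_add[OF assms] by (simp add: algebra_simps)

lemma commutes_diff:
  assumes "p * x \<approx> x * p" "q * x \<approx> x * q"
  shows "(p - q) * x \<approx> x * (p - q)"
  using cong_diff[OF assms] by (simp add: algebra_simps)

lemma intertwine_mult:
  assumes "p * x \<approx> x * p'" "q * x \<approx> x * q'" "p \<in> A_carrier" "q' \<in> A_carrier"
  shows "(p * q) * x \<approx> x * (p' * q')"
proof -
  have "p * q * x = p * (q * x)"
    by (simp add: mult.assoc)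
  also have "\<dots> \<approx> p * (x * q')"
    by (rule cong_mult_left) fact+
  also have "p * (x * q') = p * x * q'"
    by (simp add: mult.assoc)
  also have "\<dots> \<approx> x * p' * q'"
    by (rule cong_mult_right) fact+
  finally show ?thesis
    by (simp add: mult.assoc)
qed

lemma denominator_W:
  assumes "d \<in> denominators" "l \<in> A_index D"
  shows "d * W l \<approx> W l * d"
  using assms
proof (induction rule: denominators.induct)
  case (mult d d')
  then show ?case
    by (intro intertwine_mult denominators_carrier)
qed (auto intro!: commutes_add commutes_diff W_W[of "(_, _)", simplified] cong_refl carrier_intros
      simp: mult_of_int_commute cst_commute A_gens_iff)

lemma denominators_commute:
  assumes "d' \<in> denominators" "d \<in> denominators"
  shows "d' * d \<approx> d * d'"
  using assms
proof (induction arbitrary: d rule: denominators.induct)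
  case (mult d1 d2)
  then show ?case
    by (intro intertwine_mult denominators_carrier)
qed (auto intro!: commutes_add commutes_diff cong_sym[OF denominator_W[of _ "(_, _)", simplified]]
      cong_refl carrier_intros intro: denominators_carrier
      simp: mult_of_int_commute cst_commute A_gens_iff)

text \<open>The inverse letters serve for the generators, and left inverses of a product multiply in
  reverse order. A left inverse is what cancels \<open>d\<close> in
  \<open>d * p * word es\<close>.\<close>

lemma denominators_invertible: "d \<in> denominators \<Longrightarrow> \<exists>d'\<in>A_carrier. d' * d \<approx> 1"
proof (induction rule: denominators.induct)
  case (mult d1 d2)
  then obtain e1 e2 where e: "e1 \<in> A_carrier" "e1 * d1 \<approx> 1" "e2 \<in> A_carrier" "e2 * d2 \<approx> 1"
    by blast
  have "e2 * e1 * (d1 * d2) = e2 * (e1 * d1) * d2"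
    by (simp add: mult.assoc)
  also have "\<dots> \<approx> e2 * 1 * d2"
    using e mult.hyps by (intro cong_mult_left cong_mult_right) (auto intro: denominators_carrier)
  also have "\<dots> = e2 * d2"
    by simp
  also note e(4)
  finally show ?case
    using e free_carrier_mult by blast
next
  case (plus i r r' m)
  then show ?case
    using A_relators.plus_inv_left[of i r D r' m]
    by (intro bexI[of _ "free_gen (PlusInv i r r' m)"] cong_relator)
      (auto simp: A_gens_iff intro!: free_carrier_intros)
next
  case (minus i r r' m)
  then show ?case
    using A_relators.minus_inv_left[of i r D r' m]
    by (intro bexI[of _ "free_gen (MinusInv i r r' m)"] cong_relator)
      (auto simp: A_gens_iff intro!: free_carrier_intros)
next
  case (half i r m)
  then show ?case
    using A_relators.half_inv_left[of i r D m]
    by (intro bexI[of _ "free_gen (HalfInv i r m)"] cong_relator)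
      (auto simp: A_gens_iff intro!: free_carrier_intros)
qed (auto intro!: bexI[of _ 1] cong_refl free_carrier_1)

lemma shift_past:
  assumes "e * p \<approx> p' * e" "e * q \<approx> q' * e" "q \<in> A_carrier" "p' \<in> A_carrier"
  shows "e * (p * q) \<approx> (p' * q') * e"
proof -
  have "e * (p * q) = e * p * q"
    by (simp add: mult.assoc)
  also have "\<dots> \<approx> p' * e * q"
    by (rule cong_mult_right) fact+
  also have "p' * e * q = p' * (e * q)"
    by (simp add: mult.assoc)
  also have "\<dots> \<approx> p' * (q' * e)"
    by (rule cong_mult_left) fact+
  finally show ?thesis
    by (simp add: mult.assoc)
qed

lemma shift_past_sum:
  assumes "e * p \<approx> (p + of_int a) * e" "e * q \<approx> (q + of_int b) * e" "c * e = e * c"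
    "e \<in> A_carrier" "c \<in> A_carrier"
  shows "e * (p + q + c) \<approx> (p + q + (of_int (a + b) + c)) * e"
    and "e * (p - q + c) \<approx> (p - q + (of_int (a - b) + c)) * e"
    and "e * (p + c) \<approx> (p + (of_int a + c)) * e"
proof -
  have c: "e * c \<approx> c * e"
    using assms by (simp add: cong_refl free_carrier_mult)
  show "e * (p + q + c) \<approx> (p + q + (of_int (a + b) + c)) * e"
    using cong_add[OF cong_add[OF assms(1,2)] c] by (simp add: distrib_left distrib_right add_ac)
  show "e * (p - q + c) \<approx> (p - q + (of_int (a - b) + c)) * e"
    using cong_add[OF cong_diff[OF assms(1,2)] c]
    by (simp add: distrib_left distrib_right left_diff_distrib right_diff_distrib algebra_simps)
  show "e * (p + c) \<approx> (p + (of_int a + c)) * e"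
    using cong_add[OF assms(1) c] by (simp add: distrib_left distrib_right add_ac)
qed

text \<open>This is the Ore condition: \<open>e\<close> shifts each w by an integer, and the
  denominators are indexed by all integers m, so the shifted element is again a denominator.\<close>

lemma denominators_shift:
  assumes "d \<in> denominators" and e: "e \<in> A_carrier"
    and eW: "\<And>l. l \<in> A_index D \<Longrightarrow> \<exists>a. e * W l \<approx> (W l + of_int a) * e"
  shows "\<exists>d'\<in>denominators. e * d \<approx> d' * e"
  using assms(1)
proof (induction rule: denominators.induct)
  case one
  then show ?case
    using e by (intro bexI[of _ 1]) (auto intro: cong_refl denominators.one)
next
  case (plus i r r' m)
  then obtain a b where "e * W (i, r) \<approx> (W (i, r) + of_int a) * e"
    "e * W (i, r') \<approx> (W (i, r') + of_int b) * e"
    using eW by blast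
  from shift_past_sum(1)[OF this, of "of_int m"] show ?case
    using e denominators.plus[OF plus, of "a + b + m"]
    by (intro bexI[of _ "W (i, r) + W (i, r') + of_int (a + b + m)"])
      (auto simp: mult_of_int_commute free_carrier_of_int add_ac)
next
  case (minus i r r' m)
  then obtain a b where "e * W (i, r) \<approx> (W (i, r) + of_int a) * e"
    "e * W (i, r') \<approx> (W (i, r') + of_int b) * e"
    using eW by blast
  from shift_past_sum(2)[OF this, of "of_int m"] show ?case
    using e denominators.minus[OF minus, of "a - b + m"]
    by (intro bexI[of _ "W (i, r) - W (i, r') + of_int (a - b + m)"])
      (auto simp: mult_of_int_commute free_carrier_of_int add_ac)
next
  case (half i r m)
  then obtain a where a: "e * W (i, r) \<approx> (W (i, r) + of_int a) * e"
    using eW by blast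
  \<comment> \<open>The denominators of this kind contain m/2, so shifting w by \<open>a\<close>
    replaces m by 2a + m.\<close>
  have *: "cst (of_int (2 * a + m) / 2) = (of_int a + cst (of_int m / 2) :: aletter free)"
    by (simp add: cst_def scal_conv_single_0 add_divide_distrib single_add)
  from shift_past_sum(3)[OF a a, of "cst (of_int m / 2)"] show ?case
    using e denominators.half[OF half, of "2 * a + m"] unfolding *
    by (intro bexI[of _ "W (i, r) + (of_int a + cst (of_int m / 2))"])
      (auto simp: cst_commute free_carrier_cst)
next
  case (mult d1 d2)
  then obtain e1 e2 where "e1 \<in> denominators" "e * d1 \<approx> e1 * e"
    "e2 \<in> denominators" "e * d2 \<approx> e2 * e"
    by blast
  then show ?case
    using mult.hyps
    by (intro bexI[of _ "e1 * e2"] shift_past denominators.mult denominators_carrier)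
qed

lemma E_shifts: "k \<in> A_index D \<Longrightarrow> l \<in> A_index D \<Longrightarrow> \<exists>a. E k * W l \<approx> (W l + of_int a) * E k"
  using E_W[of k l] by (intro exI[of _ "of_bool (k = l)"]) simp

lemma E'_shifts: "k \<in> A_index D \<Longrightarrow> l \<in> A_index D \<Longrightarrow> \<exists>a. E' k * W l \<approx> (W l + of_int a) * E' k"
  using E'_W[of k l] by (intro exI[of _ "- of_bool (k = l)"]) simp

section \<open>Words and their rearrangement\<close>

definition word :: "aletter list \<Rightarrow> aletter free"
  where "word xs = Poly_Mapping.single xs 1"

lemma word_Nil: "word [] = 1"
  by (simp add: word_def zero_list_def[symmetric])

lemma word_append: "word (xs @ ys) = word xs * word ys"
  by (simp add: word_def mult_single plus_list_def)

lemma word_Cons: "word (x # xs) = free_gen x * word xs"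
  by (simp add: word_def free_gen_def mult_single plus_list_def)

lemma word_carrier: "set xs \<subseteq> A_gens D \<Longrightarrow> word xs \<in> A_carrier"
  unfolding word_def by (rule free_carrier_single) (auto intro: K_1)

lemma single_conv_word: "Poly_Mapping.single xs c = scal c * word xs"
  by (simp add: word_def scal_def mult_single plus_list_def)

definition W_letters :: "aletter set" where "W_letters = (\<lambda>(i, r). Wl i r) ` A_index D"
definition E_letters :: "aletter set" where "E_letters = (\<lambda>(i, r). Eth i r) ` A_index D"

lemma E_letter: "k \<in> A_index D \<Longrightarrow> Eth (fst k) (snd k) \<in> E_letters"
  by (force simp: E_letters_def)

lemma letters_subset: "W_letters \<subseteq> A_gens D" "E_letters \<subseteq> A_gens D"
  by (auto simp: W_letters_def E_letters_def A_gens_iff)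

lemma E_word_carrier: "es \<in> lists E_letters \<Longrightarrow> word es \<in> A_carrier"
  using letters_subset by (intro word_carrier) (auto simp: lists_eq_set)

lemma word_permute_head:
  assumes S: "S \<subseteq> A_gens D" and "\<And>x y. x \<in> S \<Longrightarrow> y \<in> S \<Longrightarrow> free_gen x * free_gen y \<approx> free_gen y * free_gen x"
    and "x \<in> S" "set xs \<subseteq> S"
  shows "free_gen x * word xs \<approx> word xs * free_gen x"
  using assms(4)
proof (induction xs)
  case Nil
  then show ?case
    using assms(1,3) by (auto simp: word_Nil intro!: cong_refl free_carrier_gen)
next
  case (Cons y xs)
  then have "free_gen x * (free_gen y * word xs) \<approx> (free_gen y * word xs) * free_gen x"
    using assms by (intro shift_past word_carrier free_carrier_gen) auto
  then show ?case
    by (simp add: word_Cons)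
qed

text \<open>The head of \<open>xs\<close> is located in \<open>ys\<close> and commuted to the front.
  Applied separately to the letters \<open>Wl\<close> and to the letters \<open>Eth\<close>.\<close>

lemma word_permute:
  assumes S: "S \<subseteq> A_gens D" and c: "\<And>x y. x \<in> S \<Longrightarrow> y \<in> S \<Longrightarrow> free_gen x * free_gen y \<approx> free_gen y * free_gen x"
    and "set xs \<subseteq> S" "mset xs = mset ys"
  shows "word xs \<approx> word ys"
  using assms(3,4)
proof (induction xs arbitrary: ys)
  case Nil
  then show ?case
    by (auto simp: word_Nil intro: cong_refl free_carrier_1)
next
  case (Cons x xs)
  then have "x \<in> set ys"
    by (metis list.set_intros(1) set_mset_mset)
  then obtain us vs where ys: "ys = us @ x # vs"
    by (meson split_list)
  have "set ys \<subseteq> S"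
    using Cons.prems by (metis set_mset_mset)
  then have uv: "set us \<subseteq> S" "set vs \<subseteq> S" "x \<in> S"
    by (auto simp: ys)
  have "word xs \<approx> word (us @ vs)"
    using Cons.prems by (intro Cons.IH) (auto simp: ys)
  then have "word (x # xs) \<approx> free_gen x * word (us @ vs)"
    using uv S by (auto simp: word_Cons intro!: cong_mult_left free_carrier_gen)
  also have "free_gen x * word (us @ vs) = (free_gen x * word us) * word vs"
    by (simp add: word_append mult.assoc)
  also have "\<dots> \<approx> (word us * free_gen x) * word vs"
    using S uv by (intro cong_mult_right word_permute_head[of S] word_carrier c) auto
  also have "\<dots> = word ys"
    by (simp add: ys word_append word_Cons mult.assoc)
  finally show ?case .
qed

lemma E_letters_commute:
  "x \<in> E_letters \<Longrightarrow> y \<in> E_letters \<Longrightarrow> free_gen x * free_gen y \<approx> free_gen y * free_gen x"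
  using E_E by (force simp: E_letters_def)

lemma W_letters_commute:
  "x \<in> W_letters \<Longrightarrow> y \<in> W_letters \<Longrightarrow> free_gen x * free_gen y \<approx> free_gen y * free_gen x"
  using W_W by (force simp: W_letters_def)

lemma E_words_commute:
  assumes "es \<in> lists E_letters" "es' \<in> lists E_letters"
  shows "word es * word es' \<approx> word es' * word es"
  using word_permute[OF letters_subset(2) E_letters_commute, of "es @ es'" "es' @ es"] assms
  by (auto simp: word_append lists_eq_set)

lemma E_words_invertible:
  assumes "es \<in> lists E_letters"
  shows "\<exists>p\<in>A_carrier. word es * p \<approx> 1"
  using assms
proof (induction es)
  case Nil
  then show ?case
    by (auto simp: word_Nil intro!: bexI[of _ 1] cong_refl free_carrier_1)
next
  case (Cons x es)
  then obtain p where p: "p \<in> A_carrier" "word es * p \<approx> 1"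
    by auto
  obtain k where k: "k \<in> A_index D" "x = Eth (fst k) (snd k)"
    using Cons by (auto simp: E_letters_def)
  have "word (x # es) * (p * E' k) = E k * (word es * p) * E' k"
    by (simp add: word_Cons k mult.assoc)
  also have "\<dots> \<approx> E k * 1 * E' k"
    using p k by (intro cong_mult_left cong_mult_right carrier_intros)
  also have "\<dots> = E k * E' k"
    by simp
  also have "\<dots> \<approx> 1"
    using k by (intro E_E')
  finally show ?case
    using p k by (intro bexI[of _ "p * E' k"]) (auto intro!: free_carrier_mult E'_carrier)
qed

text \<open>The elements congruent to combinations of words with all letters \<open>w\<close> preceding letters \<open>\<eth>\<close>,
  without inverses.\<close>

inductive_set ordered :: "aletter free set" where
  base: "es \<in> lists E_letters \<Longrightarrow> word es \<in> ordered"
| W: "q \<in> ordered \<Longrightarrow> k \<in> A_index D \<Longrightarrow> W k * q \<in> ordered"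
| scal: "q \<in> ordered \<Longrightarrow> c \<in> carrier (Cz D) \<Longrightarrow> scal c * q \<in> ordered"
| add: "p \<in> ordered \<Longrightarrow> q \<in> ordered \<Longrightarrow> p + q \<in> ordered"
| congr: "q \<in> ordered \<Longrightarrow> p \<approx> q \<Longrightarrow> p \<in> ordered"

lemma ordered_carrier: "p \<in> ordered \<Longrightarrow> p \<in> A_carrier"
  by (induction rule: ordered.induct) (auto intro: E_word_carrier carrier_intros cong_carrier)

lemma ordered_cst: "q \<in> ordered \<Longrightarrow> cst z * q \<in> ordered"
  unfolding cst_def by (intro ordered.scal K_const)

lemma ordered_of_int: "q \<in> ordered \<Longrightarrow> of_int m * q \<in> ordered"
  using ordered_cst[of q "of_int m"] by (simp add: cst_def scal_conv_single_0)

lemma ordered_uminus: "q \<in> ordered \<Longrightarrow> - q \<in> ordered"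
  using ordered_of_int[of q "-1"] by simp

lemma ordered_diff: "p \<in> ordered \<Longrightarrow> q \<in> ordered \<Longrightarrow> p - q \<in> ordered"
  using ordered.add[OF _ ordered_uminus, of p q] by simp

lemma ordered_denominator: "d \<in> denominators \<Longrightarrow> q \<in> ordered \<Longrightarrow> d * q \<in> ordered"
proof (induction arbitrary: q rule: denominators.induct)
  case (mult d d')
  then show ?case
    by (simp add: mult.assoc)
qed (auto simp: distrib_right left_diff_distrib
      intro!: ordered.add ordered_diff ordered.W[of _ "(_, _)", simplified] ordered_of_int ordered_cst)

lemma ordered_E_right:
  assumes "q \<in> ordered" "es \<in> lists E_letters"
  shows "q * word es \<in> ordered"
  using assms(1)
proof (induction rule: ordered.induct)
  case (base es')
  then have "word (es' @ es) \<in> ordered"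
    using assms(2) by (intro ordered.base) auto
  then show ?case
    by (simp add: word_append)
next
  case (congr q p)
  then show ?case
    using assms(2) by (blast intro: ordered.congr cong_mult_right E_word_carrier)
qed (auto simp: mult.assoc distrib_right intro: ordered.intros)

text \<open>Passing \<open>e\<close> to the right only shifts the letters w, so the claim is reduced
  to words in \<open>Eth\<close> alone. The right factor \<open>f\<close> is 1 when \<open>e\<close>
  is some \<open>E k\<close>; when \<open>e\<close> is \<open>E' k\<close> it is \<open>E k\<close>,
  which cancels the inverse that \<open>e\<close> brings in.\<close>

lemma ordered_shift:
  assumes q: "q \<in> ordered" and e: "e \<in> A_carrier" "f \<in> A_carrier"
    and eW: "\<And>l. l \<in> A_index D \<Longrightarrow> \<exists>a. e * W l \<approx> (W l + of_int a) * e"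
    and base: "\<And>es. es \<in> lists E_letters \<Longrightarrow> e * word es * f \<in> ordered"
  shows "e * q * f \<in> ordered"
  using q
proof (induction rule: ordered.induct)
  case (base es)
  then show ?case
    by (rule assms(5))
next
  case (W q k)
  then obtain a where a: "e * W k \<approx> (W k + of_int a) * e"
    using eW by blast
  have "e * (W k * q) * f = e * W k * (q * f)"
    by (simp add: mult.assoc)
  also have "\<dots> \<approx> (W k + of_int a) * e * (q * f)"
    using a W.hyps e by (intro cong_mult_right) (auto intro: free_carrier_mult ordered_carrier)
  also have "\<dots> = W k * (e * q * f) + of_int a * (e * q * f)"
    by (simp add: distrib_right mult.assoc)
  finally show ?case
    by (rule ordered.congr[rotated]) (use W in \<open>auto intro!: ordered.add ordered.W ordered_of_int\<close>)
next
  case (scal q c)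
  have "e * (scal c * q) * f = scal c * (e * q * f)"
    by (simp add: mult.assoc[symmetric] scal_commute[of c e])
  then show ?case
    using scal by (simp add: ordered.scal)
next
  case (add p q)
  then show ?case
    by (simp add: distrib_left distrib_right ordered.add)
next
  case (congr q p)
  then show ?case
    using e congr.hyps by (intro ordered.congr[OF congr.IH cong_mult_right[OF cong_mult_left]])
qed

lemma ordered_E_left:
  assumes "q \<in> ordered" "k \<in> A_index D"
  shows "E k * q \<in> ordered"
proof -
  have "E k * q * 1 \<in> ordered"
  proof (rule ordered_shift[OF assms(1)])
    fix es assume "es \<in> lists E_letters"
    then have "word (Eth (fst k) (snd k) # es) \<in> ordered"
      using assms E_letter by (intro ordered.base) auto
    then show "E k * word es * 1 \<in> ordered"
      by (simp add: word_Cons)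
  qed (use assms in \<open>auto intro: E_shifts carrier_intros\<close>)
  then show ?thesis
    by simp
qed

lemma ordered_conjugate:
  assumes "q \<in> ordered" "k \<in> A_index D"
  shows "E' k * q * E k \<in> ordered"
proof (rule ordered_shift[OF assms(1)])
  fix es assume es: "es \<in> lists E_letters"
  have E: "Eth (fst k) (snd k) \<in> E_letters"
    using assms by (intro E_letter)
  have "E' k * word es * E k = E' k * (word es * E k)"
    by (simp add: mult.assoc)
  also have "\<dots> \<approx> E' k * (E k * word es)"
    using es E assms letters_subset
    by (intro cong_mult_left cong_sym[OF word_permute_head[of E_letters]] E_letters_commute E'_carrier)
      (auto simp: lists_eq_set)
  also have "\<dots> = E' k * E k * word es"
    by (simp add: mult.assoc)
  also have "\<dots> \<approx> 1 * word es"
    using es assms by (intro cong_mult_right E'_E E_word_carrier)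
  finally show "E' k * word es * E k \<in> ordered"
    by (rule ordered.congr[rotated]) (use es in \<open>auto intro!: ordered.base\<close>)
qed (use assms in \<open>auto intro: E'_shifts carrier_intros\<close>)

lemma letter_cases:
  assumes "x \<in> A_gens D"
  obtains (W) k where "k \<in> A_index D" "x = Wl (fst k) (snd k)"
  | (E) k where "k \<in> A_index D" "x = Eth (fst k) (snd k)"
  | (E') k where "k \<in> A_index D" "x = EthInv (fst k) (snd k)"
  | (inv) d where "d \<in> denominators" "d * free_gen x \<approx> 1"
proof (cases x)
  case (PlusInv i r r' m)
  then have i: "(i, r) \<in> A_index D" "(i, r') \<in> A_index D" "r \<noteq> r'"
    using assms by (auto simp: A_gens_iff)
  show ?thesis
    using denominators.plus[OF i, of m] A_relators.plus_inv_right[OF i, of m]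
      PlusInv assms denominators_carrier[OF denominators.plus[OF i, of m]]
    by (intro inv[of "W (i, r) + W (i, r') + of_int m"] cong_relator) (auto intro!: free_carrier_intros)
next
  case (MinusInv i r r' m)
  then have i: "(i, r) \<in> A_index D" "(i, r') \<in> A_index D" "r \<noteq> r'"
    using assms by (auto simp: A_gens_iff)
  show ?thesis
    using denominators.minus[OF i, of m] A_relators.minus_inv_right[OF i, of m]
      MinusInv assms denominators_carrier[OF denominators.minus[OF i, of m]]
    by (intro inv[of "W (i, r) - W (i, r') + of_int m"] cong_relator) (auto intro!: free_carrier_intros)
next
  case (HalfInv i r m)
  then have i: "(i, r) \<in> A_index D"
    using assms by (auto simp: A_gens_iff)
  show ?thesis
    using denominators.half[OF i, of m] A_relators.half_inv_right[OF i, of m]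
      HalfInv assms denominators_carrier[OF denominators.half[OF i, of m]]
    by (intro inv[of "W (i, r) + cst (of_int m / 2)"] cong_relator) (auto intro!: free_carrier_intros)
qed (use assms that in \<open>force simp: A_gens_iff\<close>)+

text \<open>The denominator collects on the left and the compensating word on the right, letter by
  letter. A letter w changes neither, \<open>Eth\<close> shifts the denominator,
  \<open>EthInv\<close> also lengthens the word, and an inverse letter enlarges the
  denominator.\<close>

lemma denominator_clearing:
  assumes "p \<in> A_carrier"
  shows "\<exists>d\<in>denominators. \<exists>es\<in>lists E_letters. d * p * word es \<in> ordered"
  using assms
proof (induction rule: free_carrier_induct)
  case (scal c)
  have "scal c * word [] \<in> ordered"
    using scal by (intro ordered.scal ordered.base) auto
  then show ?case
    by (intro bexI[of _ 1] bexI[of _ "[]"]) (auto intro: denominators.one)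
next
  case (add p q)
  then obtain d1 es1 d2 es2 where
    d: "d1 \<in> denominators" "d2 \<in> denominators" and es: "es1 \<in> lists E_letters" "es2 \<in> lists E_letters"
    and o: "d1 * p * word es1 \<in> ordered" "d2 * q * word es2 \<in> ordered"
    by blast
  note c = d[THEN denominators_carrier] es[THEN E_word_carrier]
  \<comment> \<open>The two summands get a common denominator and a common word; denominators
    commute with each other up to congruence, and so do words in \<open>Eth\<close>.\<close>
  have "d1 * d2 * p * word (es1 @ es2) = (d1 * d2) * (p * word (es1 @ es2))"
    by (simp add: mult.assoc)
  also have "\<dots> \<approx> (d2 * d1) * (p * word (es1 @ es2))"
    using d es add.hyps by (intro cong_mult_right denominators_commute free_carrier_mult E_word_carrier) auto
  also have "\<dots> = d2 * (d1 * p * word es1) * word es2"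
    by (simp add: mult.assoc word_append)
  finally have 1: "d1 * d2 * p * word (es1 @ es2) \<in> ordered"
    by (rule ordered.congr[rotated])
      (use d es o in \<open>blast intro: ordered_E_right ordered_denominator\<close>)
  have "d1 * d2 * q * word (es1 @ es2) = (d1 * d2 * q) * (word es1 * word es2)"
    by (simp add: mult.assoc word_append)
  also have "\<dots> \<approx> (d1 * d2 * q) * (word es2 * word es1)"
    using c es add.hyps by (intro cong_mult_left E_words_commute free_carrier_mult)
  also have "\<dots> = d1 * (d2 * q * word es2) * word es1"
    by (simp add: mult.assoc)
  finally have 2: "d1 * d2 * q * word (es1 @ es2) \<in> ordered"
    by (rule ordered.congr[rotated])
      (use d es o in \<open>blast intro: ordered_E_right ordered_denominator\<close>)
  have "d1 * d2 * (p + q) * word (es1 @ es2) \<in> ordered"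
    using ordered.add[OF 1 2] by (simp add: distrib_left distrib_right)
  then show ?case
    using d es by (intro bexI[of _ "d1 * d2"] bexI[of _ "es1 @ es2"]) (auto intro: denominators.mult)
next
  case (gen x p)
  then obtain d es where d: "d \<in> denominators" and es: "es \<in> lists E_letters"
    and o: "d * p * word es \<in> ordered"
    by blast
  note c = d[THEN denominators_carrier] es[THEN E_word_carrier] gen.hyps(2)
  from gen.hyps(1) show ?case
  proof (cases rule: letter_cases)
    case (W k)
    have "d * (W k * p) * word es = d * W k * (p * word es)"
      by (simp add: mult.assoc)
    also have "\<dots> \<approx> W k * d * (p * word es)"
      using d W c by (intro cong_mult_right denominator_W carrier_intros)
    also have "\<dots> = W k * (d * p * word es)"
      by (simp add: mult.assoc)
    finally show ?thesis
      using W(1) d es o ordered.congr[OF ordered.W[OF o W(1)]] unfolding W(2) by blast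
  next
    case (E k)
    then obtain d' where d': "d' \<in> denominators" "E k * d \<approx> d' * E k"
      using denominators_shift[OF d E_carrier E_shifts] by blast
    have "d' * (E k * p) * word es = d' * E k * (p * word es)"
      by (simp add: mult.assoc)
    also have "\<dots> \<approx> E k * d * (p * word es)"
      using d' E c by (intro cong_mult_right cong_sym[OF d'(2)] carrier_intros)
    also have "\<dots> = E k * (d * p * word es)"
      by (simp add: mult.assoc)
    finally show ?thesis
      using d' es ordered.congr[OF ordered_E_left[OF o E(1)]] unfolding E(2) by blast
  next
    case (E' k)
    then obtain d' where d': "d' \<in> denominators" "E' k * d \<approx> d' * E' k"
      using denominators_shift[OF d E'_carrier E'_shifts] by blast
    \<comment> \<open>The letter appended on the right cancels \<open>E' k\<close>, which can be
      carried to it because it shifts the w and commutes with the \<open>Eth\<close>.\<close>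
    have "d' * (E' k * p) * word (es @ [Eth (fst k) (snd k)]) = d' * E' k * (p * word es * E k)"
      by (simp add: mult.assoc word_append word_Cons word_Nil)
    also have "\<dots> \<approx> E' k * d * (p * word es * E k)"
      using d' E' c by (intro cong_mult_right cong_sym[OF d'(2)] carrier_intros)
    also have "\<dots> = E' k * (d * p * word es) * E k"
      by (simp add: mult.assoc)
    finally have "d' * (E' k * p) * word (es @ [Eth (fst k) (snd k)]) \<in> ordered"
      by (rule ordered.congr[OF ordered_conjugate[OF o E'(1)]])
    moreover have "es @ [Eth (fst k) (snd k)] \<in> lists E_letters"
      using es E' E_letter by auto
    ultimately show ?thesis
      using d' unfolding E'(2) by blast
  next
    case (inv d')
    have "d * d' * (free_gen x * p) * word es = d * (d' * free_gen x) * (p * word es)"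
      by (simp add: mult.assoc)
    also have "\<dots> \<approx> d * 1 * (p * word es)"
      using inv c by (intro cong_mult_right cong_mult_left free_carrier_mult)
    also have "\<dots> = d * p * word es"
      by (simp add: mult.assoc)
    finally show ?thesis
      using inv d es ordered.congr[OF o] denominators.mult by blast
  qed
qed

section \<open>Normal words and their action\<close>

definition normal_words :: "aletter list set"
  where "normal_words = {ws @ es | ws es. ws \<in> lists W_letters \<and> es \<in> lists E_letters}"

lemma normal_words_letters: "xs \<in> normal_words \<Longrightarrow> set xs \<subseteq> W_letters \<union> E_letters"
  by (auto simp: normal_words_def)

text \<open>\<open>ordered\<close> is closed under congruence and so says nothing about the support
  of an element. The action is computed from the support, hence the choice of a representative
  supported on normal words.\<close>

lemma ordered_normal:
  assumes "p \<in> ordered"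
  shows "\<exists>q. p \<approx> q \<and> Poly_Mapping.keys q \<subseteq> normal_words"
  using assms
proof (induction rule: ordered.induct)
  case (base es)
  then have "es \<in> normal_words"
    unfolding normal_words_def by (intro CollectI exI[of _ "[]"] exI[of _ es]) auto
  then show ?case
    using base by (intro exI[of _ "word es"]) (simp_all add: cong_refl E_word_carrier, simp add: word_def)
next
  case (W p k)
  then obtain q where q: "p \<approx> q" "Poly_Mapping.keys q \<subseteq> normal_words"
    by blast
  have "Poly_Mapping.keys (W k * q) \<subseteq> normal_words"
  proof
    fix xs assume "xs \<in> Poly_Mapping.keys (W k * q)"
    then obtain xs' ys where "xs = xs' + ys" "xs' \<in> Poly_Mapping.keys (W k)" "ys \<in> Poly_Mapping.keys q"
      using subsetD[OF keys_mult] by blast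
    then have ys: "xs = Wl (fst k) (snd k) # ys" "ys \<in> Poly_Mapping.keys q"
      by (simp_all add: free_gen_def plus_list_def)
    then obtain ws es where "ys = ws @ es" "ws \<in> lists W_letters" "es \<in> lists E_letters"
      using q unfolding normal_words_def by blast
    moreover have "Wl (fst k) (snd k) \<in> W_letters"
      using W by (force simp: W_letters_def)
    ultimately show "xs \<in> normal_words"
      unfolding normal_words_def ys
      by (intro CollectI exI[of _ "Wl (fst k) (snd k) # ws"] exI[of _ es]) auto
  qed
  then show ?case
    using cong_mult_left[OF q(1) W_carrier[OF W.hyps(2)]] by blast
next
  case (scal p c)
  then obtain q where q: "p \<approx> q" "Poly_Mapping.keys q \<subseteq> normal_words"
    by blast
  have "Poly_Mapping.keys (scal c * q) \<subseteq> normal_words"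
  proof
    fix xs assume "xs \<in> Poly_Mapping.keys (scal c * q)"
    then obtain xs' ys where "xs = xs' + ys" "xs' \<in> Poly_Mapping.keys (scal c)" "ys \<in> Poly_Mapping.keys q"
      using subsetD[OF keys_mult] by blast
    then show "xs \<in> normal_words"
      using q by (auto simp: scal_def plus_list_def split: if_splits)
  qed
  then show ?case
    using cong_mult_left[OF q(1) free_carrier_scal[OF scal.hyps(2)]] by blast
next
  case (add p p')
  then obtain q q' where "p \<approx> q" "p' \<approx> q'"
    "Poly_Mapping.keys q \<subseteq> normal_words" "Poly_Mapping.keys q' \<subseteq> normal_words"
    by blast
  then show ?case
    using keys_add[of q q'] by (intro exI[of _ "q + q'"]) (auto intro: cong_add)
next
  case (congr q p)
  then show ?case
    by (blast intro: cong_trans)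
qed

text \<open>The two kinds of letters are disjoint, so filtering recovers both halves of a normal
  word and of its multiset; each half is then permuted separately.\<close>

lemma normal_words_cong:
  assumes "xs \<in> normal_words" "ys \<in> normal_words" "mset xs = mset ys"
  shows "word xs \<approx> word ys"
proof -
  obtain ws es ws' es' where xs: "xs = ws @ es" "ws \<in> lists W_letters" "es \<in> lists E_letters"
    and ys: "ys = ws' @ es'" "ws' \<in> lists W_letters" "es' \<in> lists E_letters"
    using assms by (auto simp: normal_words_def)
  have disj: "x \<notin> E_letters" if "x \<in> W_letters" for x
    using that by (auto simp: W_letters_def E_letters_def)
  have filter: "filter (\<lambda>x. x \<in> W_letters) (us @ vs) = us" "filter (\<lambda>x. x \<notin> W_letters) (us @ vs) = vs"
    if "us \<in> lists W_letters" "vs \<in> lists E_letters" for us vs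
  proof -
    have "\<forall>x\<in>set us. x \<in> W_letters" "\<forall>x\<in>set vs. x \<notin> W_letters"
      using that disj by (auto simp: lists_eq_set)
    then show "filter (\<lambda>x. x \<in> W_letters) (us @ vs) = us" "filter (\<lambda>x. x \<notin> W_letters) (us @ vs) = vs"
      by (simp_all add: filter_id_conv filter_empty_conv)
  qed
  have "mset ws = mset ws'" "mset es = mset es'"
    using assms(3) filter[OF xs(2,3)] filter[OF ys(2,3)] unfolding xs(1) ys(1)
    by (metis mset_filter)+
  then have "word ws \<approx> word ws'" "word es \<approx> word es'"
    using word_permute[OF letters_subset(1) W_letters_commute, of ws ws']
      word_permute[OF letters_subset(2) E_letters_commute, of es es'] xs
    by (auto simp: lists_eq_set)
  then show ?thesis
    unfolding xs ys word_append by (rule cong_mult)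
qed

definition W_count :: "aletter multiset \<Rightarrow> nat \<times> nat \<Rightarrow> nat"
  where "W_count M k = count M (Wl (fst k) (snd k))"

text \<open>Integer valued, being the amount by which a normal word shifts the coordinate
  \<open>k\<close>.\<close>

definition E_count :: "aletter multiset \<Rightarrow> nat \<times> nat \<Rightarrow> int"
  where "E_count M k = int (count M (Eth (fst k) (snd k)))"

lemma wshift_normal: "xs \<in> lists (W_letters \<union> E_letters) \<Longrightarrow> wshift xs n = (\<lambda>k. n k + E_count (mset xs) k)"
proof (induction xs arbitrary: n)
  case (Cons x xs)
  then show ?case
    by (auto simp: W_letters_def E_letters_def E_count_def fun_eq_iff split: if_splits)
qed (simp add: E_count_def)

lemma wcoef_E_letters: "es \<in> lists E_letters \<Longrightarrow> wcoef es n = 1"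
  by (induction es arbitrary: n) (auto simp: E_letters_def)

text \<open>The letters w stand first and are all evaluated at the unshifted point; the letters
  \<open>Eth\<close> contribute the factor 1. The coefficient is thus a monomial in the coordinates
  of \<open>n\<close>.\<close>

lemma wcoef_normal:
  assumes fin: "finite (A_index D)" and "ws \<in> lists W_letters" "es \<in> lists E_letters"
  shows "wcoef (ws @ es) n = (\<Prod>k\<in>A_index D. pt n k ^ W_count (mset (ws @ es)) k)"
  using assms(2)
proof (induction ws)
  case Nil
  have "W_count (mset es) k = 0" for k
    using assms(3) by (auto simp: W_count_def count_eq_zero_iff E_letters_def lists_eq_set)
  then show ?case
    using assms by (simp add: wcoef_E_letters)
next
  case (Cons x ws)
  then obtain k where k: "k \<in> A_index D" "x = Wl (fst k) (snd k)"
    by (auto simp: W_letters_def)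
  have "pt n l ^ W_count (mset ((x # ws) @ es)) l =
      (if l = k then pt n l else 1) * pt n l ^ W_count (mset (ws @ es)) l" for l
    by (auto simp: W_count_def k prod_eq_iff)
  then show ?case
    using Cons fin k by (simp add: prod.distrib prod.delta)
qed

text \<open>Normal words with the same multiset are congruent, so only the sums of coefficients over
  the fibres of \<open>mset\<close> matter. Testing on delta functions separates the shifts; for one
  shift the sum is a polynomial on the grid, whose coefficients vanish by independence of
  monomials.\<close>

lemma ordered_faithful:
  assumes fin: "finite (A_index D)" and q: "Poly_Mapping.keys q \<subseteq> normal_words" "q \<in> A_carrier"
    and zero: "\<And>\<xi> F n. range \<xi> \<subseteq> \<real> \<Longrightarrow> n \<in> base_lattice \<Longrightarrow> act \<xi> q F n = 0"
  shows "q \<in> rel_ideal"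
proof -
  let ?Q = "Poly_Mapping.keys q"
  define fib where "fib M = {xs\<in>?Q. mset xs = M}" for M
  have finfib: "finite (fib M)" for M
    by (simp add: fib_def)
  have coeff0: "(\<Sum>xs\<in>fib M. Poly_Mapping.lookup q xs) = 0" if M: "M \<in> mset ` ?Q" for M
  proof (rule zpoly_eq_0_if_zev_eq_0)
    fix \<xi> :: "nat \<times> nat \<Rightarrow> complex" assume \<xi>: "range \<xi> \<subseteq> \<real>"
    let ?T = "{M' \<in> mset ` ?Q. E_count M' = E_count M}"
    let ?c = "\<lambda>M. zev \<xi> (\<Sum>xs\<in>fib M. Poly_Mapping.lookup q xs)"
    let ?S = "\<lambda>k::nat \<times> nat. (\<lambda>t::int. of_int t + \<i> * of_nat (snd k)) ` UNIV"
    show "?c M = 0"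
    proof (rule monomials_independent_on_grid[where T = ?T and V = "A_index D" and S = ?S and e = W_count])
      show "infinite (?S k)" for k
        by (simp add: finite_image_iff inj_on_def)
    next
      fix M1 M2 assume M12: "M1 \<in> ?T" "M2 \<in> ?T" "\<forall>v\<in>A_index D. W_count M1 v = W_count M2 v"
      show "M1 = M2"
      proof (rule multiset_eqI)
        fix x
        have "set_mset M \<subseteq> W_letters \<union> E_letters" if "M \<in> mset ` ?Q" for M
          using that q(1) normal_words_letters by fastforce
        then have "set_mset M1 \<subseteq> W_letters \<union> E_letters" "set_mset M2 \<subseteq> W_letters \<union> E_letters"
          using M12(1,2) by blast+
        moreover have "count M1 x = count M2 x" if "x \<in> W_letters"
          using that M12(3) by (auto simp: W_letters_def W_count_def)
        moreover have "count M1 x = count M2 x" if x: "x \<in> E_letters"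
        proof -
          obtain k where "x = Eth (fst k) (snd k)"
            using x unfolding E_letters_def by force
          moreover have "E_count M1 k = E_count M2 k"
            using M12(1,2) by simp
          ultimately show ?thesis
            by (simp add: E_count_def)
        qed
        ultimately show "count M1 x = count M2 x"
          by (metis UnE count_eq_zero_iff subsetD)
      qed
    next
      fix a assume a: "\<forall>k\<in>A_index D. a k \<in> ?S k"
      \<comment> \<open>Real parts recover the lattice point whose coordinates are the prescribed
        grid values.\<close>
      define n :: lattice where "n k = (if k \<in> A_index D then \<lfloor>Re (a k)\<rfloor> else 0)" for k
      have n: "n \<in> base_lattice"
        by (simp add: n_def base_lattice_def)
      have pt: "pt n k = a k" if "k \<in> A_index D" for k
      proof -
        obtain t :: int where "a k = of_int t + \<i> * of_nat (snd k)"
          using a \<open>k \<in> A_index D\<close> by blast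
        then show ?thesis
          using that by (simp add: pt_def n_def)
      qed
      \<comment> \<open>The delta function at the point to which words with the shift of
        \<open>M\<close> lead; words with another shift drop out.\<close>
      define F :: "lattice \<Rightarrow> complex" where "F m = of_bool (m = (\<lambda>k. n k + E_count M k))" for m
      have "0 = act \<xi> q F n"
        using zero[OF \<xi> n] by simp
      also have "\<dots> = (\<Sum>xs\<in>?Q. zev \<xi> (Poly_Mapping.lookup q xs) *
          ((\<Prod>k\<in>A_index D. a k ^ W_count (mset xs) k) * of_bool (E_count (mset xs) = E_count M)))"
        unfolding act_def pm_sum_def
      proof (intro sum.cong refl arg_cong2[of _ _ _ _ "(*)"])
        fix xs assume "xs \<in> ?Q"
        then obtain ws es where xs: "xs = ws @ es" "ws \<in> lists W_letters" "es \<in> lists E_letters"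
          using q unfolding normal_words_def by blast
        show "wcoef xs n = (\<Prod>k\<in>A_index D. a k ^ W_count (mset xs) k)"
          using wcoef_normal[OF fin xs(2,3), of n] pt by (simp add: xs(1))
        have "wshift xs n = (\<lambda>k. n k + E_count (mset xs) k)"
          using xs by (intro wshift_normal) auto
        then show "F (wshift xs n) = of_bool (E_count (mset xs) = E_count M)"
          by (simp add: F_def fun_eq_iff)
      qed
      also have "\<dots> = (\<Sum>M'\<in>mset ` ?Q. \<Sum>xs\<in>fib M'. zev \<xi> (Poly_Mapping.lookup q xs) *
          ((\<Prod>k\<in>A_index D. a k ^ W_count (mset xs) k) * of_bool (E_count (mset xs) = E_count M)))"
        unfolding fib_def by (rule sum.group[symmetric]) auto
      also have "\<dots> = (\<Sum>M'\<in>mset ` ?Q. if E_count M' = E_count M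
          then ?c M' * (\<Prod>k\<in>A_index D. a k ^ W_count M' k) else 0)"
      proof (intro sum.cong refl)
        fix M'
        have "(\<Sum>xs\<in>fib M'. zev \<xi> (Poly_Mapping.lookup q xs) *
            ((\<Prod>k\<in>A_index D. a k ^ W_count (mset xs) k) * of_bool (E_count (mset xs) = E_count M))) =
          (\<Sum>xs\<in>fib M'. zev \<xi> (Poly_Mapping.lookup q xs) *
            ((\<Prod>k\<in>A_index D. a k ^ W_count M' k) * of_bool (E_count M' = E_count M)))"
          by (intro sum.cong) (auto simp: fib_def)
        then show "(\<Sum>xs\<in>fib M'. zev \<xi> (Poly_Mapping.lookup q xs) *
            ((\<Prod>k\<in>A_index D. a k ^ W_count (mset xs) k) * of_bool (E_count (mset xs) = E_count M))) =
          (if E_count M' = E_count M then ?c M' * (\<Prod>k\<in>A_index D. a k ^ W_count M' k) else 0)"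
          by (simp add: sum_distrib_right)
      qed
      also have "\<dots> = (\<Sum>M'\<in>?T. ?c M' * (\<Prod>k\<in>A_index D. a k ^ W_count M' k))"
        by (rule sum.inter_filter[symmetric]) simp
      finally show "(\<Sum>M'\<in>?T. ?c M' * (\<Prod>k\<in>A_index D. a k ^ W_count M' k)) = 0"
        by simp
    qed (use fin M in auto)
  qed
  \<comment> \<open>One word for each multiset turns the sum over a fibre into that word times the
    sum of the coefficients, which is 0.\<close>
  define rep where "rep M = (SOME xs. xs \<in> ?Q \<and> mset xs = M)" for M
  have rep: "rep M \<in> ?Q \<and> mset (rep M) = M" if "M \<in> mset ` ?Q" for M
    unfolding rep_def by (rule someI_ex) (use that in auto)
  have K: "Poly_Mapping.lookup q xs \<in> carrier (Cz D)" for xs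
    using q(2) by (auto simp: free_carrier_def)
  have "q = (\<Sum>xs\<in>?Q. scal (Poly_Mapping.lookup q xs) * word xs)"
    using poly_mapping_expand[of q] by (simp add: single_conv_word)
  also have "\<dots> \<approx> (\<Sum>xs\<in>?Q. scal (Poly_Mapping.lookup q xs) * word (rep (mset xs)))"
  proof (intro cong_sum cong_mult_left free_carrier_scal K)
    fix xs assume "xs \<in> ?Q"
    then show "word xs \<approx> word (rep (mset xs))"
      using q rep[of "mset xs"] by (intro normal_words_cong) auto
  qed
  also have "\<dots> = (\<Sum>M\<in>mset ` ?Q. \<Sum>xs\<in>fib M. scal (Poly_Mapping.lookup q xs) * word (rep (mset xs)))"
    unfolding fib_def by (rule sum.group[symmetric]) auto
  also have "\<dots> = (\<Sum>M\<in>mset ` ?Q. \<Sum>xs\<in>fib M. scal (Poly_Mapping.lookup q xs) * word (rep M))"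
    by (intro sum.cong) (auto simp: fib_def)
  also have "\<dots> = (\<Sum>M\<in>mset ` ?Q. scal (\<Sum>xs\<in>fib M. Poly_Mapping.lookup q xs) * word (rep M))"
    by (simp add: scal_sum sum_distrib_right)
  also have "\<dots> = 0"
    using coeff0 by (simp add: scal_def)
  finally show ?thesis
    by (simp add: cong_0_iff)
qed

lemma wshift_base_lattice:
  "set xs \<subseteq> A_gens D \<Longrightarrow> n \<in> base_lattice \<Longrightarrow> wshift xs n \<in> base_lattice"
proof (induction xs arbitrary: n)
  case (Cons x xs)
  then have "lshift x n \<in> base_lattice"
    by (cases x) (auto simp: base_lattice_def A_gens_iff)
  with Cons show ?case
    by simp
qed simp

text \<open>The letters of \<open>A_gens D\<close> never lead out of \<open>base_lattice\<close>, so
  values of a function elsewhere are not seen.\<close>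

lemma act_carrier_cong:
  assumes "p \<in> A_carrier" "n \<in> base_lattice" "\<And>m. m \<in> base_lattice \<Longrightarrow> F m = G m"
  shows "act \<xi> p F n = act \<xi> p G n"
  unfolding act_def pm_sum_def
proof (intro sum.cong refl)
  fix xs assume "xs \<in> Poly_Mapping.keys p"
  then have "wshift xs n \<in> base_lattice"
    using assms by (intro wshift_base_lattice) (auto simp: free_carrier_def in_keys_iff)
  then show "zev \<xi> (Poly_Mapping.lookup p xs) * (wcoef xs n * F (wshift xs n)) =
    zev \<xi> (Poly_Mapping.lookup p xs) * (wcoef xs n * G (wshift xs n))"
    using assms(3) by simp
qed

text \<open>The factors \<open>d\<close> and \<open>word es\<close> supplied by
  \<open>denominator_clearing\<close> are invertible on the left and on the right respectively, so
  \<open>p\<close> is recovered once \<open>d * p * word es\<close> is known to be congruent to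
  0.\<close>

lemma act_faithful:
  assumes fin: "finite (A_index D)" and p: "p \<in> A_carrier"
    and zero: "\<And>\<xi> F n. range \<xi> \<subseteq> \<real> \<Longrightarrow> n \<in> base_lattice \<Longrightarrow> act \<xi> p F n = 0"
  shows "p \<in> rel_ideal"
proof -
  obtain d es where d: "d \<in> denominators" and es: "es \<in> lists E_letters" and o: "d * p * word es \<in> ordered"
    using denominator_clearing[OF p] by blast
  obtain q where q: "d * p * word es \<approx> q" "Poly_Mapping.keys q \<subseteq> normal_words"
    using ordered_normal[OF o] by blast
  have "q \<in> rel_ideal"
  proof (rule ordered_faithful[OF fin q(2) cong_carrier(2)[OF q(1)]])
    fix \<xi> :: "nat \<times> nat \<Rightarrow> complex" and F n assume \<xi>: "range \<xi> \<subseteq> \<real>" and n: "n \<in> base_lattice"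
    have "act \<xi> q F n = act \<xi> d (act \<xi> p (act \<xi> (word es) F)) n"
      using act_cong[OF q(1), of \<xi> F n] by (simp add: act_mult act_mult[abs_def])
    also have "\<dots> = act \<xi> d (\<lambda>_. 0) n"
      using zero[OF \<xi>] by (intro act_carrier_cong denominators_carrier d n)
    also have "\<dots> = 0"
      using act_scale[of \<xi> d 0 "\<lambda>_. 0" n] by simp
    finally show "act \<xi> q F n = 0" .
  qed
  then have "q \<approx> 0"
    by (simp add: cong_0_iff)
  then have 0: "d * p * word es \<approx> 0"
    using q(1) cong_trans by blast
  obtain d' where d': "d' \<in> A_carrier" "d' * d \<approx> 1"
    using denominators_invertible[OF d] by blast
  obtain e where e: "e \<in> A_carrier" "word es * e \<approx> 1"
    using E_words_invertible[OF es] by blast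
  have "p = 1 * p * 1"
    by simp
  also have "\<dots> \<approx> (d' * d) * p * (word es * e)"
    using p by (intro cong_mult cong_sym[OF d'(2)] cong_sym[OF e(2)] cong_refl)
  also have "\<dots> = d' * (d * p * word es) * e"
    by (simp add: mult.assoc)
  also have "\<dots> \<approx> d' * 0 * e"
    using 0 d' e by (intro cong_mult_left cong_mult_right)
  finally show ?thesis
    by (simp add: cong_0_iff)
qed

section \<open>Operators commuting with multiplications and shifts\<close>

text \<open>\<open>act \<xi> p (delta m) n\<close> is the matrix entry of the operator
  \<open>p\<close> in row \<open>n\<close> and column \<open>m\<close>.\<close>

definition delta :: "lattice \<Rightarrow> lattice \<Rightarrow> complex"
  where "delta m n = of_bool (n = m)"

text \<open>Row \<open>n\<close> can have nonzero entries only at the finitely many points to which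
  the words of \<open>p\<close> lead from \<open>n\<close>, so \<open>F\<close> may be expanded in
  delta functions.\<close>

lemma act_diagonal:
  assumes p: "p \<in> A_carrier" and n: "n \<in> base_lattice"
    and off: "\<And>m. m \<in> base_lattice \<Longrightarrow> m \<noteq> n \<Longrightarrow> act \<xi> p (delta m) n = 0"
  shows "act \<xi> p F n = act \<xi> p (delta n) n * F n"
proof -
  let ?P = "Poly_Mapping.keys p"
  let ?M = "(\<lambda>xs. wshift xs n) ` ?P"
  let ?t = "\<lambda>xs. zev \<xi> (Poly_Mapping.lookup p xs) * wcoef xs n"
  have M: "m \<in> base_lattice" if "m \<in> ?M" for m
    using that p n by (auto simp: free_carrier_def in_keys_iff intro!: wshift_base_lattice)
  have kernel: "act \<xi> p (delta m) n = (\<Sum>xs\<in>{xs\<in>?P. wshift xs n = m}. ?t xs)" for m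
    unfolding act_def pm_sum_def delta_def
    by (subst sum.inter_filter) (auto intro!: sum.cong simp: mult.assoc)
  have "act \<xi> p F n = (\<Sum>xs\<in>?P. ?t xs * F (wshift xs n))"
    by (simp add: act_def pm_sum_def mult.assoc)
  also have "\<dots> = (\<Sum>m\<in>?M. \<Sum>xs\<in>{xs\<in>?P. wshift xs n = m}. ?t xs * F (wshift xs n))"
    by (rule sum.group[symmetric]) auto
  also have "\<dots> = (\<Sum>m\<in>?M. act \<xi> p (delta m) n * F m)"
    by (intro sum.cong refl) (simp add: kernel sum_distrib_right)
  also have "\<dots> = (\<Sum>m\<in>?M. if m = n then act \<xi> p (delta n) n * F n else 0)"
    using M off by (intro sum.cong) auto
  also have "\<dots> = (if n \<in> ?M then act \<xi> p (delta n) n * F n else 0)"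
    by (simp add: sum.delta)
  also have "\<dots> = act \<xi> p (delta n) n * F n"
  proof -
    \<comment> \<open>If no word of \<open>p\<close> leads from \<open>n\<close> back to
      \<open>n\<close>, the diagonal entry is an empty sum.\<close>
    have "act \<xi> p (delta n) n = 0" if "n \<notin> ?M"
    proof -
      have "{xs\<in>?P. wshift xs n = n} = {}"
        using that by force
      then show ?thesis
        by (simp only: kernel sum.empty)
    qed
    then show ?thesis
      by auto
  qed
  finally show ?thesis .
qed

text \<open>Raising a coordinate is undone by the lowering hypothesis at the raised point, so
  integer induction runs both ways from 0. The coordinates are then reset to 0 one at a time, and
  finiteness of the index set ends the process.\<close>

lemma shift_invariant_constant:
  fixes g :: "lattice \<Rightarrow> complex"
  assumes fin: "finite (A_index D)"
    and inv: "\<And>n k. n \<in> base_lattice \<Longrightarrow> k \<in> A_index D \<Longrightarrow> g (n(k := n k - 1)) = g n"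
    and "n \<in> base_lattice"
  shows "g n = g (\<lambda>_. 0)"
proof -
  have shift: "g (n(k := t)) = g (n(k := 0))" if n: "n \<in> base_lattice" and k: "k \<in> A_index D" for n k t
  proof (induction t rule: int_induct[of _ 0])
    case (step1 i)
    have "n(k := i + 1) \<in> base_lattice"
      using n k by (auto simp: base_lattice_def)
    from inv[OF this k] step1(2) show ?case
      by (simp only: fun_upd_upd fun_upd_same add_diff_cancel_right')
  next
    case (step2 i)
    have "n(k := i) \<in> base_lattice"
      using n k by (auto simp: base_lattice_def)
    from inv[OF this k] step2(2) show ?case
      by (simp only: fun_upd_upd fun_upd_same)
  qed simp
  have "g n = g (\<lambda>_. 0)" if "finite S" "S \<subseteq> A_index D" "\<forall>k. k \<notin> S \<longrightarrow> n k = 0" for S n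
    using that
  proof (induction S arbitrary: n)
    case empty
    then have "n = (\<lambda>_. 0)"
      by auto
    then show ?case
      by simp
  next
    case (insert k S)
    have "n \<in> base_lattice"
      using insert.prems unfolding base_lattice_def by blast
    then have "g n = g (n(k := 0))"
      using shift[of n k "n k"] insert.prems by simp
    also have "\<dots> = g (\<lambda>_. 0)"
      using insert.prems by (intro insert.IH) auto
    finally show ?case .
  qed
  from this[OF fin subset_refl] assms(3) show ?thesis
    unfolding base_lattice_def by blast
qed

text \<open>The letters act independently of \<open>z\<close>.\<close>

lemma act_at_is_zev:
  assumes "p \<in> A_carrier"
  shows "\<exists>c\<in>carrier (Cz D). \<forall>\<xi>. act \<xi> p F n = zev \<xi> c"
proof -
  let ?c = "\<Sum>xs\<in>Poly_Mapping.keys p.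
    Poly_Mapping.lookup p xs * Poly_Mapping.single 0 (wcoef xs n * F (wshift xs n))"
  have "act \<xi> p F n = zev \<xi> ?c" for \<xi>
    by (simp add: act_def pm_sum_def mon_eval_def)
  moreover have "?c \<in> carrier (Cz D)"
    using assms by (intro K_sum K_mult K_const) (auto simp: free_carrier_def)
  ultimately show ?thesis
    by blast
qed

text \<open>The witnesses \<open>h\<close>, \<open>\<phi>\<close> and \<open>b\<close> may depend on
  \<open>\<xi>\<close> and on the points: matrix entries of \<open>p\<close> are compared for one
  \<open>\<xi>\<close> at a time, and only the final polynomial has to be uniform in
  \<open>\<xi>\<close>.\<close>

lemma commutant_scalar:
  assumes fin: "finite (A_index D)" and p: "p \<in> A_carrier"
    and separating: "\<And>\<xi> n m. range \<xi> \<subseteq> \<real> \<Longrightarrow> n \<in> base_lattice \<Longrightarrow> m \<in> base_lattice \<Longrightarrow> m \<noteq> n \<Longrightarrow>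
      \<exists>h \<phi>. p * h \<approx> h * p \<and> (\<forall>F n. act \<xi> h F n = \<phi> n * F n) \<and> \<phi> m \<noteq> \<phi> n"
    and transitive: "\<And>\<xi> n k. range \<xi> \<subseteq> \<real> \<Longrightarrow> n \<in> base_lattice \<Longrightarrow> k \<in> A_index D \<Longrightarrow>
      \<exists>b\<in>A_carrier. p * b \<approx> b * p \<and> act \<xi> b (delta (n(k := n k - 1))) n \<noteq> 0"
  shows "\<exists>c\<in>carrier (Cz D). p \<approx> scal c"
proof -
  have diag: "act \<xi> p F n = act \<xi> p (delta n) n * F n"
    if \<xi>: "range \<xi> \<subseteq> \<real>" and n: "n \<in> base_lattice" for \<xi> F n
  proof (rule act_diagonal[OF p n])
    fix m assume m: "m \<in> base_lattice" "m \<noteq> n"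
    obtain h \<phi> where h: "p * h \<approx> h * p" "\<And>F n. act \<xi> h F n = \<phi> n * F n" "\<phi> m \<noteq> \<phi> n"
      using separating[OF \<xi> n m] by blast
    have "act \<xi> h (delta m) = (\<lambda>n. \<phi> m * delta m n)"
      by (rule ext) (simp add: h(2) delta_def)
    \<comment> \<open>The entries of \<open>p * h\<close> and \<open>h * p\<close> in row
      \<open>n\<close> and column \<open>m\<close>: the entry of \<open>p\<close> is multiplied by
      \<open>\<phi> m\<close> in one and by \<open>\<phi> n\<close> in the other.\<close>
    then have "\<phi> m * act \<xi> p (delta m) n = \<phi> n * act \<xi> p (delta m) n"
      using act_cong[OF h(1), of \<xi> "delta m" n] by (simp add: act_mult act_scale h(2))
    then show "act \<xi> p (delta m) n = 0"
      using h(3) by simp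
  qed
  have const: "act \<xi> p (delta n) n = act \<xi> p (delta (\<lambda>_. 0)) (\<lambda>_. 0)"
    if \<xi>: "range \<xi> \<subseteq> \<real>" and n: "n \<in> base_lattice" for \<xi> n
  proof (rule shift_invariant_constant[OF fin _ n, where g = "\<lambda>n. act \<xi> p (delta n) n"])
    fix n k assume nk: "n \<in> base_lattice" "k \<in> A_index D"
    let ?m = "n(k := n k - 1)"
    have m: "?m \<in> base_lattice"
      using nk by (auto simp: base_lattice_def)
    obtain b where b: "b \<in> A_carrier" "p * b \<approx> b * p" "act \<xi> b (delta ?m) n \<noteq> 0"
      using transitive[OF \<xi> nk] by blast
    \<comment> \<open>The entries of \<open>p * b\<close> and \<open>b * p\<close> in row
      \<open>n\<close> and column \<open>?m\<close>. As \<open>p\<close> is diagonal, the same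
      nonzero entry of \<open>b\<close> is multiplied by the value of \<open>p\<close> at
      \<open>n\<close> in one and at \<open>?m\<close> in the other.\<close>
    have "act \<xi> p (act \<xi> b (delta ?m)) n = act \<xi> b (act \<xi> p (delta ?m)) n"
      using act_cong[OF b(2), of \<xi> "delta ?m" n] by (simp add: act_mult)
    also have "\<dots> = act \<xi> b (\<lambda>l. act \<xi> p (delta ?m) ?m * delta ?m l) n"
      by (intro act_carrier_cong b nk) (subst diag[OF \<xi>], auto simp: delta_def)
    also have "\<dots> = act \<xi> p (delta ?m) ?m * act \<xi> b (delta ?m) n"
      by (rule act_scale)
    finally show "act \<xi> p (delta ?m) ?m = act \<xi> p (delta n) n"
      using b(3) diag[OF \<xi> nk(1), of "act \<xi> b (delta ?m)"] by simp
  qed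
  \<comment> \<open>The value at the origin is a single polynomial in z, so the constants found for
    different \<open>\<xi>\<close> fit together.\<close>
  obtain c where c: "c \<in> carrier (Cz D)" "\<And>\<xi>. act \<xi> p (delta (\<lambda>_. 0)) (\<lambda>_. 0) = zev \<xi> c"
    using act_at_is_zev[OF p] by blast
  have "p - scal c \<in> rel_ideal"
  proof (rule act_faithful[OF fin])
    fix \<xi> :: "nat \<times> nat \<Rightarrow> complex" and F n assume "range \<xi> \<subseteq> \<real>" "n \<in> base_lattice"
    then show "act \<xi> (p - scal c) F n = 0"
      by (subst act_diff, subst diag) (auto simp: act_scal const c(2))
  qed (use p c in \<open>auto intro: free_carrier_intros\<close>)
  then show ?thesis
    using c p by (auto simp: cong_def free_carrier_scal)
qed

end

section \<open>Laurent series\<close>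

lemma prod_list_nonzero:
  fixes f :: "'a \<Rightarrow> 'b::idom"
  shows "(\<And>x. x \<in> set xs \<Longrightarrow> f x \<noteq> 0) \<Longrightarrow> (\<Prod>x\<leftarrow>xs. f x) \<noteq> 0"
  by (induction xs) auto

lemma poly_prod_list_map: "poly (\<Prod>x\<leftarrow>xs. f x) u = (\<Prod>x\<leftarrow>xs. poly (f x) u)"
  by (induction xs) simp_all

lemma prod_list_inverse:
  fixes f g :: "'a \<Rightarrow> 'b::comm_monoid_mult"
  shows "(\<And>x. x \<in> set xs \<Longrightarrow> f x * g x = 1) \<Longrightarrow> (\<Prod>x\<leftarrow>xs. f x) * (\<Prod>x\<leftarrow>xs. g x) = 1"
proof (induction xs)
  case (Cons x xs)
  have "(\<Prod>x\<leftarrow>x # xs. f x) * (\<Prod>x\<leftarrow>x # xs. g x) =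
      (f x * g x) * ((\<Prod>x\<leftarrow>xs. f x) * (\<Prod>x\<leftarrow>xs. g x))"
    by (simp add: mult_ac)
  then show ?case
    using Cons by simp
qed simp

lemma sum_of_bool_pick: "finite A \<Longrightarrow> s \<in> A \<Longrightarrow> (\<Sum>r\<in>A. f r * of_bool (r = s)) = (f s :: complex)"
  by (simp add: of_bool_def if_distrib cong: if_cong)

notation fls_nth (infixl "$$" 75)

text \<open>The summation range may come from any lower bounds of the supports;
  \<open>dser_mult\<close> needs one range for all lattice points at once.\<close>

lemma fls_times_nth_bounds:
  fixes f g :: "'a::semiring_0 fls"
  assumes "\<And>i. i < a \<Longrightarrow> f $$ i = 0" "\<And>i. i < b \<Longrightarrow> g $$ i = 0"
  shows "(f * g) $$ k = (\<Sum>i=a..k - b. f $$ i * g $$ (k - i))"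
proof (cases "f = 0 \<or> g = 0")
  case False
  then have "a \<le> fls_subdegree f" "b \<le> fls_subdegree g"
    using assms nth_fls_subdegree_nonzero[of f] nth_fls_subdegree_nonzero[of g] not_le by blast+
  then show ?thesis
    unfolding fls_times_nth(2) by (intro sum.mono_neutral_left) auto
qed auto

text \<open>The formal variable is the inverse of u, so a polynomial in u occupies the nonpositive
  exponents.\<close>

definition fls_of_poly :: "complex poly \<Rightarrow> complex fls"
  where "fls_of_poly P = (\<Sum>k\<le>Polynomial.degree P. fls_const (Polynomial.coeff P k) * fls_X_inv ^ k)"

lemma fls_of_poly_nth: "fls_of_poly P $$ m = (if m \<le> 0 then Polynomial.coeff P (nat (- m)) else 0)"
proof -
  have "fls_of_poly P $$ m = (\<Sum>k\<le>Polynomial.degree P. if m = - int k then Polynomial.coeff P k else 0)"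
    by (simp add: fls_of_poly_def fls_nth_sum if_distrib cong: if_cong)
  also have "\<dots> = (\<Sum>k\<le>Polynomial.degree P. if k = nat (- m) then (if m \<le> 0 then Polynomial.coeff P k else 0) else 0)"
    by (intro sum.cong) auto
  also have "\<dots> = (if m \<le> 0 then Polynomial.coeff P (nat (- m)) else 0)"
    by (auto simp: sum.delta coeff_eq_0)
  finally show ?thesis .
qed

lemma fls_of_poly_inject: "fls_of_poly P = fls_of_poly Q \<longleftrightarrow> P = Q"
proof
  assume eq: "fls_of_poly P = fls_of_poly Q"
  show "P = Q"
  proof (rule poly_eqI)
    fix k show "Polynomial.coeff P k = Polynomial.coeff Q k"
      using arg_cong[OF eq, of "\<lambda>f. f $$ (- int k)"] by (simp add: fls_of_poly_nth)
  qed
qed simp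

lemma fls_of_poly_add: "fls_of_poly (P + Q) = fls_of_poly P + fls_of_poly Q"
  by (rule fls_eqI) (simp add: fls_of_poly_nth)

lemma fls_of_poly_diff: "fls_of_poly (P - Q) = fls_of_poly P - fls_of_poly Q"
  by (rule fls_eqI) (simp add: fls_of_poly_nth)

lemma fls_of_poly_smult: "fls_of_poly (Polynomial.smult c P) = fls_const c * fls_of_poly P"
  by (rule fls_eqI) (simp add: fls_of_poly_nth)

lemma fls_of_poly_pCons: "fls_of_poly (pCons c P) = fls_const c + fls_X_inv * fls_of_poly P"
proof (rule fls_eqI)
  fix m
  consider "m > 0" | "m = 0" | k where "m = - int (Suc k)"
    by (metis linorder_neqE_linordered_idom neg_less_0_iff_less neg_equal_iff_equal add.inverse_inverse
        pos_int_cases gr0_implies_Suc)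
  then show "fls_of_poly (pCons c P) $$ m = (fls_const c + fls_X_inv * fls_of_poly P) $$ m"
  proof cases
    case (3 k)
    have "nat (- m) = Suc k" "nat (- (m + 1)) = k"
      using 3 by simp_all
    then show ?thesis
      using 3 by (simp add: fls_of_poly_nth fls_X_inv_times_conv_shift del: of_nat_Suc)
  qed (simp_all add: fls_of_poly_nth fls_X_inv_times_conv_shift)
qed

lemma fls_of_poly_0 [simp]: "fls_of_poly 0 = 0"
  by (simp add: fls_of_poly_def)

lemma fls_of_poly_const [simp]: "fls_of_poly [:c:] = fls_const c"
  by (simp add: fls_of_poly_def)

lemma fls_of_poly_1 [simp]: "fls_of_poly 1 = 1"
  using fls_of_poly_const[of 1] by (simp add: one_pCons)

lemma fls_of_poly_mult: "fls_of_poly (P * Q) = fls_of_poly P * fls_of_poly Q"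
  by (induction P) (simp_all add: fls_of_poly_add fls_of_poly_smult fls_of_poly_pCons algebra_simps)

lemma fls_of_poly_power: "fls_of_poly (P ^ k) = fls_of_poly P ^ k"
  by (induction k) (simp_all add: fls_of_poly_mult)

lemma fls_of_poly_prod_list: "fls_of_poly (\<Prod>x\<leftarrow>xs. f x) = (\<Prod>x\<leftarrow>xs. fls_of_poly (f x))"
  by (induction xs) (simp_all add: fls_of_poly_mult)

lemma fls_of_poly_linear: "fls_of_poly [:c, 1:] = fls_X_inv + fls_const c"
  by (simp add: fls_of_poly_pCons one_pCons[symmetric] add.commute)

lemma fls_of_poly_monom: "fls_of_poly (Polynomial.monom c k) = fls_const c * fls_X_inv ^ k"
  by (rule fls_eqI) (auto simp: fls_of_poly_nth)

lemma fls_of_poly_sum: "fls_of_poly (\<Sum>x\<in>A. f x) = (\<Sum>x\<in>A. fls_of_poly (f x))"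
  by (induction A rule: infinite_finite_induct) (simp_all add: fls_of_poly_add)

text \<open>The numerical counterpart of \<open>recip_series\<close>: the expansion of 1/(u +
  z).\<close>

definition recip_num :: "complex \<Rightarrow> complex fls"
  where "recip_num z = fls_X * fps_to_fls (Abs_fps (\<lambda>k. (- z) ^ k))"

lemma recip_num_nth: "recip_num z $$ m = (if 1 \<le> m then (- z) ^ nat (m - 1) else 0)"
  by (simp add: recip_num_def fls_X_times_conv_shift)

lemma recip_num_mult: "recip_num z * fls_of_poly [:z, 1:] = 1"
proof (rule fls_eqI)
  fix m
  have *: "(- z) ^ nat m = - ((- z) ^ nat (m - 1) * z)" if "1 \<le> m"
  proof -
    have "nat m = Suc (nat (m - 1))"
      using that by simp
    then show ?thesis
      by (simp only: power_Suc) simp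
  qed
  show "(recip_num z * fls_of_poly [:z, 1:]) $$ m = (1 :: complex fls) $$ m"
    using * by (cases "m = 0")
      (auto simp: fls_of_poly_linear distrib_left fls_X_inv_times_conv_shift recip_num_nth)
qed

text \<open>Defined by substitution into \<open>poly\<close>, which makes multiplicativity
  immediate; \<open>zpv_altdef\<close> is the form that matches \<open>zeval\<close>.\<close>

definition zpv :: "(nat \<times> nat \<Rightarrow> complex) \<Rightarrow> zpoly poly \<Rightarrow> complex \<Rightarrow> complex"
  where "zpv \<xi> f u = zev \<xi> (poly f (Poly_Mapping.single 0 u))"

lemma mon_eval_0 [simp]: "mon_eval \<xi> 0 = 1"
  by (simp add: mon_eval_def)

lemma zpv_altdef: "zpv \<xi> f u = (\<Sum>k\<le>Polynomial.degree f. zev \<xi> (Polynomial.coeff f k) * u ^ k)"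
  by (simp add: zpv_def poly_altdef)

lemma zpv_mult: "zpv \<xi> (f * g) u = zpv \<xi> f u * zpv \<xi> g u"
  by (simp add: zpv_def)

lemma zpv_prod: "zpv \<xi> (\<Prod>x\<in>A. f x) u = (\<Prod>x\<in>A. zpv \<xi> (f x) u)"
  by (simp add: zpv_def poly_prod)

context target_algebra
begin

section \<open>Series acting diagonally\<close>

text \<open>The equation is demanded at all points, not only on \<open>base_lattice\<close>, so that
  \<open>a\<close> determines \<open>\<phi>\<close> everywhere; \<open>diag_zero\<close> and the
  bounds in \<open>dser_mult\<close> rely on this.\<close>

definition diag :: "(nat \<times> nat \<Rightarrow> complex) \<Rightarrow> aletter free \<Rightarrow> (lattice \<Rightarrow> complex) \<Rightarrow> bool"
  where "diag \<xi> a \<phi> \<longleftrightarrow> a \<in> A_carrier \<and> (\<forall>F n. act \<xi> a F n = \<phi> n * F n)"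

lemma diag_add: "diag \<xi> a \<phi> \<Longrightarrow> diag \<xi> b \<psi> \<Longrightarrow> diag \<xi> (a + b) (\<lambda>n. \<phi> n + \<psi> n)"
  by (simp add: diag_def free_carrier_add act_add distrib_right)

lemma diag_uminus: "diag \<xi> a \<phi> \<Longrightarrow> diag \<xi> (- a) (\<lambda>n. - \<phi> n)"
  by (simp add: diag_def free_carrier_uminus act_uminus)

lemma diag_diff: "diag \<xi> a \<phi> \<Longrightarrow> diag \<xi> b \<psi> \<Longrightarrow> diag \<xi> (a - b) (\<lambda>n. \<phi> n - \<psi> n)"
  by (simp add: diag_def free_carrier_diff act_diff left_diff_distrib)

lemma diag_mult: "diag \<xi> a \<phi> \<Longrightarrow> diag \<xi> b \<psi> \<Longrightarrow> diag \<xi> (a * b) (\<lambda>n. \<phi> n * \<psi> n)"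
  by (simp add: diag_def free_carrier_mult act_mult)

lemma diag_0: "diag \<xi> 0 (\<lambda>n. 0)" and diag_1: "diag \<xi> 1 (\<lambda>n. 1)"
  by (simp_all add: diag_def free_carrier_0 free_carrier_1 act_simps)

lemma diag_scal: "c \<in> carrier (Cz D) \<Longrightarrow> diag \<xi> (scal c) (\<lambda>n. zev \<xi> c)"
  by (simp add: diag_def free_carrier_scal act_scal)

lemma diag_cst: "diag \<xi> (cst z) (\<lambda>n. z)"
  by (simp add: diag_def free_carrier_cst act_cst)

lemma diag_power: "diag \<xi> a \<phi> \<Longrightarrow> diag \<xi> (a ^ k) (\<lambda>n. \<phi> n ^ k)"
  by (induction k) (auto intro: diag_1 diag_mult)

lemma diag_sum: "(\<And>x. x \<in> A \<Longrightarrow> diag \<xi> (f x) (\<phi> x)) \<Longrightarrow> diag \<xi> (\<Sum>x\<in>A. f x) (\<lambda>n. \<Sum>x\<in>A. \<phi> x n)"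
  by (induction A rule: infinite_finite_induct) (auto intro: diag_0 diag_add)

lemma diag_cong: "diag \<xi> a \<phi> \<Longrightarrow> (\<And>n. \<phi> n = \<psi> n) \<Longrightarrow> diag \<xi> a \<psi>"
  by (simp add: diag_def)

lemma diag_zero: "diag \<xi> 0 \<phi> \<Longrightarrow> \<phi> n = 0"
  by (auto simp: diag_def act_0)

lemma diag_letters:
  "(i, r) \<in> A_index D \<Longrightarrow> diag \<xi> (free_gen (Wl i r)) (\<lambda>n. pt n (i, r))"
  "(i, r) \<in> A_index D \<Longrightarrow> diag \<xi> (free_gen (HalfInv i r m)) (\<lambda>n. inverse (pt n (i, r) + of_int m / 2))"
  "(i, r) \<in> A_index D \<Longrightarrow> (i, r') \<in> A_index D \<Longrightarrow> r \<noteq> r' \<Longrightarrow>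
    diag \<xi> (free_gen (PlusInv i r r' m)) (\<lambda>n. inverse (pt n (i, r) + pt n (i, r') + of_int m))"
  "(i, r) \<in> A_index D \<Longrightarrow> (i, r') \<in> A_index D \<Longrightarrow> r \<noteq> r' \<Longrightarrow>
    diag \<xi> (free_gen (MinusInv i r r' m)) (\<lambda>n. inverse (pt n (i, r) - pt n (i, r') + of_int m))"
  by (simp_all add: diag_def act_gen free_carrier_gen A_gens_iff)

definition dser :: "(nat \<times> nat \<Rightarrow> complex) \<Rightarrow> series \<Rightarrow> (lattice \<Rightarrow> complex fls) \<Rightarrow> bool"
  where "dser \<xi> f \<phi> \<longleftrightarrow> (\<forall>k. diag \<xi> (f $$ k) (\<lambda>n. \<phi> n $$ k))"

lemma dser_const: "diag \<xi> a \<phi> \<Longrightarrow> dser \<xi> (fls_const a) (\<lambda>n. fls_const (\<phi> n))"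
  by (auto simp: dser_def intro: diag_0)

lemma dser_add: "dser \<xi> f \<phi> \<Longrightarrow> dser \<xi> g \<psi> \<Longrightarrow> dser \<xi> (f + g) (\<lambda>n. \<phi> n + \<psi> n)"
  by (simp add: dser_def diag_add)

lemma dser_diff: "dser \<xi> f \<phi> \<Longrightarrow> dser \<xi> g \<psi> \<Longrightarrow> dser \<xi> (f - g) (\<lambda>n. \<phi> n - \<psi> n)"
  by (simp add: dser_def diag_diff)

lemma dser_0: "dser \<xi> 0 (\<lambda>n. 0)"
  by (simp add: dser_def diag_0)

lemma dser_1: "dser \<xi> 1 (\<lambda>n. 1)"
  using dser_const[OF diag_1] by simp

lemma dser_X: "dser \<xi> fls_X (\<lambda>n. fls_X)"
  by (auto simp: dser_def intro: diag_0 diag_1)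

lemma dser_X_inv: "dser \<xi> fls_X_inv (\<lambda>n. fls_X_inv)"
  by (auto simp: dser_def intro: diag_0 diag_1)

lemma dser_mult:
  assumes f: "dser \<xi> f \<phi>" and g: "dser \<xi> g \<psi>"
  shows "dser \<xi> (f * g) (\<lambda>n. \<phi> n * \<psi> n)"
  unfolding dser_def
proof
  fix k
  let ?a = "fls_subdegree f" and ?b = "fls_subdegree g"
  \<comment> \<open>At a given point the numerical series may start later than the operator series,
    but never earlier, because the zero coefficients below the subdegree act as 0.\<close>
  have low: "\<phi> n $$ i = 0" if "i < fls_subdegree h" "dser \<xi> h \<phi>" for \<phi> h i n
    using that diag_zero[of \<xi> "\<lambda>n. \<phi> n $$ i" n] by (simp add: dser_def) (metis fls_eq0_below_subdegree)
  have "diag \<xi> (\<Sum>i=?a..k - ?b. f $$ i * g $$ (k - i)) (\<lambda>n. \<Sum>i=?a..k - ?b. \<phi> n $$ i * \<psi> n $$ (k - i))"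
    using f g by (intro diag_sum diag_mult) (auto simp: dser_def)
  moreover have "(\<phi> n * \<psi> n) $$ k = (\<Sum>i=?a..k - ?b. \<phi> n $$ i * \<psi> n $$ (k - i))" for n
    using low[OF _ f] low[OF _ g] by (intro fls_times_nth_bounds) auto
  ultimately show "diag \<xi> ((f * g) $$ k) (\<lambda>n. (\<phi> n * \<psi> n) $$ k)"
    by (simp add: fls_times_nth(2))
qed

lemma dser_power: "dser \<xi> f \<phi> \<Longrightarrow> dser \<xi> (f ^ k) (\<lambda>n. \<phi> n ^ k)"
  by (induction k) (auto intro: dser_1 dser_mult)

lemma dser_sum: "(\<And>x. x \<in> A \<Longrightarrow> dser \<xi> (f x) (\<phi> x)) \<Longrightarrow> dser \<xi> (\<Sum>x\<in>A. f x) (\<lambda>n. \<Sum>x\<in>A. \<phi> x n)"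
  by (induction A rule: infinite_finite_induct) (auto intro: dser_0 dser_add)

lemma dser_prod_list:
  "(\<And>x. x \<in> set xs \<Longrightarrow> dser \<xi> (f x) (\<phi> x)) \<Longrightarrow> dser \<xi> (\<Prod>x\<leftarrow>xs. f x) (\<lambda>n. \<Prod>x\<leftarrow>xs. \<phi> x n)"
  by (induction xs) (auto intro: dser_1 dser_mult)

lemma dser_cong: "dser \<xi> f \<phi> \<Longrightarrow> (\<And>n. \<phi> n = \<psi> n) \<Longrightarrow> dser \<xi> f \<psi>"
  by (simp add: dser_def)

lemma dser_num: "dser \<xi> (num_series z) (\<lambda>n. fls_const z)"
  unfolding num_series_def by (intro dser_const diag_cst)

lemma dser_recip: "diag \<xi> a \<phi> \<Longrightarrow> dser \<xi> (recip_series a) (\<lambda>n. recip_num (\<phi> n))"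
  unfolding recip_series_def recip_num_def
  by (intro dser_mult dser_X) (auto simp: dser_def intro!: diag_0 diag_power diag_uminus)

definition Cz_poly :: "zpoly poly \<Rightarrow> bool"
  where "Cz_poly f \<longleftrightarrow> (\<forall>k. Polynomial.coeff f k \<in> carrier (Cz D))"

lemma dser_zeval: "Cz_poly f \<Longrightarrow> dser \<xi> x \<phi> \<Longrightarrow>
    dser \<xi> (zeval f x) (\<lambda>n. \<Sum>k\<le>Polynomial.degree f. fls_const (zev \<xi> (Polynomial.coeff f k)) * \<phi> n ^ k)"
  unfolding zeval_def by (intro dser_sum dser_mult dser_power dser_const diag_scal) (auto simp: Cz_poly_def)

lemma Cz_poly_pCons: "a \<in> carrier (Cz D) \<Longrightarrow> Cz_poly f \<Longrightarrow> Cz_poly (pCons a f)"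
  by (auto simp: Cz_poly_def coeff_pCons split: nat.split)

lemma Cz_poly_0: "Cz_poly 0" and Cz_poly_1: "Cz_poly 1"
  by (auto simp: Cz_poly_def K_0 K_1 one_pCons coeff_pCons split: nat.split)

lemma Cz_poly_add: "Cz_poly f \<Longrightarrow> Cz_poly g \<Longrightarrow> Cz_poly (f + g)"
  by (simp add: Cz_poly_def K_add)

lemma Cz_poly_mult: "Cz_poly f \<Longrightarrow> Cz_poly g \<Longrightarrow> Cz_poly (f * g)"
  by (auto simp: Cz_poly_def coeff_mult intro!: K_sum K_mult)

lemma Cz_poly_prod: "(\<And>x. x \<in> A \<Longrightarrow> Cz_poly (f x)) \<Longrightarrow> Cz_poly (\<Prod>x\<in>A. f x)"
  by (induction A rule: infinite_finite_induct) (auto intro: Cz_poly_1 Cz_poly_mult)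

lemma Cz_poly_monom: "Cz_poly (Polynomial.monom 1 k)"
  by (simp add: Cz_poly_def K_0 K_1)

lemma Cz_poly_minus:
  assumes "Cz_poly f"
  shows "Cz_poly (poly_minus f)"
proof -
  have neg: "Cz_poly [:0, -1:]"
    using K_0 K_uminus[OF K_1] by (intro Cz_poly_pCons Cz_poly_0) auto
  have "Cz_poly (pcompose f [:0, -1:])"
    using assms
  proof (induction f)
    case (pCons a f)
    have "a \<in> carrier (Cz D)" "Cz_poly f"
      using pCons.prems by (auto simp: Cz_poly_def coeff_pCons split: nat.splits)
    then have "Cz_poly [:a:]"
      by (intro Cz_poly_pCons Cz_poly_0)
    moreover have "Cz_poly ([:0, -1:] * pcompose f [:0, -1:])"
      by (intro Cz_poly_mult neg pCons.IH) fact
    ultimately show ?case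
      unfolding pcompose_pCons by (rule Cz_poly_add)
  qed (simp add: Cz_poly_0)
  moreover have "(-1) ^ Polynomial.degree f \<in> carrier (Cz D)"
    using K_1 K_uminus[OF K_1] by (cases "even (Polynomial.degree f)") auto
  ultimately show ?thesis
    by (simp add: poly_minus_def Cz_poly_def K_mult)
qed

section \<open>Series constant in u, and first coefficients\<close>

definition cser :: "(nat \<times> nat \<Rightarrow> complex) \<Rightarrow> series \<Rightarrow> (lattice \<Rightarrow> complex) \<Rightarrow> bool"
  where "cser \<xi> f \<alpha> \<longleftrightarrow> dser \<xi> f (\<lambda>n. fls_const (\<alpha> n))"

lemma cser_const: "diag \<xi> a \<alpha> \<Longrightarrow> cser \<xi> (fls_const a) \<alpha>"
  unfolding cser_def by (rule dser_const)

lemma cser_num: "cser \<xi> (num_series z) (\<lambda>n. z)"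
  unfolding cser_def by (rule dser_num)

lemma cser_1: "cser \<xi> 1 (\<lambda>n. 1)"
  using cser_const[OF diag_1] by simp

lemma cser_0: "cser \<xi> 0 (\<lambda>n. 0)"
  using cser_const[OF diag_0] by simp

lemma cser_add: "cser \<xi> f \<alpha> \<Longrightarrow> cser \<xi> g \<beta> \<Longrightarrow> cser \<xi> (f + g) (\<lambda>n. \<alpha> n + \<beta> n)"
  unfolding cser_def fls_plus_const[symmetric] by (rule dser_add)

lemma cser_diff: "cser \<xi> f \<alpha> \<Longrightarrow> cser \<xi> g \<beta> \<Longrightarrow> cser \<xi> (f - g) (\<lambda>n. \<alpha> n - \<beta> n)"
  unfolding cser_def fls_minus_const[symmetric] by (rule dser_diff)

lemma cser_uminus: "cser \<xi> f \<alpha> \<Longrightarrow> cser \<xi> (- f) (\<lambda>n. - \<alpha> n)"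
  using cser_diff[OF cser_0] by simp

lemma cser_mult: "cser \<xi> f \<alpha> \<Longrightarrow> cser \<xi> g \<beta> \<Longrightarrow> cser \<xi> (f * g) (\<lambda>n. \<alpha> n * \<beta> n)"
  unfolding cser_def fls_const_mult_const[symmetric] by (rule dser_mult)

lemma cser_power: "cser \<xi> f \<alpha> \<Longrightarrow> cser \<xi> (f ^ k) (\<lambda>n. \<alpha> n ^ k)"
  by (induction k) (auto intro: cser_1 cser_mult)

lemma cser_prod_list:
  "(\<And>x. x \<in> set xs \<Longrightarrow> cser \<xi> (f x) (\<alpha> x)) \<Longrightarrow> cser \<xi> (\<Prod>x\<leftarrow>xs. f x) (\<lambda>n. \<Prod>x\<leftarrow>xs. \<alpha> x n)"
  by (induction xs) (auto intro: cser_1 cser_mult)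

lemma cser_zeval:
  assumes "Cz_poly f" "cser \<xi> x \<alpha>"
  shows "cser \<xi> (zeval f x) (\<lambda>n. zpv \<xi> f (\<alpha> n))"
  unfolding cser_def
proof (rule dser_cong)
  show "dser \<xi> (zeval f x) (\<lambda>n. \<Sum>k\<le>Polynomial.degree f.
      fls_const (zev \<xi> (Polynomial.coeff f k)) * fls_const (\<alpha> n) ^ k)"
    using assms by (intro dser_zeval) (auto simp: cser_def)
  have "fls_const (\<Sum>x\<in>A. g x) = (\<Sum>x\<in>A. fls_const (g x))" for A and g :: "nat \<Rightarrow> complex"
    by (induction A rule: infinite_finite_induct) (auto simp flip: fls_plus_const)
  then show "(\<Sum>k\<le>Polynomial.degree f. fls_const (zev \<xi> (Polynomial.coeff f k)) * fls_const (\<alpha> n) ^ k) =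
      fls_const (zpv \<xi> f (\<alpha> n))" for n
    by (simp add: zpv_altdef flip: fls_const_power)
qed

text \<open>Only the coefficient of the inverse of u is recorded: the argument uses no coefficient
  of \<open>B_series\<close> beyond the first.\<close>

definition lser :: "(nat \<times> nat \<Rightarrow> complex) \<Rightarrow> series \<Rightarrow> (lattice \<Rightarrow> complex) \<Rightarrow> bool"
  where "lser \<xi> f \<alpha> \<longleftrightarrow> (\<exists>\<phi>. dser \<xi> f \<phi> \<and> (\<forall>n. \<phi> n $$ 1 = \<alpha> n))"

text \<open>The expansion of 1/(u + a) begins with the inverse of u, with coefficient 1 whatever
  \<open>a\<close> is. The factors \<open>recip_series\<close> thus leave no trace in the first
  coefficient.\<close>

lemma lser_recip: "diag \<xi> a \<phi> \<Longrightarrow> lser \<xi> (recip_series a) (\<lambda>n. 1)"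
  unfolding lser_def using dser_recip by (force simp: recip_num_nth)

lemma lser_X: "lser \<xi> fls_X (\<lambda>n. 1)"
  unfolding lser_def using dser_X by force

lemma lser_mult_left: "cser \<xi> g \<beta> \<Longrightarrow> lser \<xi> f \<alpha> \<Longrightarrow> lser \<xi> (g * f) (\<lambda>n. \<beta> n * \<alpha> n)"
  unfolding lser_def cser_def
proof (elim exE conjE)
  fix \<phi> assume "dser \<xi> g (\<lambda>n. fls_const (\<beta> n))" "dser \<xi> f \<phi>" "\<forall>n. \<phi> n $$ 1 = \<alpha> n"
  then show "\<exists>\<phi>. dser \<xi> (g * f) \<phi> \<and> (\<forall>n. \<phi> n $$ 1 = \<beta> n * \<alpha> n)"
    by (intro exI[of _ "\<lambda>n. fls_const (\<beta> n) * \<phi> n"]) (auto intro: dser_mult)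
qed

lemma lser_mult_right: "lser \<xi> f \<alpha> \<Longrightarrow> cser \<xi> g \<beta> \<Longrightarrow> lser \<xi> (f * g) (\<lambda>n. \<alpha> n * \<beta> n)"
  unfolding lser_def cser_def
proof (elim exE conjE)
  fix \<phi> assume "dser \<xi> g (\<lambda>n. fls_const (\<beta> n))" "dser \<xi> f \<phi>" "\<forall>n. \<phi> n $$ 1 = \<alpha> n"
  then show "\<exists>\<phi>. dser \<xi> (f * g) \<phi> \<and> (\<forall>n. \<phi> n $$ 1 = \<alpha> n * \<beta> n)"
    by (intro exI[of _ "\<lambda>n. \<phi> n * fls_const (\<beta> n)"]) (auto intro: dser_mult)
qed

lemma lser_diag: "lser \<xi> f \<alpha> \<Longrightarrow> diag \<xi> (f $$ 1) \<alpha>"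
  unfolding lser_def dser_def by (blast intro: diag_cong)

lemma lser_shift:
  assumes "lser \<xi> f \<alpha>" "x \<in> A_gens D" "\<And>n. lcoef x n = 1"
  shows "(f * fls_const (free_gen x)) $$ 1 \<in> A_carrier"
    and "act \<xi> ((f * fls_const (free_gen x)) $$ 1) F n = \<alpha> n * F (lshift x n)"
  using lser_diag[OF assms(1)] assms(2,3)
  by (simp_all add: diag_def free_carrier_mult free_carrier_gen act_mult act_gen)

lemma act_sum: "act \<xi> (\<Sum>x\<in>A. f x) F n = (\<Sum>x\<in>A. act \<xi> (f x) F n)"
  by (induction A rule: infinite_finite_induct) (auto simp: act_simps)

text \<open>Nonvanishing is asked of the coefficients of lowering operators. The raising and
  diagonal terms at a fixed node have to act only by some function, which is what
  \<open>some_cser\<close> records.\<close>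

definition unit_cser :: "(nat \<times> nat \<Rightarrow> complex) \<Rightarrow> series \<Rightarrow> bool"
  where "unit_cser \<xi> f \<longleftrightarrow> (\<exists>\<alpha>. cser \<xi> f \<alpha> \<and> (\<forall>n. \<alpha> n \<noteq> 0))"

lemma unit_cserI: "cser \<xi> f \<alpha> \<Longrightarrow> (\<And>n. \<alpha> n \<noteq> 0) \<Longrightarrow> unit_cser \<xi> f"
  by (auto simp: unit_cser_def)

lemma unit_cser_1: "unit_cser \<xi> 1"
  by (rule unit_cserI[OF cser_1]) simp

lemma unit_cser_mult: "unit_cser \<xi> f \<Longrightarrow> unit_cser \<xi> g \<Longrightarrow> unit_cser \<xi> (f * g)"
  unfolding unit_cser_def by (elim exE conjE, rule exI, rule conjI, erule (1) cser_mult) simp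

lemma unit_cser_power: "unit_cser \<xi> f \<Longrightarrow> unit_cser \<xi> (f ^ k)"
  by (induction k) (auto intro: unit_cser_1 unit_cser_mult)

lemma unit_cser_prod_list: "(\<And>x. x \<in> set xs \<Longrightarrow> unit_cser \<xi> (f x)) \<Longrightarrow> unit_cser \<xi> (\<Prod>x\<leftarrow>xs. f x)"
  by (induction xs) (auto intro: unit_cser_1 unit_cser_mult)

definition some_cser :: "(nat \<times> nat \<Rightarrow> complex) \<Rightarrow> series \<Rightarrow> bool"
  where "some_cser \<xi> f \<longleftrightarrow> (\<exists>\<alpha>. cser \<xi> f \<alpha>)"

lemma some_cserI: "cser \<xi> f \<alpha> \<Longrightarrow> some_cser \<xi> f" and unit_some_cser: "unit_cser \<xi> f \<Longrightarrow> some_cser \<xi> f"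
  by (auto simp: some_cser_def unit_cser_def)

lemma some_cser_1: "some_cser \<xi> 1"
  by (rule some_cserI[OF cser_1])

lemma some_cser_mult: "some_cser \<xi> f \<Longrightarrow> some_cser \<xi> g \<Longrightarrow> some_cser \<xi> (f * g)"
  unfolding some_cser_def by (elim exE, rule exI, erule (1) cser_mult)

lemma some_cser_power: "some_cser \<xi> f \<Longrightarrow> some_cser \<xi> (f ^ k)"
  by (induction k) (auto intro: some_cser_1 some_cser_mult)

lemma some_cser_prod_list: "(\<And>x. x \<in> set xs \<Longrightarrow> some_cser \<xi> (f x)) \<Longrightarrow> some_cser \<xi> (\<Prod>x\<leftarrow>xs. f x)"
  by (induction xs) (auto intro: some_cser_1 some_cser_mult)

lemma some_cser_of_nat: "some_cser \<xi> (of_nat k)"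
proof (induction k)
  case (Suc k)
  then show ?case
    using cser_add[OF cser_1] by (auto simp: some_cser_def)
qed (use cser_0 in \<open>auto simp: some_cser_def\<close>)

lemma unit_lser:
  assumes "unit_cser \<xi> f" "diag \<xi> a \<phi>" "unit_cser \<xi> g"
  shows "\<exists>\<alpha>. lser \<xi> (f * recip_series a * g) \<alpha> \<and> (\<forall>n. \<alpha> n \<noteq> 0)"
proof -
  obtain \<beta> \<gamma> where "cser \<xi> f \<beta>" "cser \<xi> g \<gamma>" "\<And>n. \<beta> n \<noteq> 0" "\<And>n. \<gamma> n \<noteq> 0"
    using assms by (auto simp: unit_cser_def)
  then show ?thesis
    using lser_mult_right[OF lser_mult_left[OF _ lser_recip[OF assms(2)]], of f \<beta> g \<gamma>]
    by (intro exI[of _ "\<lambda>n. \<beta> n * 1 * \<gamma> n"]) simp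
qed

lemma some_lser:
  assumes "some_cser \<xi> f" "lser \<xi> h \<alpha>" "some_cser \<xi> g"
  shows "\<exists>\<alpha>. lser \<xi> (f * h * g) \<alpha>"
proof -
  obtain \<beta> \<gamma> where "cser \<xi> f \<beta>" "cser \<xi> g \<gamma>"
    using assms by (auto simp: some_cser_def)
  then show ?thesis
    using lser_mult_right[OF lser_mult_left[OF _ assms(2)]] by blast
qed

end

section \<open>Nondegeneracy of the Cartan matrix\<close>

lemma sum_cartan_neighbours:
  fixes d :: "nat \<Rightarrow> int"
  assumes "finite S" "N \<subseteq> S" "\<And>j. j \<in> S - N \<Longrightarrow> cartan X j i = 0"
  shows "(\<Sum>j\<in>S. d j * cartan X j i) = (\<Sum>j\<in>N. d j * cartan X j i)"
  using assms by (intro sum.mono_neutral_right) auto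

lemma sum_three:
  fixes f :: "nat \<Rightarrow> int"
  assumes "1 \<le> i"
  shows "(\<Sum>j\<in>{i - 1, i, i + 1}. f j) = f (i - 1) + f i + f (i + 1)"
  using assms by (subst sum.insert; auto)

lemma discrete_linear:
  fixes e :: "nat \<Rightarrow> int"
  assumes "e 0 = 0" "\<And>i. 1 \<le> i \<Longrightarrow> i < m \<Longrightarrow> 2 * e i = e (i - 1) + e (i + 1)" "k \<le> m"
  shows "e k = int k * e 1"
  using assms(3)
proof (induction k rule: less_induct)
  case (less k)
  consider "k = 0" | "k = 1" | i where "k = Suc (Suc i)"
    by (metis One_nat_def not0_implies_Suc)
  then show ?case
  proof cases
    case (3 i)
    then show ?thesis
      using less.IH[of i] less.IH[of "Suc i"] assms(2)[of "Suc i"] less.prems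
      by (simp add: algebra_simps)
  qed (simp_all add: assms(1))
qed

text \<open>In types A and D the equations make \<open>d\<close> linear along a chain, and the
  conditions at its ends force slope 0; in type E they are a small linear system. The purpose is
  \<open>mult_of_tau\<close>.\<close>

lemma cartan_nondegenerate:
  fixes d :: "nat \<Rightarrow> int"
  assumes ok: "dynkin_ok X"
    and eq: "\<And>i. i \<in> {1..dynkin_rank X} \<Longrightarrow> (\<Sum>j\<in>{1..dynkin_rank X}. d j * cartan X j i) = 0"
    and j: "j \<in> {1..dynkin_rank X}"
  shows "d j = 0"
proof (cases X)
  case (TypeA n)
  \<comment> \<open>Padding by 0 at the positions 0 and n + 1 gives the equations at both ends the
    form of the inner ones.\<close>
  define e where "e i = (if i = 0 \<or> i > n then 0 else d i)" for i
  have rec: "2 * e i = e (i - 1) + e (i + 1)" if i: "1 \<le> i" "i \<le> n" for i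
  proof -
    have "(\<Sum>j\<in>{1..n}. d j * cartan X j i) = (\<Sum>j\<in>{i - 1, i, i + 1} \<inter> {1..n}. d j * cartan X j i)"
      by (rule sum_cartan_neighbours) (auto simp: cartan_def TypeA)
    also have "\<dots> = (\<Sum>j\<in>{i - 1, i, i + 1}. e j * cartan X j i)"
      by (rule sum.mono_neutral_cong_left) (auto simp: e_def)
    also have "\<dots> = 2 * e i - e (i - 1) - e (i + 1)"
      unfolding sum_three[OF i(1)] using i by (auto simp: cartan_def TypeA e_def)
    finally show ?thesis
      using eq[of i] i TypeA by simp
  qed
  have lin: "e k = int k * e 1" if "k \<le> n + 1" for k
    using that by (intro discrete_linear[of e "n + 1"] rec) (auto simp: e_def)
  from lin[of "n + 1"] have "e 1 = 0"
    by (simp add: e_def)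
  then show ?thesis
    using lin[of j] j TypeA by (simp add: e_def)
next
  case (TypeD n)
  then have n: "n \<ge> 4"
    using ok by simp
  have eqD: "(\<Sum>j\<in>{1..n}. d j * cartan X j i) = 0" if "1 \<le> i" "i \<le> n" for i
    using eq[of i] that TypeD by simp
  define e where "e i = (if i = 0 then 0 else d i)" for i
  have rec: "2 * e i = e (i - 1) + e (i + 1)" if i: "1 \<le> i" "i < n - 2" for i
  proof -
    have c: "cartan X (i + 1) i = -1" "cartan X i i = 2" "i - 1 \<noteq> 0 \<Longrightarrow> cartan X (i - 1) i = -1"
      using i n by (simp_all add: cartan_def TypeD) arith+
    have "(\<Sum>j\<in>{1..n}. d j * cartan X j i) = (\<Sum>j\<in>{i - 1, i, i + 1} \<inter> {1..n}. d j * cartan X j i)"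
      using i n by (intro sum_cartan_neighbours) (auto simp: cartan_def TypeD)
    also have "\<dots> = (\<Sum>j\<in>{i - 1, i, i + 1}. e j * cartan X j i)"
      using i by (intro sum.mono_neutral_cong_left) (auto simp: e_def)
    also have "\<dots> = 2 * e i - e (i - 1) - e (i + 1)"
      unfolding sum_three[OF i(1)] using c by (cases "i - 1 = 0") (simp_all add: e_def)
    finally show ?thesis
      using eqD[of i] i n by fastforce
  qed
  have lin: "e k = int k * e 1" if "k \<le> n - 2" for k
    using that by (intro discrete_linear[of e "n - 2"] rec) (auto simp: e_def)
  obtain m where m: "n = m + 4"
    using n by (metis add.commute le_iff_add)
  have branch: "2 * d (n - 2) = d (n - 3) + d (n - 1) + d n"
  proof -
    have "(\<Sum>j\<in>{1..n}. d j * cartan X j (n - 2)) = (\<Sum>j\<in>{n - 3, n - 2, n - 1, n}. d j * cartan X j (n - 2))"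
      using n by (intro sum_cartan_neighbours) (auto simp: cartan_def TypeD)
    also have "\<dots> = 2 * d (n - 2) - d (n - 3) - d (n - 1) - d n"
      by (simp add: cartan_def TypeD m eval_nat_numeral)
    finally show ?thesis
      using eqD[of "n - 2"] n by fastforce
  qed
  have end1: "2 * d (n - 1) = d (n - 2)"
  proof -
    have "(\<Sum>j\<in>{1..n}. d j * cartan X j (n - 1)) = (\<Sum>j\<in>{n - 2, n - 1}. d j * cartan X j (n - 1))"
      using n by (intro sum_cartan_neighbours) (auto simp: cartan_def TypeD)
    also have "\<dots> = 2 * d (n - 1) - d (n - 2)"
      by (simp add: cartan_def TypeD m eval_nat_numeral)
    finally show ?thesis
      using eqD[of "n - 1"] n by fastforce
  qed
  have end2: "2 * d n = d (n - 2)"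
  proof -
    have "(\<Sum>j\<in>{1..n}. d j * cartan X j n) = (\<Sum>j\<in>{n - 2, n}. d j * cartan X j n)"
      using n by (intro sum_cartan_neighbours) (auto simp: cartan_def TypeD)
    also have "\<dots> = 2 * d n - d (n - 2)"
      by (simp add: cartan_def TypeD m eval_nat_numeral)
    finally show ?thesis
      using eqD[of n] n by fastforce
  qed
  have "d (n - 2) = int (n - 2) * e 1" "d (n - 3) = int (n - 3) * e 1"
    using lin[of "n - 2"] lin[of "n - 3"] n by (auto simp: e_def)
  \<comment> \<open>The two end equations add up to d(n - 1) + d(n) = d(n - 2), which turns the
    branch equation into equality of two neighbouring values on the linear part.\<close>
  moreover have "d (n - 2) = d (n - 3)"
    using branch end1 end2 by linarith
  ultimately have "e 1 = 0"
    using n by (auto simp: of_nat_diff algebra_simps)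
  then have "d (n - 2) = 0"
    using lin[of "n - 2"] n by (simp add: e_def)
  consider "j \<le> n - 2" | "j = n - 1" | "j = n"
    using j TypeD by fastforce
  then show ?thesis
    using lin[of j] j \<open>e 1 = 0\<close> \<open>d (n - 2) = 0\<close> end1 end2 by cases (auto simp: e_def)
next
  case (TypeE n)
  consider "n = 6" | "n = 7" | "n = 8"
    using ok TypeE by auto
  then show ?thesis
  proof cases
    case 1
    have set: "{1..6::nat} = {1, 2, 3, 4, 5, 6}"
      by auto
    have q: "(\<Sum>j\<in>{1, 2, 3, 4, 5, 6}. d j * cartan X j i) = 0" if "i \<in> {1, 2, 3, 4, 5, 6}" for i
      using eq[of i] that by (simp only: TypeE 1 dynkin_rank.simps set)
    have "2 * d 1 = d 3" "2 * d 2 = d 4" "2 * d 3 = d 1 + d 4" "2 * d 4 = d 2 + d 3 + d 5"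
      "2 * d 5 = d 4 + d 6" "2 * d 6 = d 5"
      using q[of 1] q[of 2] q[of 3] q[of 4] q[of 5] q[of 6]
      by (simp_all add: TypeE 1 cartan_def)
    then have "d 1 = 0" "d 2 = 0" "d 3 = 0" "d 4 = 0" "d 5 = 0" "d 6 = 0"
      by linarith+
    moreover have "j \<in> {1, 2, 3, 4, 5, 6}"
      using j by (simp only: TypeE 1 dynkin_rank.simps set)
    ultimately show ?thesis
      by auto
  next
    case 2
    have set: "{1..7::nat} = {1, 2, 3, 4, 5, 6, 7}"
      by auto
    have q: "(\<Sum>j\<in>{1, 2, 3, 4, 5, 6, 7}. d j * cartan X j i) = 0" if "i \<in> {1, 2, 3, 4, 5, 6, 7}" for i
      using eq[of i] that by (simp only: TypeE 2 dynkin_rank.simps set)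
    have "2 * d 1 = d 3" "2 * d 2 = d 4" "2 * d 3 = d 1 + d 4" "2 * d 4 = d 2 + d 3 + d 5"
      "2 * d 5 = d 4 + d 6" "2 * d 6 = d 5 + d 7" "2 * d 7 = d 6"
      using q[of 1] q[of 2] q[of 3] q[of 4] q[of 5] q[of 6] q[of 7]
      by (simp_all add: TypeE 2 cartan_def)
    then have "d 1 = 0" "d 2 = 0" "d 3 = 0" "d 4 = 0" "d 5 = 0" "d 6 = 0"
      "d 7 = 0"
      by linarith+
    moreover have "j \<in> {1, 2, 3, 4, 5, 6, 7}"
      using j by (simp only: TypeE 2 dynkin_rank.simps set)
    ultimately show ?thesis
      by auto
  next
    case 3
    have set: "{1..8::nat} = {1, 2, 3, 4, 5, 6, 7, 8}"
      by auto
    have q: "(\<Sum>j\<in>{1, 2, 3, 4, 5, 6, 7, 8}. d j * cartan X j i) = 0" if "i \<in> {1, 2, 3, 4, 5, 6, 7, 8}" for i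
      using eq[of i] that by (simp only: TypeE 3 dynkin_rank.simps set)
    have "2 * d 1 = d 3" "2 * d 2 = d 4" "2 * d 3 = d 1 + d 4" "2 * d 4 = d 2 + d 3 + d 5"
      "2 * d 5 = d 4 + d 6" "2 * d 6 = d 5 + d 7" "2 * d 7 = d 6 + d 8" "2 * d 8 = d 7"
      using q[of 1] q[of 2] q[of 3] q[of 4] q[of 5] q[of 6] q[of 7] q[of 8]
      by (simp_all add: TypeE 3 cartan_def)
    then have "d 1 = 0" "d 2 = 0" "d 3 = 0" "d 4 = 0" "d 5 = 0" "d 6 = 0"
      "d 7 = 0" "d 8 = 0"
      by linarith+
    moreover have "j \<in> {1, 2, 3, 4, 5, 6, 7, 8}"
      using j by (simp only: TypeE 3 dynkin_rank.simps set)
    ultimately show ?thesis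
      by auto
  qed
qed

section \<open>Satake data\<close>

locale satake_data = target_algebra +
  assumes quasi_split: "quasi_split_satake D" and reps: "orbit_reps D"
    and lam_invariant: "tau_invariant D (lam D)" and mu_spherical: "spherical D (mu D)"
    and coroots: "difference_coroots D" and zeta: "zeta_ok D" and orient: "orientation D"
    and Z_fact: "Z_factorization D"
begin

lemma nodes_eq: "nodes D = {1..dynkin_rank (dyn D)}"
  by (auto simp: nodes_def node_list_def)

lemma tau_node: "i \<in> nodes D \<Longrightarrow> tau D i \<in> nodes D"
  and tau_tau: "i \<in> nodes D \<Longrightarrow> tau D (tau D i) = i"
  and cij_tau: "i \<in> nodes D \<Longrightarrow> j \<in> nodes D \<Longrightarrow> cij D (tau D i) (tau D j) = cij D i j"
  using quasi_split by (auto simp: quasi_split_satake_def)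

text \<open>By invariance of lam and mu, both \<open>mult_of D\<close> and its composite with
  \<open>tau D\<close> are coordinates of lam - mu in the simple coroots, so nondegeneracy makes
  them equal. The reflection of indices between the two nodes of an orbit depends on this.\<close>

lemma mult_of_tau:
  assumes "i \<in> nodes D"
  shows "mult_of D (tau D i) = mult_of D i"
proof -
  have bij: "bij_betw (tau D) (nodes D) (nodes D)"
    by (rule bij_betw_byWitness[of _ "tau D"]) (auto simp: tau_node tau_tau)
  \<comment> \<open>A spherical coweight is invariant since \<open>tau D\<close> is an
    involution.\<close>
  have inv: "lam D (tau D i) - mu D (tau D i) = lam D i - mu D i" if "i \<in> nodes D" for i
  proof -
    obtain y where y: "\<And>i. i \<in> nodes D \<Longrightarrow> mu D i = y i + y (tau D i)"
      using mu_spherical by (auto simp: spherical_def)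
    show ?thesis
      using lam_invariant y[OF that] y[OF tau_node[OF that]] that
      by (simp add: tau_invariant_def tau_tau)
  qed
  let ?d = "\<lambda>j. int (mult_of D (tau D j)) - int (mult_of D j)"
  have "(\<Sum>j\<in>nodes D. ?d j * cij D j i) = 0" if i: "i \<in> nodes D" for i
  proof -
    have "(\<Sum>j\<in>nodes D. int (mult_of D (tau D j)) * cij D j i) =
        (\<Sum>j\<in>nodes D. int (mult_of D (tau D j)) * cij D (tau D j) (tau D i))"
      by (intro sum.cong) (simp_all add: cij_tau i)
    also have "\<dots> = (\<Sum>j\<in>nodes D. int (mult_of D j) * cij D j (tau D i))"
      by (rule sum.reindex_bij_betw[OF bij])
    also have "\<dots> = lam D (tau D i) - mu D (tau D i)"
      using coroots tau_node[OF i] by (simp add: difference_coroots_def)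
    also have "\<dots> = (\<Sum>j\<in>nodes D. int (mult_of D j) * cij D j i)"
      using coroots inv[OF i] i by (simp add: difference_coroots_def)
    finally show ?thesis
      by (simp add: left_diff_distrib sum_subtractf)
  qed
  then have "?d i = 0"
    using assms quasi_split
    by (intro cartan_nondegenerate[of "dyn D" ?d]) (auto simp: nodes_eq cij_def quasi_split_satake_def)
  then show ?thesis
    by simp
qed

lemma tau_fixed_tau: "i \<in> nodes D \<Longrightarrow> tau_fixed D (tau D i) \<longleftrightarrow> tau_fixed D i"
  using tau_tau[of i] by (auto simp: tau_fixed_def)

lemma vfr_tau: "i \<in> nodes D \<Longrightarrow> vfr D (tau D i) = vfr D i"
  by (simp add: vfr_def tau_fixed_tau mult_of_tau)

lemma wfr_tau: "i \<in> nodes D \<Longrightarrow> wfr D (tau D i) = wfr D i"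
  using lam_invariant by (simp add: wfr_def tau_fixed_tau tau_invariant_def)

lemma base_node: "i \<in> tau_base D \<Longrightarrow> i \<in> nodes D"
  using reps by (auto simp: tau_base_def orbit_reps_def)

lemma fixed_base: "i \<in> nodes D \<Longrightarrow> tau_fixed D i \<Longrightarrow> i \<in> tau_base D"
  by (simp add: tau_base_def)

lemma rep_iff: "i \<in> reps D \<longleftrightarrow> i \<in> tau_base D \<and> \<not> tau_fixed D i"
  using reps by (auto simp: tau_base_def orbit_reps_def)

lemma not_base:
  assumes "i \<in> nodes D" "i \<notin> tau_base D"
  shows "\<not> tau_fixed D i" "tau D i \<in> reps D" "tau D i \<in> tau_base D"
  using assms reps by (auto simp: tau_base_def orbit_reps_def)

lemma tau_rep_not_base:
  assumes "i \<in> reps D"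
  shows "tau D i \<notin> tau_base D"
proof -
  have i: "i \<in> nodes D" "\<not> tau_fixed D i" "tau D i \<notin> reps D"
    using assms reps by (auto simp: orbit_reps_def)
  then show ?thesis
    by (simp add: tau_base_def tau_fixed_tau)
qed

lemma finite_index: "finite (A_index D)"
proof (rule finite_subset)
  show "A_index D \<subseteq> (SIGMA i:nodes D. {1..vfr D i})"
    by (auto simp: A_index_def base_node)
  show "finite (SIGMA i:nodes D. {1..vfr D i})"
    by (auto simp: nodes_eq)
qed

lemma zeta_le:
  assumes "i \<in> nodes D" "\<not> tau_fixed D i"
  shows "zeta D i \<le> vfr D i"
proof (cases "i \<in> reps D")
  case True
  then show ?thesis
    using zeta by (auto simp: zeta_ok_def split: if_splits)
next
  case False
  then have "tau D i \<in> reps D"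
    using assms reps by (auto simp: orbit_reps_def)
  then have "zeta D (tau D (tau D i)) = vfr D (tau D i) - zeta D (tau D i)"
    using zeta by (auto simp: zeta_ok_def)
  then show ?thesis
    using assms by (simp add: tau_tau vfr_tau)
qed

lemma zeta_tau: "i \<in> reps D \<Longrightarrow> zeta D (tau D i) = vfr D i - zeta D i"
  using zeta by (auto simp: zeta_ok_def)

lemma set_node_list: "set (node_list D) = nodes D"
  by (simp add: nodes_def)

section \<open>Values of the variables w at lattice points\<close>

definition wnum :: "lattice \<Rightarrow> nat \<Rightarrow> nat \<Rightarrow> complex"
  where "wnum n i r = (if i \<in> tau_base D then pt n (i, r) else - pt n (tau D i, vfr D i + 1 - r))"

lemma index_reflect:
  assumes "i \<in> nodes D" "i \<notin> tau_base D" "1 \<le> r" "r \<le> vfr D i"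
  shows "(tau D i, vfr D i + 1 - r) \<in> A_index D"
  using assms not_base[of i] by (auto simp: A_index_def vfr_tau)

lemma index_base: "i \<in> tau_base D \<Longrightarrow> 1 \<le> r \<Longrightarrow> r \<le> vfr D i \<Longrightarrow> (i, r) \<in> A_index D"
  by (simp add: A_index_def)

lemma diag_w: "i \<in> nodes D \<Longrightarrow> 1 \<le> r \<Longrightarrow> r \<le> vfr D i \<Longrightarrow> diag \<xi> (w_free D i r) (\<lambda>n. wnum n i r)"
  unfolding w_free_def wnum_def using index_reflect[of i r]
  by (auto intro!: diag_uminus diag_letters(1) simp: index_base)

lemma cser_w: "i \<in> nodes D \<Longrightarrow> 1 \<le> r \<Longrightarrow> r \<le> vfr D i \<Longrightarrow> cser \<xi> (w_series D i r) (\<lambda>n. wnum n i r)"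
  unfolding w_series_def by (intro cser_const diag_w)

lemma Re_wnum: "Re (wnum n i r) \<in> \<int>"
  by (simp add: wnum_def pt_def)

lemma Im_wnum: "i \<in> nodes D \<Longrightarrow> 1 \<le> r \<Longrightarrow> r \<le> vfr D i \<Longrightarrow> Im (wnum n i r) \<noteq> 0"
  by (auto simp: wnum_def pt_def)

text \<open>The shifts by \<open>1/2\<close> separate the points where series are evaluated from the zeros of the
  polynomials involved.\<close>

definition half_point :: "complex \<Rightarrow> bool"
  where "half_point u \<longleftrightarrow> Im u \<noteq> 0 \<and> Re u + 1 / 2 \<in> \<int>"

lemma half_point_wnum:
  assumes "i \<in> nodes D" "1 \<le> r" "r \<le> vfr D i"
  shows "half_point (wnum n i r - 1 / 2)" "half_point (wnum n i r + 1 / 2)"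
proof -
  have "Re (wnum n i r) + 1 / 2 + 1 / 2 \<in> \<int>"
    using Ints_add[OF Re_wnum Ints_1, of n i r] by simp
  then show "half_point (wnum n i r - 1 / 2)" "half_point (wnum n i r + 1 / 2)"
    using Re_wnum[of n i r] Im_wnum[OF assms, of n] by (auto simp: half_point_def)
qed

lemma half_point_uminus: "half_point u \<Longrightarrow> half_point (- u)"
proof -
  assume u: "half_point u"
  have "Re (- u) + 1 / 2 = 1 - (Re u + 1 / 2)"
    by simp
  also have "\<dots> \<in> \<int>"
    using u by (intro Ints_diff Ints_1) (simp add: half_point_def)
  finally show ?thesis
    using u by (simp add: half_point_def)
qed

text \<open>By real parts alone: integral for \<open>wnum\<close>, half-integral and not integral
  for \<open>u\<close>. Hence \<open>i\<close> and \<open>r\<close> may be arbitrary.\<close>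

lemma half_point_not_wnum:
  assumes "half_point u"
  shows "u - wnum n i r \<noteq> 0" "u + wnum n i r \<noteq> 0"
proof -
  have not_int: "Re u \<notin> \<int>"
  proof
    assume "Re u \<in> \<int>"
    then have "(Re u + 1 / 2) - Re u \<in> \<int>"
      using assms by (intro Ints_diff) (auto simp: half_point_def)
    then obtain k :: int where "1 / 2 = real_of_int k"
      by (auto elim: Ints_cases)
    then have "real_of_int (2 * k) = 1"
      by simp
    then have "2 * k = 1"
      by linarith
    then show False
      by presburger
  qed
  show "u - wnum n i r \<noteq> 0"
    using not_int Re_wnum[of n i r] by auto
  show "u + wnum n i r \<noteq> 0"
  proof
    assume "u + wnum n i r = 0"
    then have "Re u = - Re (wnum n i r)"
      by (simp add: complex_eq_iff eq_neg_iff_add_eq_0)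
    then show False
      using not_int Re_wnum[of n i r] by simp
  qed
qed

definition Wbold_num :: "lattice \<Rightarrow> nat \<Rightarrow> complex \<Rightarrow> complex"
  where "Wbold_num n i u =
    (if tau_fixed D i then u ^ theta D i * (\<Prod>r\<leftarrow>[1..<Suc (vfr D i)]. u\<^sup>2 - (wnum n i r)\<^sup>2)
     else (\<Prod>r\<leftarrow>[1..<Suc (vfr D i)]. u - wnum n i r))"

definition Wpol_num :: "lattice \<Rightarrow> nat \<Rightarrow> complex \<Rightarrow> complex"
  where "Wpol_num n i u =
    (\<Prod>r\<leftarrow>[1..<Suc (if tau_fixed D i then vfr D i else zeta D i)]. u - wnum n i r)"

lemma cser_Wbold: "i \<in> nodes D \<Longrightarrow> cser \<xi> x \<alpha> \<Longrightarrow> cser \<xi> (Wbold D i x) (\<lambda>n. Wbold_num n i (\<alpha> n))"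
  unfolding Wbold_def Wbold_num_def
  by (auto intro!: cser_mult cser_power cser_prod_list cser_diff cser_w simp del: upt_Suc)

lemma cser_Wpol: "i \<in> nodes D \<Longrightarrow> cser \<xi> x \<alpha> \<Longrightarrow> cser \<xi> (Wpol D i x) (\<lambda>n. Wpol_num n i (\<alpha> n))"
  unfolding Wpol_def Wpol_num_def using zeta_le[of i]
  by (auto intro!: cser_prod_list cser_diff cser_w simp del: upt_Suc)

lemma Wbold_num_nonzero:
  assumes "half_point u"
  shows "Wbold_num n i u \<noteq> 0"
proof -
  have "u\<^sup>2 - (wnum n i r)\<^sup>2 = (u - wnum n i r) * (u + wnum n i r)" for r
    by (simp add: power2_eq_square algebra_simps)
  moreover have "u \<noteq> 0"
    using assms by (auto simp: half_point_def)
  ultimately show ?thesis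
    using half_point_not_wnum[OF assms, of n i]
    by (auto simp: Wbold_num_def intro!: prod_list_nonzero simp del: upt_Suc)
qed

lemma Wpol_num_nonzero: "half_point u \<Longrightarrow> Wpol_num n i u \<noteq> 0"
  using half_point_not_wnum[of u n i]
  by (auto simp: Wpol_num_def intro!: prod_list_nonzero simp del: upt_Suc)

section \<open>The polynomials \<open>Z\<close>\<close>

lemma zvar_carrier:
  assumes "i \<in> nodes D" "1 \<le> s" "s \<le> wfr D i"
  shows "zvar D i s \<in> carrier (Cz D)"
proof -
  have *: "Poly_Mapping.single (Poly_Mapping.single (j, s) 1) 1 \<in> carrier (Cz D)"
    if "j \<in> tau_base D" "s \<le> wfr D j" for j
    using that assms(2) by (simp add: Cz_def subring_record_def)
  show ?thesis
    using *[of i] *[of "tau D i"] assms not_base[of i]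
    by (auto simp: zvar_def wfr_tau intro!: K_uminus)
qed

lemma Cz_poly_Zpol: "i \<in> nodes D \<Longrightarrow> Cz_poly (Zpol D i)"
  using Z_fact zvar_carrier[of i]
  by (auto simp: Zpol_def Z_factorization_def Cz_poly_def[of "Zfac D i"]
      intro!: Cz_poly_prod Cz_poly_pCons Cz_poly_0 K_uminus K_1)

lemma Cz_poly_Zbold: "i \<in> nodes D \<Longrightarrow> Cz_poly (Zbold D i)"
  using zvar_carrier[of i]
  by (auto simp: Zbold_def power2_eq_square
      intro!: Cz_poly_mult Cz_poly_monom Cz_poly_prod Cz_poly_pCons Cz_poly_0 K_uminus K_mult K_0 K_1)

context
  fixes \<xi> :: "nat \<times> nat \<Rightarrow> complex" and u :: complex
  assumes real: "range \<xi> \<subseteq> \<real>" and nonreal: "Im u \<noteq> 0"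
begin

lemma zvar_num: "zev \<xi> (zvar D i s) - u \<noteq> 0" "zev \<xi> (zvar D i s) + u \<noteq> 0"
proof -
  have "\<xi> k \<in> \<real>" for k
    using real by auto
  then have "Im (zev \<xi> (zvar D i s)) = 0"
    by (auto simp: zvar_def mon_eval_def complex_is_Real_iff)
  then show "zev \<xi> (zvar D i s) - u \<noteq> 0" "zev \<xi> (zvar D i s) + u \<noteq> 0"
    using nonreal by (auto simp: complex_eq_iff)
qed

text \<open>For real z all roots of \<open>Zbold\<close> are real, while \<open>u\<close> is
  not.\<close>

lemma zpv_Zbold: "zpv \<xi> (Zbold D i) u \<noteq> 0"
proof -
  have u: "u \<noteq> 0"
    using nonreal by auto
  have lin: "zpv \<xi> [:- zvar D i s, 1:] u = - (zev \<xi> (zvar D i s) - u)" for s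
    by (simp add: zpv_def)
  have quad: "zpv \<xi> [:- (zvar D i s)\<^sup>2, 0, 1:] u = - (zev \<xi> (zvar D i s) - u) * (zev \<xi> (zvar D i s) + u)" for s
    by (simp add: zpv_def power2_eq_square algebra_simps)
  have mon: "zpv \<xi> (Polynomial.monom 1 k) u = u ^ k" for k
    by (simp add: zpv_def poly_monom)
  show ?thesis
    using u zvar_num by (auto simp: Zbold_def zpv_mult zpv_prod lin quad mon)
qed

text \<open>At a node moved by \<open>tau\<close> the factor \<open>Zfac\<close> is only known to
  divide \<open>Zbold\<close>, and this is enough.\<close>

lemma zpv_Zpol: "i \<in> nodes D \<Longrightarrow> zpv \<xi> (Zpol D i) u \<noteq> 0"
proof (cases "tau_fixed D i")
  case True
  have "zpv \<xi> [:- zvar D i s, 1:] u = - (zev \<xi> (zvar D i s) - u)" for s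
    by (simp add: zpv_def)
  with True show ?thesis
    using zvar_num by (auto simp: Zpol_def zpv_prod)
next
  case False
  assume "i \<in> nodes D"
  with False have "Zbold D i = Zfac D i * poly_minus (Zfac D (tau D i))"
    using Z_fact by (auto simp: Z_factorization_def)
  then show ?thesis
    using zpv_Zbold[of i] False by (auto simp: Zpol_def zpv_mult)
qed

text \<open>It is the factorization at \<open>tau D i\<close>, not the one at \<open>i\<close>, that
  contains \<open>poly_minus\<close> of the factor chosen at \<open>i\<close>.\<close>

lemma zpv_Zpol_minus: "i \<in> nodes D \<Longrightarrow> \<not> tau_fixed D i \<Longrightarrow> zpv \<xi> (poly_minus (Zpol D i)) u \<noteq> 0"
proof -
  assume i: "i \<in> nodes D" "\<not> tau_fixed D i"
  then have "Zbold D (tau D i) = Zfac D (tau D i) * poly_minus (Zfac D i)"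
    using Z_fact tau_node[of i] tau_tau[of i] tau_fixed_tau[of i]
    unfolding Z_factorization_def by metis
  then show ?thesis
    using zpv_Zbold[of "tau D i"] i by (auto simp: Zpol_def zpv_mult)
qed

end

section \<open>The series \<open>H\<close> separate lattice points\<close>

definition Wbold_poly :: "lattice \<Rightarrow> nat \<Rightarrow> complex poly"
  where "Wbold_poly n i =
    (if tau_fixed D i then [:0, 1:] ^ theta D i * (\<Prod>r\<leftarrow>[1..<Suc (vfr D i)]. [:0, 1:]\<^sup>2 - [:(wnum n i r)\<^sup>2:])
     else (\<Prod>r\<leftarrow>[1..<Suc (vfr D i)]. [:0, 1:] - [:wnum n i r:]))"

definition Wbold_recip_num :: "lattice \<Rightarrow> nat \<Rightarrow> complex \<Rightarrow> complex fls"
  where "Wbold_recip_num n i c =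
    (if tau_fixed D i then recip_num c ^ theta D i *
       (\<Prod>r\<leftarrow>[1..<Suc (vfr D i)]. recip_num (c - wnum n i r) * recip_num (c + wnum n i r))
     else (\<Prod>r\<leftarrow>[1..<Suc (vfr D i)]. recip_num (c - wnum n i r)))"

text \<open>The polynomial Wbold(u + c), factored so that each linear factor meets its inverse in
  \<open>Wbold_recip_num\<close>.\<close>

definition Wbold_den :: "lattice \<Rightarrow> nat \<Rightarrow> complex \<Rightarrow> complex poly"
  where "Wbold_den n i c =
    (if tau_fixed D i then [:c, 1:] ^ theta D i *
       (\<Prod>r\<leftarrow>[1..<Suc (vfr D i)]. [:c - wnum n i r, 1:] * [:c + wnum n i r, 1:])
     else (\<Prod>r\<leftarrow>[1..<Suc (vfr D i)]. [:c - wnum n i r, 1:]))"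

lemma poly_Wbold_poly: "poly (Wbold_poly n i) u = Wbold_num n i u"
  by (simp add: Wbold_poly_def Wbold_num_def poly_prod_list_map del: upt_Suc)

lemma poly_Wbold_den: "poly (Wbold_den n i c) u = Wbold_num n i (u + c)"
proof -
  have *: "(u + c - w) * (u + c + w) = (u + c)\<^sup>2 - w\<^sup>2" "poly [:c, 1:] u = u + c"
    "poly [:c - w, 1:] u = u + c - w" "poly [:c + w, 1:] u = u + c + w" for w
    by (simp_all add: power2_eq_square algebra_simps)
  show ?thesis
    by (cases "tau_fixed D i")
      (simp_all only: Wbold_den_def Wbold_num_def poly_prod_list_map poly_mult poly_power * if_True if_False simp_thms)
qed

lemma Wbold_recip_den: "Wbold_recip_num n i c * fls_of_poly (Wbold_den n i c) = 1"
proof -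
  have pair: "recip_num (c - w) * recip_num (c + w) * fls_of_poly ([:c - w, 1:] * [:c + w, 1:]) = 1" for w
  proof -
    have "recip_num (c - w) * recip_num (c + w) * fls_of_poly ([:c - w, 1:] * [:c + w, 1:]) =
        (recip_num (c - w) * fls_of_poly [:c - w, 1:]) * (recip_num (c + w) * fls_of_poly [:c + w, 1:])"
      by (simp only: fls_of_poly_mult mult_ac)
    then show ?thesis
      by (simp only: recip_num_mult mult_1)
  qed
  have pow: "recip_num c ^ k * fls_of_poly ([:c, 1:] ^ k) = 1" for k
    by (simp only: fls_of_poly_power power_mult_distrib[symmetric] recip_num_mult power_one)
  show ?thesis
  proof (cases "tau_fixed D i")
    case True
    let ?P = "\<Prod>r\<leftarrow>[1..<Suc (vfr D i)]. recip_num (c - wnum n i r) * recip_num (c + wnum n i r)"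
    let ?Q = "\<Prod>r\<leftarrow>[1..<Suc (vfr D i)]. fls_of_poly ([:c - wnum n i r, 1:] * [:c + wnum n i r, 1:])"
    have "?P * ?Q = 1"
      by (rule prod_list_inverse) (rule pair)
    moreover have "Wbold_recip_num n i c * fls_of_poly (Wbold_den n i c) =
        (recip_num c ^ theta D i * fls_of_poly ([:c, 1:] ^ theta D i)) * (?P * ?Q)"
      unfolding Wbold_recip_num_def Wbold_den_def if_P[OF True] fls_of_poly_mult[of "_ ^ _"] fls_of_poly_prod_list
      by (simp only: mult_ac)
    ultimately show ?thesis
      by (simp only: pow mult_1)
  next
    case False
    then show ?thesis
      unfolding Wbold_recip_num_def Wbold_den_def if_not_P[OF False] fls_of_poly_prod_list
      by (intro prod_list_inverse recip_num_mult)
  qed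
qed

lemma dser_Wbold:
  assumes "i \<in> nodes D"
  shows "dser \<xi> (Wbold D i fls_X_inv) (\<lambda>n. fls_of_poly (Wbold_poly n i))"
proof (rule dser_cong)
  let ?\<phi> = "\<lambda>n. if tau_fixed D i then fls_X_inv ^ theta D i *
      (\<Prod>r\<leftarrow>[1..<Suc (vfr D i)]. fls_X_inv\<^sup>2 - (fls_const (wnum n i r))\<^sup>2)
    else (\<Prod>r\<leftarrow>[1..<Suc (vfr D i)]. fls_X_inv - fls_const (wnum n i r))"
  have w: "dser \<xi> (w_series D i r) (\<lambda>n. fls_const (wnum n i r))" if "1 \<le> r" "r \<le> vfr D i" for r
    using cser_w[OF assms that] by (simp add: cser_def)
  show "dser \<xi> (Wbold D i fls_X_inv) ?\<phi>"
    unfolding Wbold_def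
    by (cases "tau_fixed D i")
      (auto intro!: dser_mult dser_power dser_prod_list dser_diff dser_X_inv w simp del: upt_Suc)
  have "fls_of_poly [:0, 1:] = fls_X_inv"
    by (simp add: fls_of_poly_linear)
  then show "?\<phi> n = fls_of_poly (Wbold_poly n i)" for n
    by (simp add: Wbold_poly_def fls_of_poly_mult fls_of_poly_power fls_of_poly_prod_list fls_of_poly_diff
        fls_of_poly_linear fls_const_power del: upt_Suc)
qed

lemma dser_Wbold_recip:
  assumes "i \<in> nodes D"
  shows "dser \<xi> (Wbold_recip D i c) (\<lambda>n. Wbold_recip_num n i c)"
proof -
  have w: "dser \<xi> (recip_series (cst c - w_free D i r)) (\<lambda>n. recip_num (c - wnum n i r))"
    "dser \<xi> (recip_series (cst c + w_free D i r)) (\<lambda>n. recip_num (c + wnum n i r))"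
    if "1 \<le> r" "r \<le> vfr D i" for r
    using assms that by (intro dser_recip diag_diff diag_add diag_cst diag_w; simp)+
  show ?thesis
    unfolding Wbold_recip_def Wbold_recip_num_def
    by (cases "tau_fixed D i")
      (auto intro!: dser_mult dser_power dser_prod_list dser_recip[OF diag_cst] w simp del: upt_Suc)
qed

text \<open>A factor of H independent of the lattice point; being nonzero, it cancels when two
  points are compared.\<close>

definition H_prefactor :: "nat \<Rightarrow> complex fls"
  where "H_prefactor i = (1 + fls_const (of_int (wp D i) / 4) * fls_X) *
    (1 - fls_const (1 / 4) * fls_X\<^sup>2) ^ vtheta D i"

definition Zbold_num :: "(nat \<times> nat \<Rightarrow> complex) \<Rightarrow> nat \<Rightarrow> complex poly"
  where "Zbold_num \<xi> i = (\<Sum>k\<le>Polynomial.degree (Zbold D i).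
    Polynomial.monom (zev \<xi> (Polynomial.coeff (Zbold D i) k)) k)"

definition H_num :: "(nat \<times> nat \<Rightarrow> complex) \<Rightarrow> nat \<Rightarrow> lattice \<Rightarrow> complex fls"
  where "H_num \<xi> i n = H_prefactor i * fls_of_poly (Zbold_num \<xi> i)
    * Wbold_recip_num n i (- 1 / 2) * Wbold_recip_num n i (1 / 2)
    * (\<Prod>j\<leftarrow>[j\<leftarrow>node_list D. cij D i j = -1]. fls_of_poly (Wbold_poly n j))"

lemma H_prefactor_nonzero: "H_prefactor i \<noteq> 0"
proof -
  have "(1 + fls_const z * fls_X) $$ 0 = (1 :: complex)" for z
    by simp
  moreover have "(1 - fls_const z * fls_X\<^sup>2) $$ 0 = (1 :: complex)" for z
    by (simp add: power2_eq_square fls_X_times_conv_shift)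
  ultimately have "1 + fls_const z * fls_X \<noteq> 0" "1 - fls_const z * fls_X\<^sup>2 \<noteq> 0" for z :: complex
    by (metis fls_zero_nth zero_neq_one)+
  then show ?thesis
    by (simp add: H_prefactor_def)
qed

lemma poly_Zbold_num: "poly (Zbold_num \<xi> i) u = zpv \<xi> (Zbold D i) u"
  by (simp add: Zbold_num_def zpv_altdef poly_sum poly_monom)

lemma dser_H:
  assumes i: "i \<in> nodes D"
  shows "dser \<xi> (H_series D i) (H_num \<xi> i)"
proof -
  have "dser \<xi> (zeval (Zbold D i) fls_X_inv) (\<lambda>n. fls_of_poly (Zbold_num \<xi> i))"
    using dser_zeval[OF Cz_poly_Zbold[OF i] dser_X_inv]
    by (simp add: Zbold_num_def fls_of_poly_sum fls_of_poly_monom)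
  moreover have "dser \<xi> ((1 + num_series (of_int (wp D i) / 4) * fls_X) *
      (1 - num_series (1 / 4) * fls_X\<^sup>2) ^ vtheta D i) (\<lambda>n. H_prefactor i)"
    unfolding H_prefactor_def
    by (intro dser_mult dser_add dser_diff dser_power dser_1 dser_num dser_X)
  ultimately show ?thesis
    unfolding H_series_def H_num_def[abs_def]
    using i by (intro dser_mult dser_prod_list dser_Wbold dser_Wbold_recip) (auto simp: set_node_list)
qed

text \<open>Clearing denominators in the equation gives Z N(n) Q(m) = Z N(m) Q(n) for polynomials,
  with Q the denominators and N the product over the neighbours. At a half point neither Z nor N(n)
  vanishes, so a root of Q(n) is a root of Q(m).\<close>

lemma H_num_eq_transfers_poles:
  assumes eq: "H_num \<xi> i n = H_num \<xi> i m" and i: "i \<in> nodes D" and \<xi>: "range \<xi> \<subseteq> \<real>"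
    and u: "half_point u" and root: "Wbold_num n i (u - 1 / 2) * Wbold_num n i (u + 1 / 2) = 0"
  shows "Wbold_num m i (u - 1 / 2) * Wbold_num m i (u + 1 / 2) = 0"
proof -
  let ?js = "[j\<leftarrow>node_list D. cij D i j = -1]"
  define N where "N n = (\<Prod>j\<leftarrow>?js. Wbold_poly n j)" for n
  define Q where "Q n = Wbold_den n i (- 1 / 2) * Wbold_den n i (1 / 2)" for n
  define R where "R n = Wbold_recip_num n i (- 1 / 2) * Wbold_recip_num n i (1 / 2)" for n
  have RQ: "R n * fls_of_poly (Q n) = 1" for n
  proof -
    have "R n * fls_of_poly (Q n) =
        (Wbold_recip_num n i (- 1 / 2) * fls_of_poly (Wbold_den n i (- 1 / 2))) *
        (Wbold_recip_num n i (1 / 2) * fls_of_poly (Wbold_den n i (1 / 2)))"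
      unfolding R_def Q_def fls_of_poly_mult by (simp only: mult_ac)
    then show ?thesis
      by (simp only: Wbold_recip_den mult_1)
  qed
  define A where "A = H_prefactor i"
  define Z where "Z = Zbold_num \<xi> i"
  have H: "H_num \<xi> i n = A * (fls_of_poly (Z * N n) * R n)" for n
    unfolding H_num_def A_def Z_def N_def R_def fls_of_poly_mult fls_of_poly_prod_list
    by (simp only: mult_ac)
  have "fls_of_poly (Z * N n) * R n = fls_of_poly (Z * N m) * R m"
    using eq H_prefactor_nonzero[of i] unfolding H A_def by simp
  then have "fls_of_poly (Z * N n) * R n * fls_of_poly (Q n) * fls_of_poly (Q m) =
      fls_of_poly (Z * N m) * R m * fls_of_poly (Q n) * fls_of_poly (Q m)"
    by simp
  then have "fls_of_poly (Z * N n) * fls_of_poly (Q m) * (R n * fls_of_poly (Q n)) =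
      fls_of_poly (Z * N m) * fls_of_poly (Q n) * (R m * fls_of_poly (Q m))"
    by (simp only: mult_ac)
  then have "fls_of_poly (Z * N n * Q m) = fls_of_poly (Z * N m * Q n)"
    by (simp only: RQ mult_1_right fls_of_poly_mult)
  then have "Z * N n * Q m = Z * N m * Q n"
    by (simp only: fls_of_poly_inject)
  then have eq': "poly Z u * poly (N n) u * poly (Q m) u = poly Z u * poly (N m) u * poly (Q n) u"
    by (metis poly_mult)
  have Q: "poly (Q n) u = Wbold_num n i (u - 1 / 2) * Wbold_num n i (u + 1 / 2)" for n
    by (simp add: Q_def poly_Wbold_den)
  have "poly Z u \<noteq> 0"
    using zpv_Zbold[OF \<xi>, of u i] u by (simp add: Z_def poly_Zbold_num half_point_def)
  moreover have "poly (N n) u \<noteq> 0"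
    unfolding N_def poly_prod_list_map poly_Wbold_poly
    by (intro prod_list_nonzero Wbold_num_nonzero u)
  ultimately show ?thesis
    using eq' root unfolding Q by auto
qed

lemma Wbold_num_root: "(i, r) \<in> A_index D \<Longrightarrow> Wbold_num n i (pt n (i, r)) = 0"
  by (auto simp: Wbold_num_def prod_list_zero_iff A_index_def wnum_def image_iff simp del: upt_Suc)

text \<open>At a base node a nonzero root is \<plusminus> \<open>pt m (i, s)\<close> for some s,
  with imaginary part \<plusminus>s; the positive imaginary part r leaves only s = r and the plus
  sign.\<close>

lemma Wbold_num_root_unique:
  assumes i: "i \<in> tau_base D" and r: "1 \<le> r" and v: "Im v = real r" "Wbold_num m i v = 0"
  shows "v = pt m (i, r)"
proof -
  have "v \<noteq> 0"
    using r v by auto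
  then obtain s where s: "1 \<le> s" "v = pt m (i, s) \<or> v = - pt m (i, s)"
    using v(2) i
    by (auto simp: Wbold_num_def prod_list_zero_iff wnum_def power2_eq_iff split: if_splits simp del: upt_Suc)
  then have "s = r"
    using v(1) r by (auto simp: pt_def)
  then show ?thesis
    using s v(1) r by (auto simp: pt_def)
qed

text \<open>Let p and q be the coordinates of \<open>n\<close> and \<open>m\<close> at the same
  index. The pole of H at p + 1/2 allows q = p or q = p + 1, the pole at p - 1/2 allows q = p or q =
  p - 1; only both together force q = p.\<close>

lemma H_separates:
  assumes \<xi>: "range \<xi> \<subseteq> \<real>" and nm: "n \<in> base_lattice" "m \<in> base_lattice" "m \<noteq> n"
  shows "\<exists>i\<in>nodes D. \<exists>k. H_num \<xi> i m $$ k \<noteq> H_num \<xi> i n $$ k"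
proof -
  obtain k where k: "m k \<noteq> n k"
    using nm(3) by blast
  then have "k \<in> A_index D"
    using nm(1,2) unfolding base_lattice_def mem_Collect_eq by metis
  with k obtain i r where ir: "(i, r) \<in> A_index D" "n (i, r) \<noteq> m (i, r)"
    by (cases k) simp
  then have i: "i \<in> tau_base D" "i \<in> nodes D" and r: "1 \<le> r" "r \<le> vfr D i"
    by (auto simp: A_index_def base_node)
  have "H_num \<xi> i n \<noteq> H_num \<xi> i m"
  proof
    assume eq: "H_num \<xi> i n = H_num \<xi> i m"
    let ?p = "pt n (i, r)" and ?q = "pt m (i, r)"
    have hp: "half_point (?p - 1 / 2)" "half_point (?p + 1 / 2)"
      using half_point_wnum[OF i(2) r, of n] i by (simp_all add: wnum_def)
    have im: "Im ?p = real r"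
      by (simp add: pt_def)
    have "Wbold_num m i (?p + 1 / 2 - 1 / 2) * Wbold_num m i (?p + 1 / 2 + 1 / 2) = 0"
      using Wbold_num_root[OF ir(1), of n] by (intro H_num_eq_transfers_poles[OF eq i(2) \<xi> hp(2)]) simp
    then have "?p = ?q \<or> ?p + 1 = ?q"
      using Wbold_num_root_unique[OF i(1) r(1), of ?p m] Wbold_num_root_unique[OF i(1) r(1), of "?p + 1" m] im
      by (auto simp: add.assoc)
    moreover have "Wbold_num m i (?p - 1 / 2 - 1 / 2) * Wbold_num m i (?p - 1 / 2 + 1 / 2) = 0"
      using Wbold_num_root[OF ir(1), of n] by (intro H_num_eq_transfers_poles[OF eq i(2) \<xi> hp(1)]) simp
    then have "?p = ?q \<or> ?p - 1 = ?q"
      using Wbold_num_root_unique[OF i(1) r(1), of ?p m] Wbold_num_root_unique[OF i(1) r(1), of "?p - 1" m] im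
      by (auto simp: diff_diff_add)
    ultimately have "?p = ?q"
      by (auto simp: complex_eq_iff)
    then show False
      using ir by (simp add: pt_def)
  qed
  then show ?thesis
    using i by (metis fls_eqI)
qed

section \<open>The leading coefficients of the series \<open>B\<close>\<close>

lemma unit_half_inv:
  assumes "(i, r) \<in> A_index D"
  shows "unit_cser \<xi> (half_inv_series i r m)"
  unfolding half_inv_series_def
  by (rule unit_cserI[OF cser_const[OF diag_letters(2)[OF assms]]])
    (rule nonzero_imp_inverse_nonzero[OF pt_nonzero(3)[OF assms assms]])

lemma unit_minus_inv:
  assumes "i \<in> nodes D" "1 \<le> r" "r \<le> vfr D i" "1 \<le> s" "s \<le> vfr D i" "r \<noteq> s"
  shows "unit_cser \<xi> (minus_inv_series D i r s)"
proof (cases "i \<in> tau_base D")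
  case True
  then have rs: "(i, r) \<in> A_index D" "(i, s) \<in> A_index D"
    using assms by (auto intro: index_base)
  show ?thesis
    unfolding minus_inv_series_def if_P[OF True]
    by (rule unit_cserI[OF cser_const[OF diag_letters(4)[OF rs assms(6)]]])
      (rule nonzero_imp_inverse_nonzero[OF pt_nonzero(2)[OF rs assms(6)]])
next
  case False
  have rs: "(tau D i, vfr D i + 1 - s) \<in> A_index D" "(tau D i, vfr D i + 1 - r) \<in> A_index D"
    "vfr D i + 1 - s \<noteq> vfr D i + 1 - r"
    using assms False by (auto intro: index_reflect[simplified])
  show ?thesis
    unfolding minus_inv_series_def if_not_P[OF False]
    by (rule unit_cserI[OF cser_const[OF diag_letters(4)[OF rs]]])
      (rule nonzero_imp_inverse_nonzero[OF pt_nonzero(2)[OF rs]])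
qed

lemma unit_plus_inv:
  assumes "(i, r) \<in> A_index D" "(i, s) \<in> A_index D" "r \<noteq> s"
  shows "unit_cser \<xi> (plus_inv_series i r s)"
  unfolding plus_inv_series_def
  by (rule unit_cserI[OF cser_const[OF diag_letters(3)[OF assms]]])
    (rule nonzero_imp_inverse_nonzero[OF pt_nonzero(1)[OF assms]])

lemma unit_half_series: "unit_cser \<xi> half_series"
  by (rule unit_cserI[OF cser_num]) simp

lemma unit_Wdiff_inv:
  assumes "i \<in> nodes D" "1 \<le> r" "r \<le> vfr D i"
  shows "unit_cser \<xi> (Wdiff_inv D i r)"
proof (cases "tau_fixed D i")
  case True
  then have "(i, s) \<in> A_index D" if "1 \<le> s" "s \<le> vfr D i" for s
    using assms that by (intro index_base fixed_base)
  then show ?thesis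
    unfolding Wdiff_inv_def if_P[OF True] using assms
    by (intro unit_cser_mult unit_cser_power unit_cser_prod_list unit_half_inv unit_half_series
        unit_minus_inv unit_plus_inv) (auto simp del: upt_Suc)
next
  case False
  show ?thesis
    unfolding Wdiff_inv_def if_not_P[OF False] using assms
    by (intro unit_cser_prod_list unit_minus_inv) (auto simp del: upt_Suc)
qed

lemma half_point_nonzero: "half_point u \<Longrightarrow> u \<noteq> 0"
  by (auto simp: half_point_def)

context
  fixes i r :: nat
  assumes ir: "i \<in> nodes D" "1 \<le> r" "r \<le> vfr D i"
begin

lemma cser_w_half:
  "cser \<xi> (w_series D i r - half_series) (\<lambda>n. wnum n i r - 1 / 2)"
  "cser \<xi> (w_series D i r + half_series) (\<lambda>n. wnum n i r + 1 / 2)"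
  using ir by (auto intro!: cser_diff cser_add cser_w cser_num)

lemma unit_Wbold_at:
  "j \<in> nodes D \<Longrightarrow> unit_cser \<xi> (Wbold D j (w_series D i r - half_series))"
  "j \<in> nodes D \<Longrightarrow> unit_cser \<xi> (Wbold D j (w_series D i r + half_series))"
  by (intro unit_cserI[OF cser_Wbold[OF _ cser_w_half(1)]] Wbold_num_nonzero half_point_wnum ir; assumption)
    (intro unit_cserI[OF cser_Wbold[OF _ cser_w_half(2)]] Wbold_num_nonzero half_point_wnum ir; assumption)

lemma unit_Wbar_minus_at:
  assumes "j \<in> nodes D"
  shows "unit_cser \<xi> (Wbar_minus D j (w_series D i r - half_series))"
  unfolding Wbar_minus_def
proof (intro unit_cser_mult unit_cser_power)
  show "unit_cser \<xi> (w_series D i r - half_series)"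
    by (intro unit_cserI[OF cser_w_half(1)] half_point_nonzero half_point_wnum ir)
  show "unit_cser \<xi> (- 1)"
    by (rule unit_cserI[OF cser_uminus[OF cser_1]]) simp
  show "unit_cser \<xi> (Wpol D j (- (w_series D i r - half_series)))"
    by (intro unit_cserI[OF cser_Wpol[OF assms cser_uminus[OF cser_w_half(1)]]] Wpol_num_nonzero
        half_point_uminus half_point_wnum ir)
qed

lemma unit_Z_at:
  assumes "range \<xi> \<subseteq> \<real>" "Cz_poly f" "\<And>u. Im u \<noteq> 0 \<Longrightarrow> zpv \<xi> f u \<noteq> 0"
  shows "unit_cser \<xi> (zeval f (w_series D i r - half_series))"
    and "unit_cser \<xi> (zeval f (w_series D i r + half_series))"
  using half_point_wnum[OF ir] assms
  by (auto intro!: unit_cserI[OF cser_zeval[OF _ cser_w_half(1)]] unit_cserI[OF cser_zeval[OF _ cser_w_half(2)]]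
      simp: half_point_def)

lemma diag_recip_arg:
  "diag \<xi> (cst (1 / 2) - w_free D i r) (\<lambda>n. 1 / 2 - wnum n i r)"
  "diag \<xi> (cst (1 / 2) + w_free D i r) (\<lambda>n. 1 / 2 + wnum n i r)"
  using ir by (auto intro!: diag_diff diag_add diag_cst diag_w)

end

lemma arrow_nodes: "arrow D i j \<Longrightarrow> i \<in> nodes D \<and> j \<in> nodes D"
  using orient unfolding orientation_def by blast

text \<open>Tested on the delta function one step below \<open>n\<close> in direction
  \<open>(i, s)\<close>, lowering operators are told apart by their index, while raising operators
  and multiplications give 0.\<close>

lemma delta_lower:
  "delta (n((i, s) := n (i, s) - 1)) (lshift (EthInv i r) n) = of_bool (r = s)"
  "delta (n((i, s) := n (i, s) - 1)) (lshift (Eth i r) n) = 0"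
  "delta (n((i, s) := n (i, s) - 1)) n = 0"
proof -
  have "n((i, r) := n (i, r) - 1) = n((i, s) := n (i, s) - 1) \<longleftrightarrow> r = s"
    by (auto simp: fun_eq_iff split: if_splits)
  moreover have "n((i, r) := n (i, r) + 1) \<noteq> n((i, s) := n (i, s) - 1)"
  proof
    assume eq: "n((i, r) := n (i, r) + 1) = n((i, s) := n (i, s) - 1)"
    have "(n((i, r) := n (i, r) + 1)) (i, s) = n (i, s) - 1"
      by (simp only: eq fun_upd_same)
    then show False
      by (auto split: if_splits)
  qed
  moreover have "n \<noteq> n((i, s) := n (i, s) - 1)"
    by (auto simp: fun_eq_iff)
  ultimately show "delta (n((i, s) := n (i, s) - 1)) (lshift (EthInv i r) n) = of_bool (r = s)"
    "delta (n((i, s) := n (i, s) - 1)) (lshift (Eth i r) n) = 0"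
    "delta (n((i, s) := n (i, s) - 1)) n = 0"
    by (simp_all add: delta_def)
qed

text \<open>The first coefficient consists of lowering terms, raising terms and the term with
  \<open>theta\<close>, which acts diagonally. The entry in row \<open>n\<close> at the lowered
  neighbour is therefore minus the coefficient of a single \<open>EthInv\<close>, a product of
  factors that vanish nowhere.\<close>

lemma B_fixed_lowers:
  assumes \<xi>: "range \<xi> \<subseteq> \<real>" and i: "i \<in> nodes D" "tau_fixed D i" and s: "1 \<le> s" "s \<le> vfr D i"
  shows "B_series D i $$ 1 \<in> A_carrier \<and> act \<xi> (B_series D i $$ 1) (delta (n((i, s) := n (i, s) - 1))) n \<noteq> 0"
proof -
  have base: "i \<in> tau_base D" and v: "(i, r) \<in> A_index D" if "1 \<le> r" "r \<le> vfr D i" for r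
    using i that by (auto intro: fixed_base index_base)
  have gens: "EthInv i r \<in> A_gens D" "Eth i r \<in> A_gens D" if "1 \<le> r" "r \<le> vfr D i" for r
    using v[OF that] by (simp_all add: A_gens_iff)
  have kappa: "unit_cser \<xi> (kappa_inv D i r)" "unit_cser \<xi> (kappa_neg_inv D i r)"
    if "1 \<le> r" "r \<le> vfr D i" for r
  proof -
    have "wnum n i r \<noteq> 0" for n
      using Im_wnum[OF i(1) that, of n] by auto
    then have "unit_cser \<xi> (w_series D i r)"
      by (rule unit_cserI[OF cser_w[OF i(1) that]])
    then show "unit_cser \<xi> (kappa_inv D i r)" "unit_cser \<xi> (kappa_neg_inv D i r)"
      unfolding kappa_inv_def kappa_neg_inv_def using v[OF that]
      by (auto intro: unit_cser_mult unit_half_inv)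
  qed
  \<comment> \<open>\<open>P\<close> and \<open>Q\<close> are the summands without their final shift
    letter, so that all their coefficients act diagonally; \<open>T\<close> is the term with
    \<open>theta\<close>.\<close>
  define P where "P r = kappa_inv D i r ^ vtheta D i * zeval (Zpol D i) (w_series D i r - half_series)
        * recip_series (cst (1 / 2) - w_free D i r) * Wdiff_inv D i r
        * (\<Prod>j\<leftarrow>[j\<leftarrow>node_list D. arrow D j i]. Wbold D j (w_series D i r - half_series))
        * (\<Prod>j\<leftarrow>[j\<leftarrow>node_list D. arrow D i j \<and> tau_fixed D j].
             Wbar_minus D j (w_series D i r - half_series))" for r
  define Q where "Q r = kappa_neg_inv D i r ^ vtheta D i * zeval (Zbar_minus D i) (w_series D i r + half_series)
        * recip_series (cst (1 / 2) + w_free D i r) * Wdiff_inv D i r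
        * (\<Prod>j\<leftarrow>[j\<leftarrow>node_list D. arrow D i j \<and> \<not> tau_fixed D j].
             Wbold D j (w_series D i r + half_series))
        * (\<Prod>j\<leftarrow>[j\<leftarrow>node_list D. arrow D i j \<and> tau_fixed D j].
             Wpol D j (w_series D i r + half_series))" for r
  define T where "T = num_series (csqrt ((-1) ^ (wfr D i + (\<Sum>j | j \<in> tau_base D \<and> cij D i j = -1. vfr D j))))
      * of_nat (theta D i) * zeval (Zpol D i) 0 * fls_X * Wcirc_half_inv D i
      * (\<Prod>j\<leftarrow>[j\<leftarrow>node_list D. cij D i j = -1]. Wpol D j 0)"
  have B: "B_series D i $$ 1 = - (\<Sum>r=1..vfr D i. (P r * fls_const (free_gen (EthInv i r))) $$ 1)
      - (\<Sum>r=1..vfr D i. (Q r * fls_const (free_gen (Eth i r))) $$ 1) + T $$ 1"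
    using i base[OF s]
    by (simp add: B_series_def B_series_fixed_def P_def Q_def T_def eth_series_def eth_inv_series_def
        fls_nth_sum del: fls_mult_const_nth)
  have "\<exists>\<alpha>. lser \<xi> (P r) \<alpha> \<and> (\<forall>n. \<alpha> n \<noteq> 0)" if r: "1 \<le> r" "r \<le> vfr D i" for r
  proof -
    have "unit_cser \<xi> (Wdiff_inv D i r
        * (\<Prod>j\<leftarrow>[j\<leftarrow>node_list D. arrow D j i]. Wbold D j (w_series D i r - half_series))
        * (\<Prod>j\<leftarrow>[j\<leftarrow>node_list D. arrow D i j \<and> tau_fixed D j].
             Wbar_minus D j (w_series D i r - half_series)))"
      using i r arrow_nodes
      by (intro unit_cser_mult unit_cser_prod_list unit_Wdiff_inv unit_Wbold_at unit_Wbar_minus_at) auto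
    moreover have "unit_cser \<xi> (zeval (Zpol D i) (w_series D i r - half_series))"
      using i r \<xi> by (intro unit_Z_at(1) zpv_Zpol Cz_poly_Zpol)
    ultimately have "\<exists>\<alpha>. lser \<xi> ((kappa_inv D i r ^ vtheta D i
        * zeval (Zpol D i) (w_series D i r - half_series))
        * recip_series (cst (1 / 2) - w_free D i r) * (Wdiff_inv D i r
        * (\<Prod>j\<leftarrow>[j\<leftarrow>node_list D. arrow D j i]. Wbold D j (w_series D i r - half_series))
        * (\<Prod>j\<leftarrow>[j\<leftarrow>node_list D. arrow D i j \<and> tau_fixed D j].
             Wbar_minus D j (w_series D i r - half_series)))) \<alpha> \<and> (\<forall>n. \<alpha> n \<noteq> 0)"
      by (intro unit_lser[OF unit_cser_mult[OF unit_cser_power[OF kappa(1)[OF r]]]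
            diag_recip_arg(1)[OF i(1) r]])
    then    show ?thesis
      by (simp only: P_def mult.assoc)
  qed
  then obtain \<alpha> where \<alpha>: "\<And>r. 1 \<le> r \<Longrightarrow> r \<le> vfr D i \<Longrightarrow> lser \<xi> (P r) (\<alpha> r)"
    "\<And>r n. 1 \<le> r \<Longrightarrow> r \<le> vfr D i \<Longrightarrow> \<alpha> r n \<noteq> 0"
    by metis
  have "\<exists>\<beta>. lser \<xi> (Q r) \<beta>" if r: "1 \<le> r" "r \<le> vfr D i" for r
  proof -
    have "some_cser \<xi> (Wdiff_inv D i r
        * (\<Prod>j\<leftarrow>[j\<leftarrow>node_list D. arrow D i j \<and> \<not> tau_fixed D j].
             Wbold D j (w_series D i r + half_series))
        * (\<Prod>j\<leftarrow>[j\<leftarrow>node_list D. arrow D i j \<and> tau_fixed D j].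
             Wpol D j (w_series D i r + half_series)))"
      using i r arrow_nodes
      by (intro some_cser_mult some_cser_prod_list unit_some_cser[OF unit_Wdiff_inv]
          unit_some_cser[OF unit_Wbold_at(2)] some_cserI[OF cser_Wpol[OF _ cser_w_half(2)]]) auto
    moreover have "Cz_poly (Zbar_minus D i)"
      unfolding Zbar_minus_def by (intro Cz_poly_mult Cz_poly_monom Cz_poly_minus Cz_poly_Zpol i)
    then have "some_cser \<xi> (zeval (Zbar_minus D i) (w_series D i r + half_series))"
      using i r by (intro some_cserI[OF cser_zeval[OF _ cser_w_half(2)]])
    ultimately have "\<exists>\<beta>. lser \<xi> ((kappa_neg_inv D i r ^ vtheta D i
        * zeval (Zbar_minus D i) (w_series D i r + half_series))
        * recip_series (cst (1 / 2) + w_free D i r) * (Wdiff_inv D i r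
        * (\<Prod>j\<leftarrow>[j\<leftarrow>node_list D. arrow D i j \<and> \<not> tau_fixed D j].
             Wbold D j (w_series D i r + half_series))
        * (\<Prod>j\<leftarrow>[j\<leftarrow>node_list D. arrow D i j \<and> tau_fixed D j].
             Wpol D j (w_series D i r + half_series)))) \<beta>"
      by (intro some_lser[OF some_cser_mult[OF some_cser_power[OF unit_some_cser[OF kappa(2)[OF r]]]]
            lser_recip[OF diag_recip_arg(2)[OF i(1) r]]])
    then show ?thesis
      by (simp only: Q_def mult.assoc)
  qed
  then obtain \<beta> where \<beta>: "\<And>r. 1 \<le> r \<Longrightarrow> r \<le> vfr D i \<Longrightarrow> lser \<xi> (Q r) (\<beta> r)"
    by metis
  obtain \<gamma> where \<gamma>: "lser \<xi> T \<gamma>"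
  proof -
    have "some_cser \<xi> (Wcirc_half_inv D i)"
      unfolding Wcirc_half_inv_def
    proof (intro some_cser_prod_list)
      fix r assume "r \<in> set [1..<Suc (vfr D i)]"
      then have "unit_cser \<xi> (half_inv_series i r (-1) * half_inv_series i r 1)"
        by (intro unit_cser_mult unit_half_inv v) auto
      then show "some_cser \<xi> (- (half_inv_series i r (-1) * half_inv_series i r 1))"
        unfolding unit_cser_def some_cser_def using cser_uminus by blast
    qed
    moreover have "some_cser \<xi> (\<Prod>j\<leftarrow>[j\<leftarrow>node_list D. cij D i j = -1]. Wpol D j 0)"
      by (intro some_cser_prod_list some_cserI[OF cser_Wpol[OF _ cser_0]]) (auto simp: set_node_list)
    ultimately have "\<exists>\<gamma>. lser \<xi> ((num_series (csqrt ((-1) ^ (wfr D i + (\<Sum>j | j \<in> tau_base D \<and> cij D i j = -1. vfr D j))))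
      * of_nat (theta D i) * zeval (Zpol D i) 0) * fls_X * (Wcirc_half_inv D i
      * (\<Prod>j\<leftarrow>[j\<leftarrow>node_list D. cij D i j = -1]. Wpol D j 0))) \<gamma>"
      using i by (intro some_lser[OF some_cser_mult[OF some_cser_mult[OF some_cserI[OF cser_num] some_cser_of_nat]
            some_cserI[OF cser_zeval[OF Cz_poly_Zpol cser_0]]] lser_X] some_cser_mult)
    then show ?thesis
      using that by (auto simp only: T_def mult.assoc)
  qed
  let ?F = "delta (n((i, s) := n (i, s) - 1))"
  have "B_series D i $$ 1 \<in> A_carrier"
    unfolding B using lser_shift(1)[OF \<alpha>(1) gens(1)] lser_shift(1)[OF \<beta> gens(2)] lser_diag[OF \<gamma>]
    by (intro free_carrier_add free_carrier_diff free_carrier_uminus free_carrier_sum)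
      (auto simp: diag_def simp del: fls_mult_const_nth)
  moreover have "act \<xi> (B_series D i $$ 1) ?F n = - \<alpha> s n"
  proof -
    have "act \<xi> (T $$ 1) ?F n = 0"
      using lser_diag[OF \<gamma>] by (simp add: diag_def delta_lower)
    moreover have "act \<xi> ((Q r * fls_const (free_gen (Eth i r))) $$ 1) ?F n = 0" if "r \<in> {1..vfr D i}" for r
      using lser_shift(2)[OF \<beta> gens(2), of r r ?F n] that by (simp only: delta_lower atLeastAtMost_iff) simp
    moreover have "act \<xi> ((P r * fls_const (free_gen (EthInv i r))) $$ 1) ?F n = \<alpha> r n * of_bool (r = s)"
      if "r \<in> {1..vfr D i}" for r
      using lser_shift(2)[OF \<alpha>(1) gens(1), of r r ?F n] that by (simp only: delta_lower atLeastAtMost_iff) simp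
    ultimately show ?thesis
      unfolding B act_add act_diff act_uminus act_sum
      using sum_of_bool_pick[of "{1..vfr D i}" s "\<lambda>r. \<alpha> r n"] s by (simp del: fls_mult_const_nth)
  qed
  ultimately show ?thesis
    using \<alpha>(2)[OF s] by simp
qed

text \<open>At a representative both sums lower, since \<open>eth_series\<close> at
  \<open>tau D i\<close> and r is \<open>EthInv i (vfr D i + 1 - r)\<close>. The first sum covers
  the indices up to \<open>zeta D i\<close>, the second those above it because
  \<open>zeta D (tau D i) = vfr D i - zeta D i\<close>; each \<open>s\<close> occurs exactly once,
  so nothing can cancel.\<close>

lemma B_moved_lowers:
  assumes \<xi>: "range \<xi> \<subseteq> \<real>" and i: "i \<in> reps D" and s: "1 \<le> s" "s \<le> vfr D i"
  shows "B_series D i $$ 1 \<in> A_carrier \<and> act \<xi> (B_series D i $$ 1) (delta (n((i, s) := n (i, s) - 1))) n \<noteq> 0"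
proof -
  have base: "i \<in> tau_base D" "i \<in> nodes D" "\<not> tau_fixed D i"
    using i rep_iff base_node by auto
  let ?i = "tau D i"
  have ti: "?i \<in> nodes D" "?i \<notin> tau_base D" "\<not> tau_fixed D ?i" "vfr D ?i = vfr D i" "tau D ?i = i"
    using base tau_rep_not_base[OF i] by (auto simp: tau_node tau_fixed_tau vfr_tau tau_tau)
  have z: "zeta D i \<le> vfr D i" "zeta D ?i = vfr D i - zeta D i"
    using zeta_le base zeta_tau[OF i] by auto
  let ?v = "\<lambda>r. vfr D i + 1 - r"
  have gens: "EthInv i r \<in> A_gens D" if "1 \<le> r" "r \<le> vfr D i" for r
    using base that by (simp add: A_gens_iff index_base)
  define P where "P r = zeval (Zpol D i) (w_series D i r - half_series)
        * recip_series (cst (1 / 2) - w_free D i r) * Wdiff_inv D i r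
        * (\<Prod>j\<leftarrow>[j\<leftarrow>node_list D. arrow D j i]. Wbold D j (w_series D i r - half_series))" for r
  define Q where "Q r = zeval (poly_minus (Zpol D i)) (w_series D ?i r + half_series)
        * recip_series (cst (1 / 2) + w_free D ?i r) * Wdiff_inv D ?i r
        * (\<Prod>j\<leftarrow>[j\<leftarrow>node_list D. arrow D ?i (tau D j)].
             Wbold D (tau D j) (w_series D ?i r + half_series))" for r
  have B: "B_series D i $$ 1 = - (\<Sum>r=1..zeta D i. (P r * fls_const (free_gen (EthInv i r))) $$ 1)
      - (\<Sum>r=1..zeta D ?i. (Q r * fls_const (free_gen (EthInv i (?v r)))) $$ 1)"
    using base ti
    by (simp add: B_series_def B_series_moved_def P_def Q_def eth_series_def eth_inv_series_def
        fls_nth_sum del: fls_mult_const_nth)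
  have "\<exists>\<alpha>. lser \<xi> (P r) \<alpha> \<and> (\<forall>n. \<alpha> n \<noteq> 0)" if r: "1 \<le> r" "r \<le> vfr D i" for r
  proof -
    have "unit_cser \<xi> (Wdiff_inv D i r
        * (\<Prod>j\<leftarrow>[j\<leftarrow>node_list D. arrow D j i]. Wbold D j (w_series D i r - half_series)))"
      using base r arrow_nodes
      by (intro unit_cser_mult unit_cser_prod_list unit_Wdiff_inv unit_Wbold_at) auto
    moreover have "unit_cser \<xi> (zeval (Zpol D i) (w_series D i r - half_series))"
      using base r \<xi> by (intro unit_Z_at(1) zpv_Zpol Cz_poly_Zpol)
    ultimately have "\<exists>\<alpha>. lser \<xi> (zeval (Zpol D i) (w_series D i r - half_series)
        * recip_series (cst (1 / 2) - w_free D i r) * (Wdiff_inv D i r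
        * (\<Prod>j\<leftarrow>[j\<leftarrow>node_list D. arrow D j i]. Wbold D j (w_series D i r - half_series)))) \<alpha> \<and>
        (\<forall>n. \<alpha> n \<noteq> 0)"
      by (intro unit_lser[OF _ diag_recip_arg(1)[OF base(2) r]])
    then    show ?thesis
      by (simp only: P_def mult.assoc)
  qed
  then obtain \<alpha> where \<alpha>: "\<And>r. 1 \<le> r \<Longrightarrow> r \<le> vfr D i \<Longrightarrow> lser \<xi> (P r) (\<alpha> r)"
    "\<And>r n. 1 \<le> r \<Longrightarrow> r \<le> vfr D i \<Longrightarrow> \<alpha> r n \<noteq> 0"
    by metis
  have "\<exists>\<beta>. lser \<xi> (Q r) \<beta> \<and> (\<forall>n. \<beta> n \<noteq> 0)" if r: "1 \<le> r" "r \<le> vfr D i" for r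
  proof -
    have r': "r \<le> vfr D ?i"
      using r ti by simp
    have "unit_cser \<xi> (Wdiff_inv D ?i r
        * (\<Prod>j\<leftarrow>[j\<leftarrow>node_list D. arrow D ?i (tau D j)].
             Wbold D (tau D j) (w_series D ?i r + half_series)))"
      using ti r r' arrow_nodes
      by (intro unit_cser_mult unit_cser_prod_list unit_Wdiff_inv unit_Wbold_at(2)) auto
    moreover have "unit_cser \<xi> (zeval (poly_minus (Zpol D i)) (w_series D ?i r + half_series))"
      using base ti r r' \<xi> by (intro unit_Z_at(2) zpv_Zpol_minus Cz_poly_minus Cz_poly_Zpol)
    ultimately have "\<exists>\<alpha>. lser \<xi> (zeval (poly_minus (Zpol D i)) (w_series D ?i r + half_series)
        * recip_series (cst (1 / 2) + w_free D ?i r) * (Wdiff_inv D ?i r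
        * (\<Prod>j\<leftarrow>[j\<leftarrow>node_list D. arrow D ?i (tau D j)].
             Wbold D (tau D j) (w_series D ?i r + half_series)))) \<alpha> \<and> (\<forall>n. \<alpha> n \<noteq> 0)"
      by (intro unit_lser[OF _ diag_recip_arg(2)[OF ti(1) r(1) r']])
    then    show ?thesis
      by (simp only: Q_def mult.assoc)
  qed
  then obtain \<beta> where \<beta>: "\<And>r. 1 \<le> r \<Longrightarrow> r \<le> vfr D i \<Longrightarrow> lser \<xi> (Q r) (\<beta> r)"
    "\<And>r n. 1 \<le> r \<Longrightarrow> r \<le> vfr D i \<Longrightarrow> \<beta> r n \<noteq> 0"
    by metis
  let ?F = "delta (n((i, s) := n (i, s) - 1))"
  have "B_series D i $$ 1 \<in> A_carrier"
    unfolding B using lser_shift(1)[OF \<alpha>(1) gens] lser_shift(1)[OF \<beta>(1) gens] z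
    by (intro free_carrier_diff free_carrier_uminus free_carrier_sum) (auto simp del: fls_mult_const_nth)
  moreover have "act \<xi> (B_series D i $$ 1) ?F n = - (if s \<le> zeta D i then \<alpha> s n else \<beta> (?v s) n)"
  proof -
    have P: "(\<Sum>r=1..zeta D i. act \<xi> ((P r * fls_const (free_gen (EthInv i r))) $$ 1) ?F n) =
        (\<Sum>r=1..zeta D i. \<alpha> r n * of_bool (r = s))"
    proof (intro sum.cong refl)
      fix r assume "r \<in> {1..zeta D i}"
      then have r: "1 \<le> r" "r \<le> vfr D i"
        using z by auto
      show "act \<xi> ((P r * fls_const (free_gen (EthInv i r))) $$ 1) ?F n = \<alpha> r n * of_bool (r = s)"
        using lser_shift(2)[OF \<alpha>(1)[OF r] gens[OF r], of ?F n] by (simp only: delta_lower lcoef.simps)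
    qed
    have Q: "(\<Sum>r=1..zeta D ?i. act \<xi> ((Q r * fls_const (free_gen (EthInv i (?v r)))) $$ 1) ?F n) =
        (\<Sum>r=1..zeta D ?i. \<beta> r n * of_bool (r = ?v s))"
    proof (intro sum.cong refl)
      fix r assume "r \<in> {1..zeta D ?i}"
      then have r: "1 \<le> r" "r \<le> vfr D i" and v: "1 \<le> ?v r" "?v r \<le> vfr D i"
        using z by auto
      have "act \<xi> ((Q r * fls_const (free_gen (EthInv i (?v r)))) $$ 1) ?F n = \<beta> r n * of_bool (?v r = s)"
        using lser_shift(2)[OF \<beta>(1)[OF r] gens[OF v], of ?F n] by (simp only: delta_lower lcoef.simps)
      \<comment> \<open>Truncated subtraction is harmless: \<open>r\<close> and \<open>s\<close> lie
        between 1 and \<open>vfr D i\<close>, where the reflection is an involution.\<close>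
      also have "?v r = s \<longleftrightarrow> r = ?v s"
        using r s by auto
      finally show "act \<xi> ((Q r * fls_const (free_gen (EthInv i (?v r)))) $$ 1) ?F n = \<beta> r n * of_bool (r = ?v s)" .
    qed
    have *: "act \<xi> (B_series D i $$ 1) ?F n =
        - (\<Sum>r=1..zeta D i. \<alpha> r n * of_bool (r = s)) - (\<Sum>r=1..zeta D ?i. \<beta> r n * of_bool (r = ?v s))"
      unfolding B act_diff act_uminus act_sum P Q ..
    show ?thesis
    proof (cases "s \<le> zeta D i")
      case True
      have "(\<Sum>r=1..zeta D ?i. \<beta> r n * of_bool (r = ?v s)) = 0"
        using True z s by (intro sum.neutral) auto
      then show ?thesis
        using * True s sum_of_bool_pick[of "{1..zeta D i}" s "\<lambda>r. \<alpha> r n"] by simp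
    next
      case False
      have "(\<Sum>r=1..zeta D i. \<alpha> r n * of_bool (r = s)) = 0"
        using False by (intro sum.neutral) auto
      moreover have "(\<Sum>r=1..zeta D ?i. \<beta> r n * of_bool (r = ?v s)) = \<beta> (?v s) n"
        using False s z by (intro sum_of_bool_pick) auto
      ultimately show ?thesis
        using * False by simp
    qed
  qed
  ultimately show ?thesis
    using \<alpha>(2)[OF s] \<beta>(2)[of "?v s"] s by auto
qed

lemma B_lowers:
  assumes "range \<xi> \<subseteq> \<real>" "(i, s) \<in> A_index D"
  shows "B_series D i $$ 1 \<in> A_carrier \<and> act \<xi> (B_series D i $$ 1) (delta (n((i, s) := n (i, s) - 1))) n \<noteq> 0"
  using assms B_fixed_lowers[of \<xi> i s n] B_moved_lowers[of \<xi> i s n] base_node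
  by (cases "tau_fixed D i") (auto simp: A_index_def rep_iff)

text \<open>Membership of the coefficients in the carrier is a premise of \<open>H\<close> and
  \<open>B\<close> because it is established together with their action, for just those coefficients
  that are used.\<close>

lemma commutant_of_H_B:
  assumes p: "p \<in> A_carrier"
    and H: "\<And>i k. i \<in> nodes D \<Longrightarrow> H_series D i $$ k \<in> A_carrier \<Longrightarrow> p * (H_series D i $$ k) \<approx> H_series D i $$ k * p"
    and B: "\<And>i. i \<in> nodes D \<Longrightarrow> B_series D i $$ 1 \<in> A_carrier \<Longrightarrow> p * (B_series D i $$ 1) \<approx> B_series D i $$ 1 * p"
  shows "\<exists>c\<in>carrier (Cz D). p \<approx> scal c"
proof (rule commutant_scalar[OF finite_index p])
  fix \<xi> :: "nat \<times> nat \<Rightarrow> complex" and n m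
  assume \<xi>: "range \<xi> \<subseteq> \<real>" and nm: "n \<in> base_lattice" "m \<in> base_lattice" "m \<noteq> n"
  obtain i k where ik: "i \<in> nodes D" "H_num \<xi> i m $$ k \<noteq> H_num \<xi> i n $$ k"
    using H_separates[OF \<xi> nm] by blast
  have "diag \<xi> (H_series D i $$ k) (\<lambda>n. H_num \<xi> i n $$ k)"
    using dser_H[OF ik(1)] by (simp add: dser_def)
  then show "\<exists>h \<phi>. p * h \<approx> h * p \<and> (\<forall>F n. act \<xi> h F n = \<phi> n * F n) \<and> \<phi> m \<noteq> \<phi> n"
    using H[OF ik(1), of k] ik(2) unfolding diag_def
    by (intro exI[of _ "H_series D i $$ k"] exI[of _ "\<lambda>n. H_num \<xi> i n $$ k"]) blast
next
  fix \<xi> :: "nat \<times> nat \<Rightarrow> complex" and n k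
  assume \<xi>: "range \<xi> \<subseteq> \<real>" and k: "k \<in> A_index D"
  obtain i s where ks: "k = (i, s)"
    by (cases k)
  then have "i \<in> nodes D"
    using k ks base_node by (auto simp: A_index_def)
  then show "\<exists>b\<in>A_carrier. p * b \<approx> b * p \<and> act \<xi> b (delta (n(k := n k - 1))) n \<noteq> 0"
    using B_lowers[OF \<xi>, of i s n] B k ks by (intro bexI[of _ "B_series D i $$ 1"]) auto
qed

end

section \<open>The center\<close>

text \<open>The isomorphism is the explicit map on constants, so the center is identified with their
  image and not merely with an abstract polynomial ring. Surjectivity comes from
  \<open>commutant_of_H_B\<close>, injectivity from \<open>scal_in_ideal_iff\<close>.\<close>

theorem proposition3:
  fixes D :: satake and \<Phi> :: "yletter free set \<Rightarrow> aletter free set"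
  assumes "quasi_split_satake D" and "orbit_reps D"
    and "dominant D (lam D)" and "tau_invariant D (lam D)"
    and "even_coweight D (mu D)" and "spherical D (mu D)"
    and "difference_coroots D"
    and "parity_condition D"
    and "zeta_ok D" and "orientation D" and "Z_factorization D"
    and "truncation_hom D \<Phi>"
  shows "(\<lambda>c. A_class D (scal c)) \<in> ring_iso (Cz D)
    ((truncated_iYangian D \<Phi>)\<lparr>carrier := ring_center (truncated_iYangian D \<Phi>)\<rparr>)"
proof -
  interpret satake_data D
    by unfold_locales fact+
  let ?A = "A_alg D" and ?T = "truncated_iYangian D \<Phi>"
  note cong = cls_eq_iff[folded A_class_def] and mult = cls_mult[folded A_class_def A_alg_def]
    and add = cls_add[folded A_class_def A_alg_def] and one = cls_1[folded A_class_def A_alg_def]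
  have A_carrier: "carrier ?A = A_class D ` A_carrier"
    using carrier_presented by (simp add: A_alg_def A_class_def)
  have hom: "\<Phi> \<in> ring_hom (iYz D) ?A"
    and \<Phi>_scal: "\<And>c. c \<in> carrier (Cz D) \<Longrightarrow> \<Phi> (iYz_class D (scal c)) = A_class D (scal c)"
    and \<Phi>_H: "\<And>i r. i \<in> nodes D \<Longrightarrow> \<Phi> (iYz_class D (Hgen i r)) = A_class D (H_series D i $$ r)"
    and \<Phi>_B: "\<And>i s. i \<in> nodes D \<Longrightarrow> 1 \<le> s \<Longrightarrow> \<Phi> (iYz_class D (Bgen i s)) = A_class D (B_series D i $$ int s)"
    using assms(12) by (auto simp: truncation_hom_def)
  have Y: "iYz_class D y \<in> carrier (iYz D)" if "y \<in> free_carrier (iY_gens D)" for y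
    using class_in_carrier[OF that] by (simp add: iYz_class_def iYz_def shifted_iYangian_def)
  have T: "carrier ?T = \<Phi> ` carrier (iYz D)" "(\<otimes>\<^bsub>?T\<^esub>) = (\<otimes>\<^bsub>?A\<^esub>)" "(\<oplus>\<^bsub>?T\<^esub>) = (\<oplus>\<^bsub>?A\<^esub>)" "\<one>\<^bsub>?T\<^esub> = \<one>\<^bsub>?A\<^esub>"
    by (simp_all add: truncated_iYangian_def)
  have T_lift: "\<exists>p\<in>A_carrier. x = A_class D p" if "x \<in> carrier ?T" for x
  proof -
    have "x \<in> carrier ?A"
      using that ring_hom_closed[OF hom] by (auto simp: T)
    then show ?thesis
      using A_carrier by blast
  qed
  have Cz_ops: "\<one>\<^bsub>Cz D\<^esub> = 1" "c \<otimes>\<^bsub>Cz D\<^esub> c' = c * c'" "c \<oplus>\<^bsub>Cz D\<^esub> c' = c + c'" for c c'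
    by (simp_all add: Cz_def subring_record_def)
  \<comment> \<open>\<open>\<Phi>\<close> sends the class of a constant to the class of the same
    constant, so all constants lie in its image.\<close>
  have scal_T: "A_class D (scal c) \<in> carrier ?T" if "c \<in> carrier (Cz D)" for c
    using Y[OF free_carrier_scal[OF that]] \<Phi>_scal[OF that] by (auto simp: T intro: image_eqI[OF sym])
  have H_T: "A_class D (H_series D i $$ r) \<in> carrier ?T" if "i \<in> nodes D" for i r
  proof -
    have "Hl i r \<in> iY_gens D"
      using that by (auto simp: iY_gens_def)
    from Y[OF free_carrier_gen[OF this]] show ?thesis
      using \<Phi>_H[OF that, of r] by (auto simp: T intro: image_eqI[OF sym])
  qed
  have B_T: "A_class D (B_series D i $$ 1) \<in> carrier ?T" if "i \<in> nodes D" for i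
  proof -
    have "Bl i 1 \<in> iY_gens D"
      using that by (auto simp: iY_gens_def)
    from Y[OF free_carrier_gen[OF this]] show ?thesis
      using \<Phi>_B[OF that, of 1] by (auto simp: T intro: image_eqI[OF sym])
  qed
  have "ring_center ?T = (\<lambda>c. A_class D (scal c)) ` carrier (Cz D)"
  proof (intro equalityI subsetI)
    fix x assume x: "x \<in> ring_center ?T"
    then have xT: "x \<in> carrier ?T" and comm: "\<And>y. y \<in> carrier ?T \<Longrightarrow> x \<otimes>\<^bsub>?A\<^esub> y = y \<otimes>\<^bsub>?A\<^esub> x"
      by (auto simp: ring_center_def T)
    obtain p where p: "p \<in> A_carrier" "x = A_class D p"
      using T_lift[OF xT] by blast
    \<comment> \<open>Equality of classes is congruence of representatives, so centrality becomes a
      family of congruences for one fixed lift \<open>p\<close>.\<close>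
    have comm': "p * q \<approx> q * p" if "q \<in> A_carrier" "A_class D q \<in> carrier ?T" for q
      using comm[OF that(2)] p that(1) by (simp add: mult cong free_carrier_mult)
    obtain c where "c \<in> carrier (Cz D)" "p \<approx> scal c"
      using commutant_of_H_B[OF p(1)] comm' H_T B_T by blast
    then have "x = A_class D (scal c)"
      using p cong[of p "scal c"] by (simp add: free_carrier_scal)
    then show "x \<in> (\<lambda>c. A_class D (scal c)) ` carrier (Cz D)"
      using \<open>c \<in> carrier (Cz D)\<close> by blast
  next
    \<comment> \<open>Constants are central already in the free algebra.\<close>
    fix x assume "x \<in> (\<lambda>c. A_class D (scal c)) ` carrier (Cz D)"
    then obtain c where c: "c \<in> carrier (Cz D)" "x = A_class D (scal c)"
      by blast
    have "x \<otimes>\<^bsub>?T\<^esub> y = y \<otimes>\<^bsub>?T\<^esub> x" if y: "y \<in> carrier ?T" for y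
    proof -
      obtain q where "q \<in> A_carrier" "y = A_class D q"
        using T_lift[OF y] by blast
      then show ?thesis
        using c by (simp add: T mult free_carrier_scal scal_commute)
    qed
    then show "x \<in> ring_center ?T"
      using c scal_T by (auto simp: ring_center_def)
  qed
  moreover have "inj_on (\<lambda>c. A_class D (scal c)) (carrier (Cz D))"
  proof (rule inj_onI)
    fix c c' assume c: "c \<in> carrier (Cz D)" "c' \<in> carrier (Cz D)" "A_class D (scal c) = A_class D (scal c')"
    then have "scal (c - c') \<in> rel_ideal"
      using cong[of "scal c" "scal c'"] by (simp add: free_carrier_scal cong_def scal_diff)
    then show "c = c'"
      by (simp add: scal_in_ideal_iff)
  qed
  moreover have "(\<lambda>c. A_class D (scal c)) \<in> ring_hom (Cz D) (?T\<lparr>carrier := ring_center ?T\<rparr>)"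
  proof (rule ring_hom_memI)
    fix c c' assume c: "c \<in> carrier (Cz D)" "c' \<in> carrier (Cz D)"
    show "A_class D (scal c) \<in> carrier (?T\<lparr>carrier := ring_center ?T\<rparr>)"
      using c calculation by auto
    show "A_class D (scal (c \<otimes>\<^bsub>Cz D\<^esub> c')) =
        A_class D (scal c) \<otimes>\<^bsub>?T\<lparr>carrier := ring_center ?T\<rparr>\<^esub> A_class D (scal c')"
      using c by (simp add: T mult free_carrier_scal scal_mult Cz_ops)
    show "A_class D (scal (c \<oplus>\<^bsub>Cz D\<^esub> c')) =
        A_class D (scal c) \<oplus>\<^bsub>?T\<lparr>carrier := ring_center ?T\<rparr>\<^esub> A_class D (scal c')"
      using c by (simp add: T add free_carrier_scal scal_add Cz_ops)
  next
    show "A_class D (scal \<one>\<^bsub>Cz D\<^esub>) = \<one>\<^bsub>?T\<lparr>carrier := ring_center ?T\<rparr>\<^esub>"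
      by (simp add: T one[symmetric] scal_1 Cz_ops)
  qed
  ultimately show ?thesis
    by (simp add: ring_iso_def bij_betw_def)
qed

end
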